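(* Let $\mathcal K$ be a nontrivial minor-closed family of edge-weighted graphs and let $p>0$ be a fixed integer. There is a constant $c$ with the following property. For any $0<\varepsilon<1/2$ and any $G\in\mathcal K$, applying the local-search algorithm below to the metric completion of $G$, with an $n$-element client set $C\subseteq V(G)$, a positive integer $k$, cost function $$\mathrm{cost}(S)=\sum_{x\in C}\Big(\min_{u\in S}\mathrm{dist}(x,u)\Big)^p,$$ and neighborhood parameter $s=1/\varepsilon^{c}$, yields a solution $S$ with $\mathrm{cost}(S)\le(1+\varepsilon)\min\{\mathrm{cost}(S^* ): S^*\subseteq V(G),\ |S^*|\le k\}$.
   Context: A minor-closed family of graphs is nontrivial if it omits at least one graph. Edge weights are nonnegative. The metric completion of $G$ is the metric space on $V(G)$ where $\mathrm{dist}(u,v)$ is the length of a shortest $u$-to-$v$ path in $G$. The local-search algorithm (with inputs a metric space, a cost function, an $n$-element client set $C$, $\varepsilon>0$, and positive integers $k$ and $s$): start with $S$ an arbitrary set of $k$ points of the space; while there exists a set $S'$ of points with $|S'|\le k$, $|S\setminus S'|+|S'\setminus S|\le s$ and $\mathrm{cost}(S')\le(1-\varepsilon/n)\,\mathrm{cost}(S)$, replace $S$ by $S'$; output $S$. *)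

theory Defs
  imports "Graph_Theory.Graph_Theory"
begin

text \<open>
  A finite simple undirected graph is a \<^locale>\<open>pair_graph\<close>: the edge \<open>uv\<close> is the pair of
  opposite arcs \<open>(u, v)\<close> and \<open>(v, u)\<close>. Values of a weight function outside the arcs are irrelevant.
\<close>

type_synonym 'v wgraph = "'v pair_pre_digraph \<times> ('v \<times> 'v) weight_fun"

definition edge_weighted_graph :: "'v wgraph \<Rightarrow> bool" where
  "edge_weighted_graph \<G> \<longleftrightarrow> (case \<G> of (G, w) \<Rightarrow>
     pair_graph G \<and> (\<forall>(u, v) \<in> parcs G. 0 \<le> w (u, v) \<and> w (u, v) = w (v, u)))"

text \<open>
  Minors by branch sets: \<open>H\<close> is obtained, up to isomorphism, from a subgraph of \<open>G\<close> by contracting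
  the connected vertex sets \<open>B x\<close>. The library's \<open>connected\<close> includes nonemptiness.
\<close>

definition is_minor :: "'a pair_pre_digraph \<Rightarrow> 'b pair_pre_digraph \<Rightarrow> bool" where
  "is_minor H G \<longleftrightarrow> (\<exists>B.
     (\<forall>x \<in> pverts H. B x \<subseteq> pverts G \<and> Digraph_Component.connected (with_proj G \<restriction> B x)) \<and>
     (\<forall>x \<in> pverts H. \<forall>y \<in> pverts H. x \<noteq> y \<longrightarrow> B x \<inter> B y = {}) \<and>
     (\<forall>(x, y) \<in> parcs H. \<exists>u \<in> B x. \<exists>v \<in> B y. (u, v) \<in> parcs G))"

text \<open>
  Being a minor and being omitted concern the underlying graphs only. For instance, the family of
  all graphs with weights at most 1 is not nontrivial, and for a minor-closed family \<open>\<F>\<close> of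
  unweighted graphs the set of all weightings of members of \<open>\<F>\<close> is minor-closed.
\<close>

definition minor_closed :: "'v wgraph set \<Rightarrow> bool" where
  "minor_closed \<K> \<longleftrightarrow> (\<forall>G \<in> fst ` \<K>. \<forall>H. pair_graph H \<and> is_minor H G \<longrightarrow> H \<in> fst ` \<K>)"

definition nontrivial_family :: "'v wgraph set \<Rightarrow> bool" where
  "nontrivial_family \<K> \<longleftrightarrow> (\<exists>H. pair_graph H \<and> H \<notin> fst ` \<K>)"

text \<open>
  Shortest-path distance, with value \<open>\<infinity>\<close> between different components. The infimum over walks
  is attained by a path, as weights are nonnegative.
\<close>

definition graph_dist :: "'v wgraph \<Rightarrow> 'v \<Rightarrow> 'v \<Rightarrow> ereal" where
  "graph_dist \<G> u v = wf_digraph.\<mu> (with_proj (fst \<G>)) (snd \<G>) u v"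

text \<open>
  For finite nonempty \<open>S\<close> the infimum is the minimum; for \<open>S = {}\<close> it is \<open>\<infinity>\<close>.
\<close>

definition cluster_cost :: "('v \<Rightarrow> 'v \<Rightarrow> ereal) \<Rightarrow> nat \<Rightarrow> 'v set \<Rightarrow> 'v set \<Rightarrow> ereal" where
  "cluster_cost d p C S = (\<Sum>x\<in>C. (INF u\<in>S. d x u) ^ p)"

definition local_search_step ::
  "'v set \<Rightarrow> ('v set \<Rightarrow> ereal) \<Rightarrow> nat \<Rightarrow> real \<Rightarrow> nat \<Rightarrow> nat \<Rightarrow> 'v set \<Rightarrow> 'v set \<Rightarrow> bool" where
  "local_search_step X cost n \<epsilon> k s S S' \<longleftrightarrow>
     S' \<subseteq> X \<and> finite S' \<and> card S' \<le> k \<and> card (S - S') + card (S' - S) \<le> s \<and>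
     cost S' \<le> ereal (1 - \<epsilon> / real n) * cost S"

text \<open>
  \<open>S\<close> is a possible output: the initial set and the improving set chosen in each iteration are
  arbitrary, and the loop has terminated at \<open>S\<close>.
\<close>

definition local_search_output ::
  "'v set \<Rightarrow> ('v set \<Rightarrow> ereal) \<Rightarrow> nat \<Rightarrow> real \<Rightarrow> nat \<Rightarrow> nat \<Rightarrow> 'v set \<Rightarrow> bool" where
  "local_search_output X cost n \<epsilon> k s S \<longleftrightarrow>
     (\<exists>S\<^sub>0. S\<^sub>0 \<subseteq> X \<and> finite S\<^sub>0 \<and> card S\<^sub>0 = k \<and> (local_search_step X cost n \<epsilon> k s)\<^sup>*\<^sup>* S\<^sub>0 S) \<and>
     \<not> (\<exists>S'. local_search_step X cost n \<epsilon> k s S S')"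

text \<open>
  The loop can run forever only from a set of infinite cost or once a set of cost 0 is reached
  (where \<open>S' = S\<close> satisfies the loop condition).
\<close>

lemma local_search_terminates:
  assumes "finite X" and "0 < \<epsilon>" and "0 < n" and "cost S\<^sub>0 < \<infinity>"
    and pos: "\<And>S. S \<subseteq> X \<Longrightarrow> card S \<le> k \<Longrightarrow> 0 < cost S"
    and S0: "S\<^sub>0 \<subseteq> X" "card S\<^sub>0 = k"
  shows "\<not> (\<exists>f. f 0 = S\<^sub>0 \<and> (\<forall>i. local_search_step X cost n \<epsilon> k s (f i) (f (Suc i))))"
proof
  assume "\<exists>f. f 0 = S\<^sub>0 \<and> (\<forall>i. local_search_step X cost n \<epsilon> k s (f i) (f (Suc i)))"
  then obtain f where f0: "f 0 = S\<^sub>0"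
    and step: "\<And>i. local_search_step X cost n \<epsilon> k s (f i) (f (Suc i))" by blast
  have f_in: "f i \<subseteq> X \<and> card (f i) \<le> k" for i
    using step S0 f0 by (cases i) (auto simp: local_search_step_def)
  have dec: "cost (f (Suc i)) < cost (f i)" if fin: "cost (f i) < \<infinity>" for i
  proof -
    obtain r where r: "cost (f i) = ereal r" "0 < r"
      using fin pos[of "f i"] f_in[of i] by (cases "cost (f i)") auto
    have "(1 - \<epsilon> / real n) * r < 1 * r"
      using \<open>0 < r\<close> \<open>0 < \<epsilon>\<close> \<open>0 < n\<close> by (intro mult_strict_right_mono) auto
    with r step[of i] show ?thesis
      by (auto simp: local_search_step_def elim!: order.strict_trans1)
  qed
  have fin: "cost (f i) < \<infinity>" for i
  proof (induction i)
    case (Suc i)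
    then show ?case using dec order.strict_trans by blast
  qed (use f0 assms(4) in simp)
  have less: "cost (f j) < cost (f i)" if "i < j" for i j
    using that
  proof (induction j)
    case (Suc j)
    then show ?case using dec[OF fin] by (metis less_Suc_eq order.strict_trans)
  qed simp
  have "inj f"
    by (rule injI) (metis less linorder_neqE_nat order.irrefl)
  moreover have "finite (range f)"
    using f_in \<open>finite X\<close> by (intro finite_subset[of "range f" "Pow X"]) auto
  ultimately show False
    using finite_imageD by blast
qed

end

theory Submission
  imports Defs "HOL-Library.Disjoint_Sets"
begin

text \<open>
  Compare a locally optimal set \<open>L\<close> with an optimal set \<open>O\<close>, both of size \<open>k\<close>. Contracting the
  Voronoi cells of \<open>L \<union> O\<close> gives a graph without a \<open>K\<^sub>h\<close> minor, which by recursive use of balanced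
  separators (Alon, Seymour, Thomas) has a division into regions of bounded size with few boundary
  vertices. Exchange, in one region, the centers of \<open>L\<close> for those of \<open>O\<close> and the boundary: the clients
  whose cell lies in the region pay at most their \<open>O\<close>-cost, and all others at most their \<open>L\<close>-cost,
  because a shortest path that enters or leaves the region passes a cell of a boundary vertex.
  Adding up over all regions would give the theorem, but the boundary has to be paid for, as the
  exchanged set may not have more than \<open>k\<close> elements.

  So some centers of \<open>O\<close> are dropped first. Two clusters of \<open>L\<close> and \<open>O\<close> are isolated if they nearly
  coincide. Isolated pairs are exchanged directly, and the center from \<open>L\<close> takes the place of its mate
  in \<open>O\<close>, where it costs nothing because it is common to both sets. Among the remaining clusters of
  \<open>O\<close> at least half overlap other clusters so much that their clients can be rerouted at bounded
  expense, and dropping a small fraction of these centers costs little and saves more centers than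
  the boundary needs. Grouping regions makes every exchange balanced and keeps their number small
  compared to the number of clients. All parameters are powers of \<open>\<epsilon>\<close>.
\<close>

section \<open>Connected sets and separators\<close>

text \<open>Two counts shape the argument. When the loop stops, an exchange may still lower the cost
  by just under an \<epsilon>/n share, so each exchange used loses that much and only a small
  fraction of n exchanges is affordable. Exchanges that move many centers at once keep the number
  near k/R, which suffices if n > k; if n \<le> k, a single swap shows that the cost is 0.

  Hence the common centers are deleted from the contracted graph before it is divided: boundary and
  dropped centers are then both measured against the number of non-isolated centers.

  Clients in the core of an isolated pair pay their L-distance in the reduced solution; the direct
  exchange of the pair supplies exactly the difference to their O-distance. All other deviations are
  distances between centers, charged to averages over overlapping clusters.\<close>

definition conn :: "('a \<times> 'a) set \<Rightarrow> 'a set \<Rightarrow> bool" where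
  "conn E S \<longleftrightarrow> S \<noteq> {} \<and> (\<forall>x\<in>S. \<forall>y\<in>S. (x, y) \<in> (E \<inter> S \<times> S)\<^sup>*)"

definition component :: "('a \<times> 'a) set \<Rightarrow> 'a set \<Rightarrow> 'a \<Rightarrow> 'a set" where
  "component E W x = {y. (x, y) \<in> (E \<inter> W \<times> W)\<^sup>*}"

text \<open>Branch sets form a set, not an indexed family: being nonempty and disjoint they are
  distinct anyway, so \<open>card \<C>\<close> is the order of the clique.\<close>

definition clique_model :: "('a \<times> 'a) set \<Rightarrow> 'a set \<Rightarrow> 'a set set \<Rightarrow> bool" where
  "clique_model E V \<C> \<longleftrightarrow> finite \<C> \<and> (\<forall>C\<in>\<C>. C \<subseteq> V \<and> conn E C) \<and>
     (\<forall>C\<in>\<C>. \<forall>C'\<in>\<C>. C \<noteq> C' \<longrightarrow> C \<inter> C' = {} \<and> (\<exists>u\<in>C. \<exists>v\<in>C'. (u, v) \<in> E))"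

definition has_clique_minor :: "('a \<times> 'a) set \<Rightarrow> 'a set \<Rightarrow> nat \<Rightarrow> bool" where
  "has_clique_minor E V h \<longleftrightarrow> (\<exists>\<C>. clique_model E V \<C> \<and> card \<C> = h)"

definition nbhd :: "('a \<times> 'a) set \<Rightarrow> 'a set \<Rightarrow> 'a set \<Rightarrow> 'a set" where
  "nbhd E V D = {y\<in>V - D. \<exists>x\<in>D. (x, y) \<in> E}"

lemma conn_nonempty: "conn E S \<Longrightarrow> S \<noteq> {}"
  by (simp add: conn_def)

lemma conn_singleton: "conn E {x}"
  by (simp add: conn_def)

lemma sym_restrict: "sym E \<Longrightarrow> sym (E \<inter> S \<times> S)"
  by (auto simp: sym_def)

lemma connI_root:
  assumes "sym E" "v \<in> S" "\<And>x. x \<in> S \<Longrightarrow> (v, x) \<in> (E \<inter> S \<times> S)\<^sup>*"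
  shows "conn E S"
  unfolding conn_def
proof (intro conjI ballI)
  fix x y assume "x \<in> S" "y \<in> S"
  have "(x, v) \<in> (E \<inter> S \<times> S)\<^sup>*"
    using assms(3)[OF \<open>x \<in> S\<close>] sym_rtrancl[OF sym_restrict[OF assms(1)], of S] by (auto dest: symD)
  then show "(x, y) \<in> (E \<inter> S \<times> S)\<^sup>*"
    using assms(3)[OF \<open>y \<in> S\<close>] by (rule rtrancl_trans)
qed (use assms in auto)

lemma rtrancl_restrict_mono: "S \<subseteq> T \<Longrightarrow> (E \<inter> S \<times> S)\<^sup>* \<subseteq> (E \<inter> T \<times> T)\<^sup>*"
  by (rule rtrancl_mono) auto

lemma conn_Union:
  assumes "sym E" "v \<in> \<Union>\<S>" "\<And>S. S \<in> \<S> \<Longrightarrow> conn E S \<and> v \<in> S"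
  shows "conn E (\<Union>\<S>)"
proof (rule connI_root[OF assms(1,2)])
  fix x assume "x \<in> \<Union>\<S>"
  then obtain S where S: "S \<in> \<S>" "x \<in> S" by blast
  then have "(v, x) \<in> (E \<inter> S \<times> S)\<^sup>*" using assms(3) by (auto simp: conn_def)
  then show "(v, x) \<in> (E \<inter> \<Union>\<S> \<times> \<Union>\<S>)\<^sup>*"
    using rtrancl_restrict_mono[of S "\<Union>\<S>"] S by blast
qed

lemma conn_Un:
  assumes "sym E" "conn E S" "conn E T" "S \<inter> T \<noteq> {}"
  shows "conn E (S \<union> T)"
proof -
  obtain v where "v \<in> S \<inter> T" using assms(4) by blast
  then show ?thesis using conn_Union[OF assms(1), of v "{S, T}"] assms by auto
qed

lemma conn_edge: "sym E \<Longrightarrow> (x, y) \<in> E \<Longrightarrow> conn E {x, y}"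
  by (rule connI_root[of _ x]) auto

lemma conn_Un_edge:
  assumes "sym E" "conn E S" "conn E T" "x \<in> S" "y \<in> T" "(x, y) \<in> E"
  shows "conn E (S \<union> T)"
proof -
  have "conn E (S \<union> {x, y})"
    using conn_Un[OF assms(1,2) conn_edge] assms by blast
  then have "conn E ((S \<union> {x, y}) \<union> T)"
    using conn_Un[OF assms(1)] assms by blast
  moreover have "(S \<union> {x, y}) \<union> T = S \<union> T" using assms by auto
  ultimately show ?thesis by simp
qed

lemma rtrancl_closed:
  assumes "(x, y) \<in> R\<^sup>*" "x \<in> Y" "\<And>a b. a \<in> Y \<Longrightarrow> (a, b) \<in> R \<Longrightarrow> b \<in> Y"
  shows "y \<in> Y"
  using assms(1) by (induction rule: rtrancl_induct) (use assms in auto)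

lemma conn_subset_closed:
  assumes "conn E U" "x \<in> U" "x \<in> Y"
    and "\<And>a b. a \<in> U \<Longrightarrow> a \<in> Y \<Longrightarrow> b \<in> U \<Longrightarrow> (a, b) \<in> E \<Longrightarrow> b \<in> Y"
  shows "U \<subseteq> Y"
proof
  fix y assume "y \<in> U"
  then have "(x, y) \<in> (E \<inter> U \<times> U)\<^sup>*" using assms(1,2) by (simp add: conn_def)
  then have "y \<in> U \<inter> Y"
    by (rule rtrancl_closed) (use assms in auto)
  then show "y \<in> Y" by simp
qed

lemma component_self: "x \<in> component E W x"
  by (simp add: component_def)

lemma component_subset: assumes "x \<in> W" shows "component E W x \<subseteq> W"
proof
  fix y assume "y \<in> component E W x"
  then have "(x, y) \<in> (E \<inter> W \<times> W)\<^sup>*" by (simp add: component_def)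
  then show "y \<in> W" by (rule rtrancl_closed) (use assms in auto)
qed

lemma component_closed:
  assumes "x \<in> W" "a \<in> component E W x" "b \<in> W" "(a, b) \<in> E"
  shows "b \<in> component E W x"
proof -
  have "a \<in> W" using component_subset assms by fast
  then show ?thesis using assms
    by (auto simp: component_def intro: rtrancl_into_rtrancl)
qed

lemma component_conn:
  assumes "sym E" "x \<in> W"
  shows "conn E (component E W x)"
proof (rule connI_root[OF assms(1) component_self])
  fix y assume "y \<in> component E W x"
  then have "(x, y) \<in> (E \<inter> W \<times> W)\<^sup>*" by (simp add: component_def)
  then show "(x, y) \<in> (E \<inter> component E W x \<times> component E W x)\<^sup>*"
  proof (induction rule: rtrancl_induct)
    case (step y z)
    then have "y \<in> component E W x" "z \<in> component E W x"
      by (auto simp: component_def intro: rtrancl_into_rtrancl)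
    with step show ?case by (auto intro: rtrancl_into_rtrancl)
  qed simp
qed

lemma clique_model_mono:
  assumes "clique_model E W \<C>" "W \<subseteq> V"
  shows "clique_model E V \<C>"
proof -
  have "\<forall>C\<in>\<C>. C \<subseteq> V \<and> conn E C"
    using assms unfolding clique_model_def by fast
  then show ?thesis
    using assms(1) unfolding clique_model_def by simp
qed

lemma has_clique_minor_mono:
  "has_clique_minor E W h \<Longrightarrow> W \<subseteq> V \<Longrightarrow> has_clique_minor E V h"
  unfolding has_clique_minor_def
  by (elim exE conjE, rule exI, rule conjI, rule clique_model_mono)

section \<open>Balanced separators in graphs without a clique minor\<close>

lemma min_le_average:
  fixes f :: "'b \<Rightarrow> nat"
  assumes "finite J" "J \<noteq> {}" "sum f J \<le> N"
  obtains j where "j \<in> J" "card J * f j \<le> N"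
proof -
  obtain j where j: "j \<in> J" "\<And>i. i \<in> J \<Longrightarrow> f j \<le> f i"
    using arg_min_if_finite[OF assms(1,2), of f] by (metis not_le)
  have "card J * f j \<le> sum f J"
    using sum_bounded_below[of J "f j" f] j by simp
  then show ?thesis using that j assms by fastforce
qed

text \<open>\<open>Y\<close> is a ball around \<open>A\<close> in a breadth-first search, \<open>Z\<close> a sparse layer following it.\<close>

lemma layer_cut:
  assumes "sym E" "finite D" "A \<subseteq> D" "r > 0"
  obtains Y Z where "Y \<subseteq> D" "Z \<subseteq> D" "A \<subseteq> Y" "r * card Z \<le> card D"
    "\<And>x y. x \<in> Y \<Longrightarrow> y \<in> D \<Longrightarrow> (x, y) \<in> E \<Longrightarrow> y \<in> Y \<union> Z"
    "\<And>y. y \<in> Y \<Longrightarrow> \<exists>T\<subseteq>D. conn E T \<and> y \<in> T \<and> T \<inter> A \<noteq> {} \<and> card T \<le> r"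
proof -
  define b where "b = rec_nat A (\<lambda>_ S. S \<union> nbhd E D S)"
  have b0: "b 0 = A" and bS: "\<And>j. b (Suc j) = b j \<union> nbhd E D (b j)"
    by (simp_all add: b_def)
  have bD: "b j \<subseteq> D" for j
    by (induction j) (use assms in \<open>auto simp: b0 bS nbhd_def\<close>)
  have bm: "i \<le> j \<Longrightarrow> b i \<subseteq> b j" for i j
    by (rule lift_Suc_mono_le[of b]) (auto simp: bS)
  have bT: "y \<in> b j \<Longrightarrow> \<exists>T\<subseteq>D. conn E T \<and> y \<in> T \<and> T \<inter> A \<noteq> {} \<and> card T \<le> Suc j" for y j
  proof (induction j arbitrary: y)
    case 0
    then show ?case using assms(3) by (intro exI[of _ "{y}"]) (auto simp: b0 conn_singleton)
  next
    case (Suc j)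
    show ?case
    proof (cases "y \<in> b j")
      case True
      then show ?thesis using Suc.IH by (meson le_SucI)
    next
      case False
      then obtain x where x: "x \<in> b j" "(x, y) \<in> E" "y \<in> D"
        using Suc.prems by (auto simp: bS nbhd_def)
      from Suc.IH[OF x(1)] obtain T where T: "T \<subseteq> D" "conn E T" "x \<in> T" "T \<inter> A \<noteq> {}" "card T \<le> Suc j"
        by blast
      have "conn E (T \<union> {y})"
        using conn_Un_edge[OF assms(1) T(2) conn_singleton T(3) _ x(2)] by simp
      moreover have "card (T \<union> {y}) \<le> Suc (Suc j)"
        using T by (simp add: card_insert_le_m1 order.trans[OF card_Un_le])
      ultimately show ?thesis using T x by (intro exI[of _ "T \<union> {y}"]) auto
    qed
  qed
  define Z where "Z j = b (Suc j) - b j" for j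
  have disj: "i < j \<Longrightarrow> Z i \<inter> Z j = {}" for i j
    using bm[of "Suc i" j] by (auto simp: Z_def)
  have disj': "i \<noteq> j \<Longrightarrow> Z i \<inter> Z j = {}" for i j
    using disj[of i j] disj[of j i] by (cases "i < j") auto
  have finZ: "finite (Z j)" for j
    using finite_subset[OF bD assms(2)] by (auto simp: Z_def)
  \<comment> \<open>The first \<open>r\<close> layers are disjoint subsets of \<open>D\<close>, so
    the thinnest has at most \<open>card D / r\<close> elements. Its index \<open>j < r\<close> also
    bounds the radius of the ball, and with it the size of the connecting sets.\<close>
  have "(\<Sum>j\<in>{..<r}. card (Z j)) = card (\<Union>j\<in>{..<r}. Z j)"
    using disj' finZ by (intro card_UN_disjoint[symmetric]) auto
  also have "\<dots> \<le> card D"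
    by (rule card_mono[OF assms(2)]) (use bD in \<open>auto simp: Z_def\<close>)
  finally obtain j where j: "j \<in> {..<r}" "card {..<r} * card (Z j) \<le> card D"
    using min_le_average[of "{..<r}" "\<lambda>j. card (Z j)" "card D"] assms(4) by auto
  show thesis
  proof (rule that[of "b j" "Z j"])
    show "\<exists>T\<subseteq>D. conn E T \<and> y \<in> T \<and> T \<inter> A \<noteq> {} \<and> card T \<le> r" if "y \<in> b j" for y
      using bT[OF that] j by (meson Suc_leI le_trans lessThan_iff)
    show "A \<subseteq> b j" using bm[of 0 j] b0 by simp
  qed (use bD j in \<open>auto simp: Z_def bS nbhd_def\<close>)
qed

text \<open>
  A partial clique model together with a large connected set \<open>D\<close> that is separated from the rest
  by a few vertices of each branch set. The branch sets themselves may be large.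
\<close>

definition guarded :: "('a \<times> 'a) set \<Rightarrow> 'a set \<Rightarrow> nat \<Rightarrow> 'a set \<Rightarrow> 'a set set \<Rightarrow> bool" where
  "guarded E V q D \<C> \<longleftrightarrow> D \<subseteq> V \<and> conn E D \<and> card V < 2 * card D \<and> clique_model E V \<C> \<and>
     (\<forall>C\<in>\<C>. C \<inter> D = {} \<and> card (nbhd E V D \<inter> C) \<le> q) \<and> nbhd E V D \<subseteq> \<Union>\<C>"

lemma guardedD:
  assumes "guarded E V q D \<C>"
  shows "D \<subseteq> V" "conn E D" "card V < 2 * card D" "clique_model E V \<C>"
    "\<And>C. C \<in> \<C> \<Longrightarrow> C \<inter> D = {}" "\<And>C. C \<in> \<C> \<Longrightarrow> card (nbhd E V D \<inter> C) \<le> q"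
    "nbhd E V D \<subseteq> \<Union>\<C>" "finite \<C>" "\<And>C. C \<in> \<C> \<Longrightarrow> C \<subseteq> V" "\<And>C. C \<in> \<C> \<Longrightarrow> conn E C"
    "\<And>C C'. C \<in> \<C> \<Longrightarrow> C' \<in> \<C> \<Longrightarrow> C \<noteq> C' \<Longrightarrow> C \<inter> C' = {}"
    "\<And>C C'. C \<in> \<C> \<Longrightarrow> C' \<in> \<C> \<Longrightarrow> C \<noteq> C' \<Longrightarrow> \<exists>u\<in>C. \<exists>v\<in>C'. (u, v) \<in> E"
  using assms unfolding guarded_def clique_model_def by simp_all

lemma guardedI:
  assumes "D \<subseteq> V" "conn E D" "card V < 2 * card D" "clique_model E V \<C>"
    "\<And>C. C \<in> \<C> \<Longrightarrow> C \<inter> D = {}" "\<And>C. C \<in> \<C> \<Longrightarrow> card (nbhd E V D \<inter> C) \<le> q"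
    "nbhd E V D \<subseteq> \<Union>\<C>"
  shows "guarded E V q D \<C>"
  using assms unfolding guarded_def by simp

lemma guarded_card_nbhd:
  assumes "guarded E V q D \<C>" "finite V"
  shows "card (nbhd E V D) \<le> card \<C> * q"
proof -
  note g = guardedD[OF assms(1)]
  have "nbhd E V D = (\<Union>C\<in>\<C>. nbhd E V D \<inter> C)" using g(7) by auto
  then have "card (nbhd E V D) = card (\<Union>C\<in>\<C>. nbhd E V D \<inter> C)" by simp
  also have "\<dots> \<le> (\<Sum>C\<in>\<C>. card (nbhd E V D \<inter> C))"
    by (rule card_UN_le[OF g(8)])
  also have "\<dots> \<le> card \<C> * q"
    using sum_bounded_above[of \<C> "\<lambda>C. card (nbhd E V D \<inter> C)" q] g(6) by simp
  finally show ?thesis .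
qed

lemma big_sets_meet:
  assumes "finite V" "A \<subseteq> V" "B \<subseteq> V" "card V < 2 * card A" "card V < 2 * card B"
  shows "A \<inter> B \<noteq> {}"
proof
  assume "A \<inter> B = {}"
  then have "card (A \<union> B) = card A + card B"
    using assms finite_subset by (metis card_Un_disjoint)
  moreover have "card (A \<union> B) \<le> card V" using assms by (intro card_mono) auto
  ultimately show False using assms by linarith
qed

lemma clique_model_insert:
  assumes "sym E" "clique_model E V \<C>" "T \<subseteq> V" "conn E T"
    "\<And>C. C \<in> \<C> \<Longrightarrow> T \<inter> C = {} \<and> (\<exists>u\<in>T. \<exists>v\<in>C. (u, v) \<in> E)"
  shows "clique_model E V (insert T \<C>)"
  unfolding clique_model_def
proof (intro conjI ballI impI)
  fix C C' assume C: "C \<in> insert T \<C>" "C' \<in> insert T \<C>" "C \<noteq> C'"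
  show "C \<inter> C' = {}"
    using C assms(2,5) unfolding clique_model_def by (metis inf_commute insert_iff)
  show "\<exists>u\<in>C. \<exists>v\<in>C'. (u, v) \<in> E"
    using C assms(2,5) symD[OF assms(1)] unfolding clique_model_def by (metis insert_iff)
qed (use assms in \<open>auto simp: clique_model_def\<close>)

text \<open>A branch set that does not touch the boundary of \<open>D\<close> is discarded.
  Otherwise a thin layer is cut around the attachment set \<open>A C\<close> of every branch set;
  together with the old boundary this is too little to separate, so a large component
  \<open>D0\<close> survives. If a vertex of \<open>D0\<close> is within short reach of all branch
  sets, the connecting sets form a new small branch set. If not, \<open>D0\<close> lies beyond the
  layer of some \<open>C\<close>, and \<open>C\<close> swallows what lies in between. Of the
  enlarged set only vertices of the cut layers still border on the new \<open>D'\<close>, which is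
  why large branch sets do no harm.\<close>

lemma guarded_step:
  assumes E: "sym E" and V: "finite V" and r: "r > 0"
    and q: "h * r + 1 \<le> q" "h * (card V div r) \<le> q"
    and big: "\<And>X. X \<subseteq> V \<Longrightarrow> card X \<le> h * q \<Longrightarrow>
       \<exists>U. U \<subseteq> V - X \<and> conn E U \<and> card V < 2 * card U \<and>
         (\<forall>x\<in>U. \<forall>y\<in>V - X. (x, y) \<in> E \<longrightarrow> y \<in> U)"
    and g: "guarded E V q D \<C>" and h: "card \<C> < h"
  shows "\<exists>D' \<C>'. guarded E V q D' \<C>' \<and>
     (card D' < card D \<and> card \<C>' \<le> Suc (card \<C>) \<or> D' = D \<and> card \<C>' < card \<C>)"
proof (cases "\<exists>C\<in>\<C>. nbhd E V D \<inter> C = {}")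
  case True
  then obtain C where C: "C \<in> \<C>" "nbhd E V D \<inter> C = {}" by blast
  note g' = guardedD[OF g]
  have "clique_model E V (\<C> - {C})"
    using g'(4) unfolding clique_model_def by simp
  moreover have "nbhd E V D \<subseteq> \<Union>(\<C> - {C})" using g'(7) C by blast
  ultimately have "guarded E V q D (\<C> - {C})"
    using g' by (intro guardedI) auto
  moreover have "card (\<C> - {C}) < card \<C>" by (rule card_Diff1_less[OF g'(8) C(1)])
  ultimately show ?thesis by blast
next
  case False
  note g' = guardedD[OF g]
  have finD: "finite D" using g'(1) V finite_subset by blast
  define A where "A C = {x\<in>D. \<exists>c\<in>C. (x, c) \<in> E}" for C
  have Ane: "A C \<noteq> {}" if C: "C \<in> \<C>" for C
  proof -
    obtain y where "y \<in> nbhd E V D" "y \<in> C" using False C by blast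
    then show ?thesis by (auto simp: A_def nbhd_def)
  qed
  have "\<exists>Y Z. Y \<subseteq> D \<and> Z \<subseteq> D \<and> A C \<subseteq> Y \<and> r * card Z \<le> card D \<and>
    (\<forall>x y. x \<in> Y \<longrightarrow> y \<in> D \<longrightarrow> (x, y) \<in> E \<longrightarrow> y \<in> Y \<union> Z) \<and>
    (\<forall>y\<in>Y. \<exists>T\<subseteq>D. conn E T \<and> y \<in> T \<and> T \<inter> A C \<noteq> {} \<and> card T \<le> r)" for C
  proof (rule layer_cut[OF E finD _ r, of "A C"], goal_cases)
    case (2 Y Z)
    then show ?case by (rule_tac exI[of _ Y], rule_tac exI[of _ Z]) simp
  qed (auto simp: A_def)
  then obtain Y Z where YZ: "\<And>C. Y C \<subseteq> D \<and> Z C \<subseteq> D \<and> A C \<subseteq> Y C \<and> r * card (Z C) \<le> card D \<and>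
    (\<forall>x y. x \<in> Y C \<longrightarrow> y \<in> D \<longrightarrow> (x, y) \<in> E \<longrightarrow> y \<in> Y C \<union> Z C) \<and>
    (\<forall>y\<in>Y C. \<exists>T\<subseteq>D. conn E T \<and> y \<in> T \<and> T \<inter> A C \<noteq> {} \<and> card T \<le> r)"
    by metis
  have ZD: "Z C \<subseteq> D" and AY: "A C \<subseteq> Y C" and rZ: "r * card (Z C) \<le> card D"
    and Ycl: "x \<in> Y C \<Longrightarrow> y \<in> D \<Longrightarrow> (x, y) \<in> E \<Longrightarrow> y \<in> Y C \<union> Z C"
    and YT: "y \<in> Y C \<Longrightarrow> \<exists>T\<subseteq>D. conn E T \<and> y \<in> T \<and> T \<inter> A C \<noteq> {} \<and> card T \<le> r" for C x y
    using YZ[of C] by simp_all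
  define ZZ where "ZZ = (\<Union>C\<in>\<C>. Z C)"
  have cZ: "card (Z C) \<le> card V div r" for C
  proof -
    have "r * card (Z C) \<le> card V"
      using rZ[of C] card_mono[OF V g'(1)] by linarith
    then show ?thesis using r by (simp add: less_eq_div_iff_mult_less_eq mult.commute)
  qed
  have "card ZZ \<le> (\<Sum>C\<in>\<C>. card (Z C))" unfolding ZZ_def by (rule card_UN_le[OF g'(8)])
  also have "\<dots> \<le> card \<C> * (card V div r)"
    using sum_bounded_above[of \<C> "\<lambda>C. card (Z C)"] cZ by simp
  also have "\<dots> \<le> h * (card V div r)" using h by simp
  finally have cZZ: "card ZZ \<le> q" using q by simp
  have ZZD: "ZZ \<subseteq> D" unfolding ZZ_def using ZD by (rule UN_least)
  \<comment> \<open>The budget \<open>h * q\<close> covers the boundary of \<open>D\<close>, at most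
    \<open>q\<close> per branch set, and one more set \<open>X\<close> of size \<open>q\<close>,
    because there are fewer than \<open>h\<close> branch sets. The large component left over meets
    \<open>D\<close>, as both exceed half of \<open>V\<close>, and cannot cross the
    boundary.\<close>
  have sep: "\<exists>D0. D0 \<subseteq> D - X \<and> conn E D0 \<and> card V < 2 * card D0 \<and>
         (\<forall>x\<in>D0. \<forall>y\<in>V - (nbhd E V D \<union> X). (x, y) \<in> E \<longrightarrow> y \<in> D0)"
    if X: "X \<subseteq> D" "card X \<le> q" for X
  proof -
    have "card (nbhd E V D \<union> X) \<le> card \<C> * q + q"
      using card_Un_le[of "nbhd E V D" X] guarded_card_nbhd[OF g V] X by linarith
    also have "\<dots> = Suc (card \<C>) * q" by simp
    also have "\<dots> \<le> h * q" using h by (intro mult_right_mono) auto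
    finally have c: "card (nbhd E V D \<union> X) \<le> h * q" .
    have "nbhd E V D \<union> X \<subseteq> V" using X(1) g'(1) by (auto simp: nbhd_def)
    from big[OF this c] obtain U where U: "U \<subseteq> V - (nbhd E V D \<union> X)" "conn E U" "card V < 2 * card U"
      "\<forall>x\<in>U. \<forall>y\<in>V - (nbhd E V D \<union> X). (x, y) \<in> E \<longrightarrow> y \<in> U"
      by blast
    obtain x where "x \<in> U" "x \<in> D" using big_sets_meet[OF V, of U D] U g' by blast
    then have "U \<subseteq> D"
      by (rule conn_subset_closed[OF U(2)]) (use U(1) in \<open>auto simp: nbhd_def\<close>)
    then show ?thesis using U by blast
  qed
  obtain D0 where D0: "D0 \<subseteq> D - ZZ" "conn E D0" "card V < 2 * card D0"
      "\<forall>x\<in>D0. \<forall>y\<in>V - (nbhd E V D \<union> ZZ). (x, y) \<in> E \<longrightarrow> y \<in> D0"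
    using sep[OF ZZD cZZ] by blast
  obtain v where v: "v \<in> D0" using conn_nonempty[OF D0(2)] by blast
  show ?thesis
  proof (cases "\<forall>C\<in>\<C>. v \<in> Y C")
    case True
    then have "\<forall>C\<in>\<C>. \<exists>T\<subseteq>D. conn E T \<and> v \<in> T \<and> T \<inter> A C \<noteq> {} \<and> card T \<le> r"
      using YT by simp
    then obtain T where T: "\<And>C. C \<in> \<C> \<Longrightarrow> T C \<subseteq> D \<and> conn E (T C) \<and> v \<in> T C \<and> T C \<inter> A C \<noteq> {} \<and> card (T C) \<le> r"
      by metis
    define TT where "TT = \<Union>(insert {v} (T ` \<C>))"
    have cTT: "conn E TT"
      unfolding TT_def by (rule conn_Union[OF E, of v]) (use T conn_singleton in auto)
    have TTD: "TT \<subseteq> D" using T v D0(1) by (auto simp: TT_def)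
    have "card TT \<le> card {v} + card (\<Union>C\<in>\<C>. T C)"
      unfolding TT_def using card_Un_le[of "{v}" "\<Union>C\<in>\<C>. T C"] by simp
    also have "\<dots> \<le> 1 + (\<Sum>C\<in>\<C>. card (T C))"
      using card_UN_le[OF g'(8), of T] by simp
    also have "\<dots> \<le> 1 + card \<C> * r"
      using sum_bounded_above[of \<C> "\<lambda>C. card (T C)" r] T by simp
    also have "\<dots> \<le> 1 + h * r" using h by simp
    finally have cardTT: "card TT \<le> q" using q by simp
    obtain D' where D': "D' \<subseteq> D - TT" "conn E D'" "card V < 2 * card D'"
      "\<forall>x\<in>D'. \<forall>y\<in>V - (nbhd E V D \<union> TT). (x, y) \<in> E \<longrightarrow> y \<in> D'"
      using sep[OF TTD cardTT] by blast
    have adj: "TT \<inter> C = {} \<and> (\<exists>u\<in>TT. \<exists>v\<in>C. (u, v) \<in> E)" if C: "C \<in> \<C>" for C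
    proof
      show "TT \<inter> C = {}" using TTD g'(5)[OF C] by blast
      obtain u where "u \<in> T C" "u \<in> A C" using T[OF C] by blast
      then show "\<exists>u\<in>TT. \<exists>v\<in>C. (u, v) \<in> E" using C by (auto simp: A_def TT_def)
    qed
    have cm: "clique_model E V (insert TT \<C>)"
      using clique_model_insert[OF E g'(4) _ cTT] TTD g'(1) adj by blast
    have nb: "nbhd E V D' \<subseteq> nbhd E V D \<union> TT" using D'(4) by (auto simp: nbhd_def)
    have "card (nbhd E V D' \<inter> C) \<le> q" if "C \<in> insert TT \<C>" for C
    proof (cases "C = TT")
      case True
      then show ?thesis using card_mono[of TT "nbhd E V D' \<inter> TT"] finite_subset[OF TTD finD] cardTT by auto
    next
      case False
      then have C: "C \<in> \<C>" using that by auto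
      then have "nbhd E V D' \<inter> C \<subseteq> nbhd E V D \<inter> C" using nb adj[OF C] by blast
      moreover have "finite (nbhd E V D \<inter> C)" using V by (auto simp: nbhd_def)
      ultimately show ?thesis using g'(6)[OF C] card_mono by (meson le_trans)
    qed
    moreover have "C \<inter> D' = {}" if "C \<in> insert TT \<C>" for C
      using that D'(1) g'(5) by auto
    moreover have "nbhd E V D' \<subseteq> \<Union>(insert TT \<C>)" using nb g'(7) by auto
    moreover have "D' \<subseteq> V" using D'(1) g'(1) by blast
    ultimately have "guarded E V q D' (insert TT \<C>)"
      by (intro guardedI D'(2,3) cm) simp_all
    moreover have "card D' < card D"
    proof (rule psubset_card_mono[OF finD])
      have "v \<in> TT" by (simp add: TT_def)
      then show "D' \<subset> D" using TTD D'(1) by blast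
    qed
    moreover have "card (insert TT \<C>) \<le> Suc (card \<C>)"
      by (simp add: g'(8) card_insert_if)
    ultimately show ?thesis by blast
  next
    case False
    then obtain C where C: "C \<in> \<C>" "v \<notin> Y C" by blast
    have "D0 \<subseteq> - Y C"
    proof (rule conn_subset_closed[OF D0(2) v])
      fix a b assume ab: "a \<in> D0" "a \<in> - Y C" "b \<in> D0" "(a, b) \<in> E"
      show "b \<in> - Y C"
      proof
        assume "b \<in> Y C"
        then have "a \<in> Y C \<union> Z C" using Ycl[of b C a] ab D0(1) symD[OF E] by blast
        then show False using ab D0(1) C by (auto simp: ZZ_def)
      qed
    qed (use C in auto)
    then have D0A: "D0 \<inter> A C = {}" using AY[of C] by blast
    \<comment> \<open>Everything in \<open>D\<close> reachable from the attachments of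
      \<open>C\<close> without entering \<open>D0\<close> is taken, not just the ball. Then
      \<open>D - P\<close> stays connected: a component of it away from \<open>D0\<close> would have
      no edge to the rest of \<open>D\<close>.\<close>
    define P where "P = (\<Union>a\<in>A C. component E (D - D0) a)"
    have AD: "A C \<subseteq> D - D0" using D0A by (auto simp: A_def)
    have PD: "P \<subseteq> D - D0" unfolding P_def
      by (rule UN_least, rule component_subset) (use AD in blast)
    have AP: "A C \<subseteq> P" using component_self[of _ E "D - D0"] unfolding P_def by blast
    have Pcl: "b \<in> P" if ab: "a \<in> P" "b \<in> D - D0" "(a, b) \<in> E" for a b
    proof -
      obtain x where x: "x \<in> A C" "a \<in> component E (D - D0) x" using ab(1) by (auto simp: P_def)
      then have "b \<in> component E (D - D0) x" using component_closed[OF _ x(2) ab(2,3)] AD by blast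
      then show ?thesis using x by (auto simp: P_def)
    qed
    define D' where "D' = D - P"
    define C' where "C' = C \<union> P"
    have D0D': "D0 \<subseteq> D'" using PD D0(1) by (auto simp: D'_def)
    have cD': "conn E D'"
    proof -
      define R where "R = component E D' v"
      have vD': "v \<in> D'" using v D0D' by blast
      have RD': "R \<subseteq> D'" unfolding R_def by (rule component_subset[OF vD'])
      have D0R: "D0 \<subseteq> R"
        by (rule conn_subset_closed[OF D0(2) v])
          (use component_self component_closed[OF vD'] D0D' in \<open>auto simp: R_def\<close>)
      have "D' \<subseteq> R"
      proof
        fix a assume a: "a \<in> D'"
        show "a \<in> R"
        proof (rule ccontr)
          assume "a \<notin> R"
          have "D \<subseteq> D' - R"
          proof (rule conn_subset_closed[OF g'(2)])
            fix x y assume xy: "x \<in> D" "x \<in> D' - R" "y \<in> D" "(x, y) \<in> E"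
            have "y \<notin> R"
              using component_closed[OF vD', of y E x] xy symD[OF E xy(4)] unfolding R_def by blast
            moreover have "y \<notin> P"
            proof
              assume "y \<in> P"
              then have "x \<in> P" using Pcl[of y x] xy D0R symD[OF E] by blast
              then show False using xy by (simp add: D'_def)
            qed
            ultimately show "y \<in> D' - R" using xy by (simp add: D'_def)
          qed (use a \<open>a \<notin> R\<close> in \<open>auto simp: D'_def\<close>)
          moreover have "v \<in> R" "v \<in> D" using vD' component_self by (auto simp: R_def D'_def)
          ultimately show False by blast
        qed
      qed
      then have "R = D'" using RD' by blast
      then show ?thesis using component_conn[OF E vD'] by (simp add: R_def)
    qed
    obtain c where c: "c \<in> C" using conn_nonempty[OF g'(10)[OF C(1)]] by blast
    have cC': "conn E C'"
    proof -
      have comp: "conn E (C \<union> component E (D - D0) a)" if a: "a \<in> A C" for a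
      proof -
        obtain y where "y \<in> C" "(a, y) \<in> E" using a by (auto simp: A_def)
        then show ?thesis
          using conn_Un_edge[OF E g'(10)[OF C(1)] component_conn[OF E, of a "D - D0"], of y a]
            a AD component_self[of a E "D - D0"] symD[OF E] by blast
      qed
      have "conn E (\<Union>(insert C ((\<lambda>a. C \<union> component E (D - D0) a) ` A C)))"
        by (rule conn_Union[OF E, of c]) (use c g'(10)[OF C(1)] comp in blast)+
      moreover have "\<Union>(insert C ((\<lambda>a. C \<union> component E (D - D0) a) ` A C)) = C'"
        by (auto simp: C'_def P_def)
      ultimately show ?thesis by simp
    qed
    define \<C>' where "\<C>' = insert C' (\<C> - {C})"
    have C'D: "C' \<subseteq> V" using g'(9)[OF C(1)] PD g'(1) by (auto simp: C'_def)
    have disj: "C' \<inter> B = {}" if "B \<in> \<C> - {C}" for B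
      using that g'(11)[OF C(1), of B] g'(5)[of B] PD by (auto simp: C'_def)
    have cm: "clique_model E V \<C>'"
      unfolding \<C>'_def
    proof (rule clique_model_insert[OF E _ C'D cC'])
      show "clique_model E V (\<C> - {C})" using g'(4) unfolding clique_model_def by simp
      show "C' \<inter> B = {} \<and> (\<exists>u\<in>C'. \<exists>v\<in>B. (u, v) \<in> E)" if "B \<in> \<C> - {C}" for B
        using disj[OF that] that g'(12)[OF C(1), of B] by (auto simp: C'_def)
    qed
    have nb: "nbhd E V D' \<subseteq> (ZZ \<inter> P) \<union> (nbhd E V D - C)"
    proof
      fix y assume "y \<in> nbhd E V D'"
      then obtain x where xy: "x \<in> D'" "(x, y) \<in> E" "y \<in> V" "y \<notin> D'" by (auto simp: nbhd_def)
      show "y \<in> (ZZ \<inter> P) \<union> (nbhd E V D - C)"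
      proof (cases "y \<in> D")
        case True
        then have yP: "y \<in> P" using xy by (simp add: D'_def)
        \<comment> \<open>A vertex outside \<open>D0\<close> with a neighbour in \<open>P\<close>
          would itself have been collected into \<open>P\<close>.\<close>
        have "x \<in> D0" using Pcl[OF yP, of x] xy symD[OF E] by (auto simp: D'_def)
        moreover have "y \<notin> D0" using yP PD by blast
        moreover have "y \<notin> nbhd E V D" using True by (simp add: nbhd_def)
        ultimately have "y \<in> ZZ" using D0(4) xy by blast
        then show ?thesis using yP by blast
      next
        case False
        then have "y \<in> nbhd E V D" using xy by (auto simp: nbhd_def D'_def)
        moreover have "y \<notin> C"
        proof
          assume "y \<in> C"
          then have "x \<in> A C" using xy by (auto simp: A_def D'_def)
          then show False using AP xy by (auto simp: D'_def)
        qed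
        ultimately show ?thesis by blast
      qed
    qed
    have "card (nbhd E V D' \<inter> B) \<le> q" if "B \<in> \<C>'" for B
    proof (cases "B = C'")
      case True
      have "nbhd E V D \<inter> P = {}" using PD by (auto simp: nbhd_def)
      then have "nbhd E V D' \<inter> B \<subseteq> ZZ" using nb True by (auto simp: C'_def)
      then show ?thesis using card_mono[of ZZ] finite_subset[OF ZZD finD] cZZ le_trans by blast
    next
      case False
      then have B: "B \<in> \<C>" "B \<in> \<C> - {C}" using that by (auto simp: \<C>'_def)
      then have "nbhd E V D' \<inter> B \<subseteq> nbhd E V D \<inter> B" using nb disj[of B] by (auto simp: C'_def)
      moreover have "finite (nbhd E V D \<inter> B)" using V by (auto simp: nbhd_def)
      ultimately show ?thesis using g'(6)[OF B(1)] card_mono by (meson le_trans)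
    qed
    moreover have "B \<inter> D' = {}" if "B \<in> \<C>'" for B
      using that g'(5) C(1) by (auto simp: \<C>'_def C'_def D'_def)
    moreover have "nbhd E V D' \<subseteq> \<Union>\<C>'" using nb g'(7) by (auto simp: \<C>'_def C'_def)
    moreover have "D' \<subseteq> V" using g'(1) by (auto simp: D'_def)
    moreover have "card V < 2 * card D'"
      using card_mono[of D' D0] D0(3) D0D' finD by (auto simp: D'_def)
    ultimately have "guarded E V q D' \<C>'"
      by (intro guardedI cD' cm) simp_all
    moreover have "card D' < card D"
      using Ane[OF C(1)] AP AD by (intro psubset_card_mono[OF finD]) (auto simp: D'_def)
    moreover have "card \<C>' \<le> Suc (card \<C>)"
      unfolding \<C>'_def using g'(8) by (simp add: card_insert_if card_Diff1_le le_SucI)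
    ultimately show ?thesis by blast
  qed
qed

text \<open>Let \<open>A\<close> be a largest union of components with at most two thirds of the
  vertices. Its complement must exceed two thirds, so \<open>A\<close> has less than one third.
  Adding another component \<open>U\<close> exceeds two thirds by maximality. If \<open>U\<close>
  had at most half of the vertices, the same argument would give it less than one third, and
  \<open>A\<close> and \<open>U\<close> together would be too small.\<close>

lemma separator_or_big_component:
  assumes E: "sym E" and V: "finite V" and X: "X \<subseteq> V"
    and nosep: "\<not> (\<exists>A B. V - X = A \<union> B \<and> A \<inter> B = {} \<and> 3 * card A \<le> 2 * card V \<and>
                  3 * card B \<le> 2 * card V \<and> (\<forall>a\<in>A. \<forall>b\<in>B. (a, b) \<notin> E))"
  shows "\<exists>U. U \<subseteq> V - X \<and> conn E U \<and> card V < 2 * card U \<and>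
         (\<forall>x\<in>U. \<forall>y\<in>V - X. (x, y) \<in> E \<longrightarrow> y \<in> U)"
proof -
  define W where "W = V - X"
  have finW: "finite W" using V by (simp add: W_def)
  have WV: "card W \<le> card V" unfolding W_def by (intro card_mono V) auto
  define closed where "closed A \<longleftrightarrow> A \<subseteq> W \<and> (\<forall>x\<in>A. \<forall>y\<in>W. (x, y) \<in> E \<longrightarrow> y \<in> A)" for A
  have unbal: "2 * card V < 3 * card (W - A)" if "closed A" "3 * card A \<le> 2 * card V" for A
  proof (rule ccontr)
    assume "\<not> 2 * card V < 3 * card (W - A)"
    moreover have "W = A \<union> (W - A)" using that by (auto simp: closed_def)
    moreover have "\<forall>a\<in>A. \<forall>b\<in>W - A. (a, b) \<notin> E" using that by (auto simp: closed_def)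
    ultimately show False using nosep that unfolding W_def
      by (metis Diff_disjoint not_less)
  qed
  have "closed {} \<and> 3 * card {} \<le> 2 * card V" by (simp add: closed_def)
  moreover have "\<forall>B. closed B \<and> 3 * card B \<le> 2 * card V \<longrightarrow> card B < Suc (2 * card V)" by auto
  ultimately have "\<exists>A. (closed A \<and> 3 * card A \<le> 2 * card V) \<and>
      (\<forall>B. closed B \<and> 3 * card B \<le> 2 * card V \<longrightarrow> card B \<le> card A)"
    by (rule ex_has_greatest_nat)
  then obtain A where A: "closed A" "3 * card A \<le> 2 * card V"
    and max: "\<And>B. closed B \<Longrightarrow> 3 * card B \<le> 2 * card V \<Longrightarrow> card B \<le> card A"
    by blast
  have AW: "A \<subseteq> W" using A by (simp add: closed_def)
  have cA: "card A + card (W - A) = card W"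
    using AW finW by (metis card_Diff_subset card_mono finite_subset le_add_diff_inverse)
  obtain x where x: "x \<in> W" "x \<notin> A"
    using unbal[OF A] by (metis DiffE card.empty ex_in_conv gr_implies_not0 mult_0_right)
  define U where "U = component E W x"
  have UW: "U \<subseteq> W" unfolding U_def by (rule component_subset[OF x(1)])
  have Ucl: "closed U"
    using UW component_closed[OF x(1)] by (auto simp: closed_def U_def)
  have disj: "U \<subseteq> - A"
    by (rule conn_subset_closed[OF component_conn[OF E x(1)], of x, folded U_def])
      (use x A(1) UW component_self symD[OF E] in \<open>auto simp: closed_def U_def\<close>)
  have "closed (A \<union> U)" using A(1) Ucl by (auto simp: closed_def)
  moreover have "card A < card (A \<union> U)"
  proof (rule psubset_card_mono)
    show "finite (A \<union> U)" using AW UW finW finite_subset by (metis Un_least)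
    show "A \<subset> A \<union> U" using x component_self[of x E W] by (auto simp: U_def)
  qed
  ultimately have "2 * card V < 3 * card (A \<union> U)" using max by (metis not_less)
  also have "card (A \<union> U) \<le> card A + card U" by (rule card_Un_le)
  finally have AU: "2 * card V < 3 * (card A + card U)" by simp
  have cU: "card U + card (W - U) = card W"
    using UW finW by (metis card_Diff_subset card_mono finite_subset le_add_diff_inverse)
  have "card V < 2 * card U"
  proof (rule ccontr)
    assume "\<not> card V < 2 * card U"
    then have "3 * card U \<le> 2 * card V" by linarith
    from unbal[OF Ucl this] have "3 * card U < card V" using cU WV by linarith
    moreover have "3 * card A < card V" using unbal[OF A] cA WV by linarith
    ultimately show False using AU by simp
  qed
  then show ?thesis using UW component_conn[OF E x(1)] Ucl
    unfolding closed_def W_def[symmetric] U_def[symmetric] by blast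
qed

text \<open>Without a separator, \<open>guarded_step\<close> applies forever, starting from the
  empty clique model: each step adds at most one branch set, and the number can never be exactly
  \<open>h\<close>.\<close>

lemma separator_from_parameters:
  assumes E: "sym E" and V: "finite V" and nominor: "\<not> has_clique_minor E V h"
    and r: "r > 0" and q: "h * r + 1 \<le> q" "h * (card V div r) \<le> q"
  shows "\<exists>X A B. X \<subseteq> V \<and> card X \<le> h * q \<and> V - X = A \<union> B \<and> A \<inter> B = {} \<and>
    3 * card A \<le> 2 * card V \<and> 3 * card B \<le> 2 * card V \<and> (\<forall>a\<in>A. \<forall>b\<in>B. (a, b) \<notin> E)"
proof (rule ccontr)
  assume nosep: "\<not> ?thesis"
  have big: "\<exists>U. U \<subseteq> V - X \<and> conn E U \<and> card V < 2 * card U \<and>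
         (\<forall>x\<in>U. \<forall>y\<in>V - X. (x, y) \<in> E \<longrightarrow> y \<in> U)" if "X \<subseteq> V" "card X \<le> h * q" for X
    by (rule separator_or_big_component[OF E V \<open>X \<subseteq> V\<close>]) (use nosep that in simp)
  have no_guarded: "\<not> (guarded E V q D \<C> \<and> card \<C> < h)" for D \<C>
  \<comment> \<open>The weight \<open>h + 1\<close> lets the loss of one vertex of \<open>D\<close>
    pay for a model of any size below \<open>h\<close>.\<close>
  proof (induction "(h + 1) * card D + card \<C>" arbitrary: D \<C> rule: less_induct)
    case less
    show ?case
    proof (intro notI, elim conjE)
      assume g: "guarded E V q D \<C>" and h: "card \<C> < h"
      from guarded_step[OF E V r q big g h] obtain D' \<C>' where g': "guarded E V q D' \<C>'"
        and dec: "card D' < card D \<and> card \<C>' \<le> Suc (card \<C>) \<or> D' = D \<and> card \<C>' < card \<C>"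
        by blast
      have "card \<C>' \<noteq> h"
        using nominor guardedD(4)[OF g'] unfolding has_clique_minor_def by blast
      then have h': "card \<C>' < h" using dec h by linarith
      have "(h + 1) * card D' + card \<C>' < (h + 1) * card D + card \<C>"
      proof (cases "card D' < card D")
        case True
        then have "(h + 1) * Suc (card D') \<le> (h + 1) * card D"
          by (intro mult_left_mono) auto
        then show ?thesis using h' by simp
      qed (use dec in simp)
      then show False using less g' h' by blast
    qed
  qed
  have "\<not> card ({}::'a set set) = h"
    using nominor unfolding has_clique_minor_def clique_model_def by blast
  then have "card ({}::'a set set) < h" by simp
  moreover obtain U where U: "U \<subseteq> V" "conn E U" "card V < 2 * card U"
      "\<forall>x\<in>U. \<forall>y\<in>V. (x, y) \<in> E \<longrightarrow> y \<in> U"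
    using big[of "{}"] by auto
  then have "guarded E V q U {}"
    by (intro guardedI) (auto simp: clique_model_def nbhd_def)
  ultimately show False using no_guarded by blast
qed

text \<open>The radius \<open>r\<close> is about the square root of \<open>card V\<close>, which
  balances the two demands on \<open>q\<close>: short connecting sets, of total size
  \<open>h * r + 1\<close>, and thin layers, of total size
  \<open>h * (card V div r)\<close>.\<close>

lemma balanced_separator:
  assumes E: "sym E" and V: "finite V" and nominor: "\<not> has_clique_minor E V h"
  obtains X A B where "X \<subseteq> V" "V - X = A \<union> B" "A \<inter> B = {}"
    "real (card X) \<le> real (h * (2 * h + 1)) * sqrt (card V)"
    "3 * card A \<le> 2 * card V" "3 * card B \<le> 2 * card V"
    "\<And>a b. a \<in> A \<Longrightarrow> b \<in> B \<Longrightarrow> (a, b) \<notin> E"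
proof (cases "V = {}")
  case True
  then show ?thesis using that[of "{}" "{}" "{}"] by simp
next
  case False
  define n where "n = real (card V)"
  have n: "n \<ge> 1" using False V by (simp add: n_def Suc_leI card_gt_0_iff)
  have sn: "sqrt n \<ge> 1" using n by simp
  define r where "r = nat \<lceil>sqrt n\<rceil>"
  have r1: "sqrt n \<le> real r" unfolding r_def by linarith
  have r2: "real r \<le> 2 * sqrt n" using sn unfolding r_def by linarith
  have r0: "r > 0" using r1 sn by (cases r) auto
  define q where "q = max (h * r + 1) (h * (card V div r))"
  have "real (h * r + 1) \<le> real (2 * h + 1) * sqrt n"
  proof -
    have "real h * real r \<le> real h * (2 * sqrt n)" by (intro mult_left_mono r2) auto
    then have "real h * real r + 1 \<le> real h * (2 * sqrt n) + sqrt n" using sn by linarith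
    then show ?thesis by (simp add: algebra_simps)
  qed
  moreover have "real (h * (card V div r)) \<le> real (2 * h + 1) * sqrt n"
  proof -
    have "real (card V div r) \<le> n / real r"
      unfolding n_def by (rule of_nat_div_le_of_nat)
    also have "\<dots> \<le> n / sqrt n"
      using r1 r0 n by (intro divide_left_mono) auto
    also have "\<dots> = sqrt n" using n by (simp add: real_div_sqrt)
    finally have "real h * real (card V div r) \<le> real h * sqrt n" by (intro mult_left_mono) auto
    also have "\<dots> \<le> real (2 * h + 1) * sqrt n" using sn by (intro mult_right_mono) auto
    finally show ?thesis by simp
  qed
  ultimately have q: "real q \<le> real (2 * h + 1) * sqrt n" by (simp add: q_def max_def)
  obtain X A B where X: "X \<subseteq> V" "card X \<le> h * q" "V - X = A \<union> B" "A \<inter> B = {}"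
    "3 * card A \<le> 2 * card V" "3 * card B \<le> 2 * card V" "\<forall>a\<in>A. \<forall>b\<in>B. (a, b) \<notin> E"
    using separator_from_parameters[OF E V nominor r0, of q] by (auto simp: q_def)
  have "real (card X) \<le> real h * real q" using X(2) by (metis of_nat_le_iff of_nat_mult)
  also have "\<dots> \<le> real h * (real (2 * h + 1) * sqrt n)" by (intro mult_left_mono q) auto
  also have "\<dots> = real (h * (2 * h + 1)) * sqrt (card V)" by (simp add: n_def algebra_simps)
  finally show ?thesis using that[OF X(1,3,4) _ X(5,6)] X(7) by blast
qed

section \<open>Divisions by recursive separation\<close>

text \<open>Squaring leaves \<open>a + b\<close> plus twice the root of \<open>a * b\<close>, at
  least 5/3 of \<open>n\<close>, which exceeds 25/16 of \<open>n\<close>. This quantitative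
  concavity is the gain that pays for separators in the recursion.\<close>

lemma sqrt_sum_ge:
  fixes a b n :: real
  assumes "n \<ge> 0" "n / 3 \<le> a" "n / 3 \<le> b" "n \<le> a + b"
  shows "5 / 4 * sqrt n \<le> sqrt a + sqrt b"
proof -
  have ab: "a \<ge> 0" "b \<ge> 0" using assms by auto
  have "(n / 3) * (n / 3) \<le> a * b" using assms by (intro mult_mono) auto
  then have "sqrt ((n / 3) * (n / 3)) \<le> sqrt (a * b)" by (rule real_sqrt_le_mono)
  moreover have "sqrt ((n / 3) * (n / 3)) = n / 3" using assms(1) by (subst real_sqrt_abs2) simp
  ultimately have "n / 3 \<le> sqrt a * sqrt b" by (simp only: real_sqrt_mult)
  moreover have "(sqrt a + sqrt b)\<^sup>2 = a + b + 2 * (sqrt a * sqrt b)"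
    using ab by (simp add: power2_sum)
  moreover have "(5 / 4 * sqrt n)\<^sup>2 = 25 / 16 * n"
    using assms(1) by (simp add: power_mult_distrib power2_eq_square)
  ultimately have "(5 / 4 * sqrt n)\<^sup>2 \<le> (sqrt a + sqrt b)\<^sup>2" using assms by linarith
  then show ?thesis by (rule power2_le_imp_le) (use ab in auto)
qed

text \<open>A list, because equal regions from different branches of the recursion must be counted
  separately in the total size.\<close>

definition covers :: "('a \<times> 'a) set \<Rightarrow> 'a set \<Rightarrow> 'a set list \<Rightarrow> bool" where
  "covers E V Rs \<longleftrightarrow> \<Union>(set Rs) = V \<and> (\<forall>x\<in>V. \<forall>y\<in>V. (x, y) \<in> E \<longrightarrow> (\<exists>R\<in>set Rs. x \<in> R \<and> y \<in> R))"

lemma covers_append: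
  assumes "covers E (A \<union> X) Rs" "covers E (B \<union> X) Ss" "sym E"
    "\<And>a b. a \<in> A \<Longrightarrow> b \<in> B \<Longrightarrow> (a, b) \<notin> E"
  shows "covers E (A \<union> B \<union> X) (Rs @ Ss)"
  unfolding covers_def
proof (intro conjI ballI impI)
  show "\<Union>(set (Rs @ Ss)) = A \<union> B \<union> X" using assms(1,2) by (auto simp: covers_def)
  fix x y assume xy: "x \<in> A \<union> B \<union> X" "y \<in> A \<union> B \<union> X" "(x, y) \<in> E"
  have "(x \<in> A \<union> X \<and> y \<in> A \<union> X) \<or> (x \<in> B \<union> X \<and> y \<in> B \<union> X)"
    using xy assms(4) symD[OF assms(3)] by blast
  then show "\<exists>R\<in>set (Rs @ Ss). x \<in> R \<and> y \<in> R"
    using assms(1,2) xy(3) unfolding covers_def set_append by blast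
qed

text \<open>The subtracted square-root term is a potential that makes the induction close. Splitting
  at a separator \<open>X\<close> raises the sum of the roots by a quarter of the old root, worth
  \<open>2 * \<kappa> * sqrt n\<close> by the choice of \<open>r\<close>, and this pays for counting
  \<open>X\<close> twice. A set with at most \<open>r\<close> vertices is a single region; the lower
  bound \<open>r / 4\<close> ensures that the potential is then at most the allowance
  \<open>\<eta> * card W\<close>. It is inherited, since parts of a set larger than \<open>r\<close>
  keep at least a third of it.\<close>

lemma division_aux:
  fixes \<eta> r :: real
  assumes E: "sym E" and nominor: "\<not> has_clique_minor E V h" and V: "finite V" and h: "h > 0"
    and \<eta>: "0 < \<eta>" "\<eta> \<le> 1" and r: "16 * real (h * (2 * h + 1)) / \<eta> \<le> sqrt r"
    and W: "W \<subseteq> V" "r / 4 \<le> real (card W)"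
  shows "\<exists>Rs. covers E W Rs \<and> (\<forall>R\<in>set Rs. real (card R) \<le> r) \<and>
     real (sum_list (map card Rs)) \<le> (1 + \<eta>) * card W - \<eta> * sqrt r / 2 * sqrt (card W)"
  using W
proof (induction "card W" arbitrary: W rule: less_induct)
  case less
  define \<kappa> where "\<kappa> = real (h * (2 * h + 1))"
  define n where "n = real (card W)"
  have \<kappa>: "\<kappa> \<ge> 1" unfolding \<kappa>_def using h by (metis One_nat_def Suc_leI add_gr_0 mult_pos_pos of_nat_1 of_nat_le_iff zero_less_one)
  have r16: "16 * \<kappa> \<le> sqrt r * \<eta>" using r \<eta> by (simp add: \<kappa>_def field_simps)
  have sr: "sqrt r \<ge> 16 * \<kappa>"
  proof -
    have "sqrt r \<ge> 0" using r16 \<kappa> \<eta> by (smt (verit) mult_nonpos_nonneg)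
    then have "sqrt r * \<eta> \<le> sqrt r * 1" using \<eta> by (intro mult_left_mono) auto
    then show ?thesis using r16 by simp
  qed
  have r0: "r > 0" using sr \<kappa> by (smt (verit) real_sqrt_le_0_iff)
  show ?case
  proof (cases "n \<le> r")
    case True
    have "sqrt (r / 4) \<le> sqrt n" using less.prems(2) by (simp add: n_def)
    then have "sqrt r / 2 \<le> sqrt n" by (simp add: real_sqrt_divide)
    then have "\<eta> * (sqrt r / 2) * sqrt n \<le> \<eta> * sqrt n * sqrt n"
      using \<eta> by (intro mult_right_mono mult_left_mono) (auto simp: n_def)
    then have "n \<le> (1 + \<eta>) * n - \<eta> * sqrt r / 2 * sqrt n"
      by (simp add: algebra_simps n_def)
    then show ?thesis using True
      by (intro exI[of _ "[W]"]) (auto simp: covers_def n_def)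
  next
    case False
    have finW: "finite W" using less.prems(1) V finite_subset by blast
    obtain X A B where X: "X \<subseteq> W" "W - X = A \<union> B" "A \<inter> B = {}"
      "real (card X) \<le> \<kappa> * sqrt (card W)" "3 * card A \<le> 2 * card W" "3 * card B \<le> 2 * card W"
      "\<And>a b. a \<in> A \<Longrightarrow> b \<in> B \<Longrightarrow> (a, b) \<notin> E"
      using balanced_separator[OF E finW, of h] nominor has_clique_minor_mono[OF _ less.prems(1)]
      unfolding \<kappa>_def by metis
    have W: "W = A \<union> B \<union> X" using X(1,2) by blast
    have disj: "A \<inter> X = {}" "B \<inter> X = {}" using X(2) by auto
    have fin: "finite A" "finite B" "finite X" using W finW by auto
    have cW: "card W = card A + card B + card X"
      unfolding W using fin disj X(3) by (subst card_Un_disjoint; auto simp: card_Un_disjoint)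
    have cAX: "card (A \<union> X) = card A + card X" and cBX: "card (B \<union> X) = card B + card X"
      using fin disj by (auto simp: card_Un_disjoint)
    define a b where "a = real (card (A \<union> X))" and "b = real (card (B \<union> X))"
    have snr: "sqrt r \<le> sqrt n" using False by simp
    \<comment> \<open>Keeps \<open>X\<close> below a third of \<open>W\<close>, so that both parts,
      each including \<open>X\<close>, are strictly smaller.\<close>
    have "3 * \<kappa> < sqrt n" using snr sr \<kappa> by linarith
    then have "3 * \<kappa> * sqrt n < sqrt n * sqrt n" using \<kappa> by (intro mult_strict_right_mono) linarith+
    then have kn: "3 * (\<kappa> * sqrt n) < n" by (simp add: n_def)
    have X4: "real (card X) \<le> \<kappa> * sqrt n" using X(4) by (simp add: n_def)
    have A3: "3 * real (card A) \<le> 2 * n" "3 * real (card B) \<le> 2 * n"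
      using X(5,6) unfolding n_def by (metis of_nat_le_iff of_nat_mult of_nat_numeral)+
    have nW: "n = real (card A) + real (card B) + real (card X)" by (simp add: n_def cW)
    have a: "n / 3 \<le> a" "a < n" and b: "n / 3 \<le> b" "b < n" and ab: "a + b = n + real (card X)"
      using A3 X4 kn nW by (auto simp: a_def b_def cAX cBX)
    have "r / 4 \<le> a" "r / 4 \<le> b" using a b False r0 by auto
    then obtain Rs Ss where Rs: "covers E (A \<union> X) Rs" "\<forall>R\<in>set Rs. real (card R) \<le> r"
        "real (sum_list (map card Rs)) \<le> (1 + \<eta>) * a - \<eta> * sqrt r / 2 * sqrt a"
      and Ss: "covers E (B \<union> X) Ss" "\<forall>R\<in>set Ss. real (card R) \<le> r"
        "real (sum_list (map card Ss)) \<le> (1 + \<eta>) * b - \<eta> * sqrt r / 2 * sqrt b"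
      using less.hyps[of "A \<union> X"] less.hyps[of "B \<union> X"] a b less.prems(1) W
      by (auto simp: a_def b_def n_def)
    have "covers E W (Rs @ Ss)"
      unfolding W by (rule covers_append[OF Rs(1) Ss(1) E X(7)])
    moreover have "real (sum_list (map card (Rs @ Ss))) \<le> (1 + \<eta>) * n - \<eta> * sqrt r / 2 * sqrt n"
    proof -
      have "8 * \<kappa> * (sqrt n / 4) \<le> \<eta> * sqrt r / 2 * (sqrt a + sqrt b - sqrt n)"
        using sqrt_sum_ge[of n a b] a b ab r16 \<kappa>
        by (intro mult_mono) (auto simp: n_def algebra_simps)
      moreover have "(1 + \<eta>) * real (card X) \<le> 2 * (\<kappa> * sqrt n)"
        using \<eta> X4 by (intro mult_mono) auto
      moreover have "(1 + \<eta>) * a + (1 + \<eta>) * b = (1 + \<eta>) * n + (1 + \<eta>) * real (card X)"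
        using ab by (simp add: distrib_left[symmetric])
      ultimately show ?thesis using Rs(3) Ss(3) by (simp add: algebra_simps)
    qed
    ultimately show ?thesis using Rs(2) Ss(2) unfolding n_def
      by (intro exI[of _ "Rs @ Ss"]) auto
  qed
qed

lemma division:
  fixes \<eta> r :: real
  assumes E: "sym E" and nominor: "\<not> has_clique_minor E V h" and V: "finite V" and h: "h > 0"
    and \<eta>: "0 < \<eta>" "\<eta> \<le> 1" and r: "16 * real (h * (2 * h + 1)) / \<eta> \<le> sqrt r"
  obtains Rs where "covers E V Rs" "\<And>R. R \<in> set Rs \<Longrightarrow> real (card R) \<le> r"
     "real (sum_list (map card Rs)) \<le> (1 + \<eta>) * card V"
proof (cases "r / 4 \<le> real (card V)")
  case True
  have "0 \<le> 16 * real (h * (2 * h + 1)) / \<eta>" using \<eta> by auto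
  then have "0 \<le> sqrt r" using r by linarith
  then have "0 \<le> \<eta> * sqrt r / 2 * sqrt (card V)"
    using \<eta> by (intro mult_nonneg_nonneg divide_nonneg_nonneg) auto
  moreover obtain Rs where "covers E V Rs" "\<forall>R\<in>set Rs. real (card R) \<le> r"
     "real (sum_list (map card Rs)) \<le> (1 + \<eta>) * card V - \<eta> * sqrt r / 2 * sqrt (card V)"
    using division_aux[OF assms subset_refl True] by blast
  ultimately show ?thesis using that[of Rs] by simp
next
  case False
  have "0 \<le> 16 * real (h * (2 * h + 1)) / \<eta>" using \<eta> by auto
  then have "0 \<le> r" using r by (metis order_trans real_sqrt_ge_0_iff)
  then show ?thesis using False \<eta> that[of "[V]"] by (auto simp: covers_def mult_le_cancel_right1 algebra_simps)
qed

section \<open>Groups of small total\<close>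

lemma pigeonhole_value:
  fixes f :: "'b \<Rightarrow> nat"
  assumes "finite S" "\<And>i. i \<in> S \<Longrightarrow> f i \<in> {1..r}" "r * r < card S"
  shows "\<exists>x\<in>{1..r}. r \<le> card {i\<in>S. f i = x}"
proof (rule ccontr)
  assume *: "\<not> ?thesis"
  have "S = (\<Union>x\<in>{1..r}. {i\<in>S. f i = x})" using assms(2) by auto
  then have "card S = card (\<Union>x\<in>{1..r}. {i\<in>S. f i = x})" by simp
  also have "\<dots> \<le> (\<Sum>x\<in>{1..r}. card {i\<in>S. f i = x})" by (rule card_UN_le) simp
  also have "\<dots> \<le> (\<Sum>x\<in>{1..r}. r)" by (rule sum_mono) (use * in \<open>auto simp: not_le less_imp_le\<close>)
  finally show False using assms(3) by simp
qed

text \<open>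
  Either many positive and many negative values occur, so that some positive value \<open>x\<close> and some
  negative value \<open>-y\<close> occur often enough to cancel \<open>y\<close> copies of \<open>x\<close> against \<open>x\<close> copies of \<open>-y\<close>,
  or all positive values can be absorbed into a single group.
\<close>

lemma nonpositive_part:
  fixes a :: "'b \<Rightarrow> int"
  assumes fin: "finite I" and ne: "I \<noteq> {}" and r: "r > 0"
    and bd: "\<And>i. i \<in> I \<Longrightarrow> \<bar>a i\<bar> \<le> int r" and neg: "sum a I \<le> 0"
  shows "\<exists>J\<subseteq>I. J \<noteq> {} \<and> card J \<le> 2 * r ^ 3 + 1 \<and> sum a J \<le> 0 \<and> sum a (I - J) \<le> 0"
proof -
  define P N where "P = {i\<in>I. a i > 0}" and "N = {i\<in>I. a i < 0}"
  have finPN: "finite P" "finite N" using fin by (auto simp: P_def N_def)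
  have PN: "sum a I = sum a P + sum a N"
  proof -
    have "sum a I = sum a (P \<union> N)"
      by (rule sum.mono_neutral_right[OF fin]) (auto simp: P_def N_def)
    then show ?thesis using finPN by (simp add: sum.union_disjoint P_def N_def disjoint_iff)
  qed
  have r13: "r * r \<le> r ^ 3" using r by (simp add: power3_eq_cube)
  have cardN: "int (card S) \<le> - sum a S" if "S \<subseteq> N" for S
  proof -
    have "(\<Sum>i\<in>S. 1) \<le> (\<Sum>i\<in>S. - a i)" by (rule sum_mono) (use that in \<open>force simp: N_def\<close>)
    then show ?thesis by (simp add: sum_negf)
  qed
  have cardP: "int (card S) \<le> sum a S" if "S \<subseteq> P" for S
  proof -
    have "(\<Sum>i\<in>S. 1) \<le> (\<Sum>i\<in>S. a i)" by (rule sum_mono) (use that in \<open>force simp: P_def\<close>)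
    then show ?thesis by simp
  qed
  have sumP: "sum a S \<le> int (card S) * int r" if "S \<subseteq> I" for S
    using sum_bounded_above[of S a "int r"] bd that by fastforce
  have sumN: "- sum a S \<le> int (card S) * int r" if "S \<subseteq> I" for S
    using sum_bounded_above[of S "\<lambda>i. - a i" "int r"] bd that by (fastforce simp: sum_negf)
  show ?thesis
  proof (cases "P = {}")
    case True
    obtain i where "i \<in> I" using ne by blast
    moreover have "a j \<le> 0" if "j \<in> I" for j using True that by (force simp: P_def)
    ultimately show ?thesis by (intro exI[of _ "{i}"]) (auto intro: sum_nonpos)
  next
    case False
    show ?thesis
    proof (cases "card P \<le> r * r")
      case True
      \<comment> \<open>A smallest set of negative indices that absorbs all positive ones. Without
        one of its elements the total would be positive, so its size is at most the positive total,
        which is at most \<open>r ^ 3\<close>.\<close>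
      let ?Q = "\<lambda>S. S \<subseteq> N \<and> sum a P + sum a S \<le> 0"
      have "?Q N" using neg PN by simp
      then obtain S where S: "?Q S" and min: "\<And>T. ?Q T \<Longrightarrow> card S \<le> card T"
        using ex_has_least_nat[of ?Q N card] by blast
      have finS: "finite S" using S finPN finite_subset by blast
      have "int (card S) \<le> sum a P"
      proof (cases "S = {}")
        case True
        then show ?thesis using cardP[of P] by simp
      next
        case False
        then obtain i where i: "i \<in> S" by blast
        have "\<not> ?Q (S - {i})"
          using min[of "S - {i}"] i finS by (metis card_Diff1_less not_le)
        then have "sum a P + sum a (S - {i}) > 0" using S by (meson Diff_subset not_le order_trans)
        then have "int (card (S - {i})) < sum a P" using cardN[of "S - {i}"] S by force
        then show ?thesis using i finS by (simp add: card_gt_0_iff of_nat_diff)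
      qed
      also have "\<dots> \<le> int (card P) * int r" by (rule sumP) (auto simp: P_def)
      also have "\<dots> \<le> int (r * r) * int r" using True by (intro mult_right_mono of_nat_mono) auto
      finally have cS: "card S \<le> r ^ 3" by (metis of_nat_le_iff of_nat_mult power3_eq_cube)
      have dis: "P \<inter> S = {}" using S by (auto simp: P_def N_def)
      have "sum a (P \<union> S) \<le> 0" using S finPN finS dis by (simp add: sum.union_disjoint)
      moreover have "sum a (I - (P \<union> S)) \<le> 0" by (rule sum_nonpos) (auto simp: P_def)
      moreover have "card (P \<union> S) \<le> 2 * r ^ 3 + 1"
        using card_Un_le[of P S] cS True r13 by linarith
      ultimately show ?thesis using False S by (intro exI[of _ "P \<union> S"]) (auto simp: P_def N_def)
    next
      case Pbig: False
      show ?thesis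
      proof (cases "card N \<le> r * r")
        case True
        \<comment> \<open>With few negative indices their total weight, and hence the number of
          positive indices, is at most \<open>r ^ 3\<close>; all nonzero values fit into one
          group.\<close>
        have "int (card P) \<le> sum a P" by (rule cardP) simp
        also have "\<dots> \<le> - sum a N" using neg PN by simp
        also have "\<dots> \<le> int (card N) * int r" by (rule sumN) (auto simp: N_def)
        also have "\<dots> \<le> int (r * r) * int r" using True by (intro mult_right_mono of_nat_mono) auto
        finally have cP: "card P \<le> r ^ 3" by (metis of_nat_le_iff of_nat_mult power3_eq_cube)
        have dis: "P \<inter> N = {}" by (auto simp: P_def N_def)
        have "sum a (P \<union> N) \<le> 0" using PN neg finPN dis by (simp add: sum.union_disjoint)
        moreover have "sum a (I - (P \<union> N)) \<le> 0" by (rule sum_nonpos) (auto simp: P_def)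
        moreover have "card (P \<union> N) \<le> 2 * r ^ 3 + 1"
          using card_Un_le[of P N] cP True r13 by linarith
        ultimately show ?thesis using False by (intro exI[of _ "P \<union> N"]) (auto simp: P_def N_def)
      next
        case Nbig: False
        have "\<exists>x\<in>{1..r}. r \<le> card {i\<in>P. nat (a i) = x}"
          by (rule pigeonhole_value[OF finPN(1)]) (use bd Pbig in \<open>force simp: P_def\<close>)+
        then obtain x where x: "x \<in> {1..r}" "r \<le> card {i\<in>P. nat (a i) = x}" by blast
        have "\<exists>y\<in>{1..r}. r \<le> card {i\<in>N. nat (- a i) = y}"
          by (rule pigeonhole_value[OF finPN(2)]) (use bd Nbig in \<open>force simp: N_def\<close>)+
        then obtain y where y: "y \<in> {1..r}" "r \<le> card {i\<in>N. nat (- a i) = y}" by blast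
        obtain S where S: "S \<subseteq> {i\<in>P. nat (a i) = x}" "card S = y" "finite S"
          using obtain_subset_with_card_n[of y "{i\<in>P. nat (a i) = x}"] x y by auto
        obtain T where T: "T \<subseteq> {i\<in>N. nat (- a i) = y}" "card T = x" "finite T"
          using obtain_subset_with_card_n[of x "{i\<in>N. nat (- a i) = y}"] x y by auto
        have "sum a S = (\<Sum>i\<in>S. int x)" by (rule sum.cong) (use S in \<open>auto simp: P_def\<close>)
        moreover have "sum a T = (\<Sum>i\<in>T. - int y)" by (rule sum.cong) (use T in \<open>force simp: N_def\<close>)+
        moreover have dis: "S \<inter> T = {}" using S(1) T(1) unfolding P_def N_def by fastforce
        ultimately have 0: "sum a (S \<union> T) = 0"
          using S T by (simp add: sum.union_disjoint)
        have sub: "S \<union> T \<subseteq> I" using S T by (auto simp: P_def N_def)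
        have "sum a (I - (S \<union> T)) \<le> 0" using sum_diff[OF fin sub, of a] 0 neg by simp
        moreover have "card (S \<union> T) \<le> 2 * r ^ 3 + 1"
        proof -
          have "card (S \<union> T) \<le> x + y" using card_Un_le[of S T] S T by simp
          also have "\<dots> \<le> r + r" using x y by simp
          also have "r \<le> r ^ 3" using r by (simp add: self_le_power)
          finally show ?thesis by simp
        qed
        moreover have "S \<union> T \<noteq> {}" using S(2) y by auto
        ultimately show ?thesis using 0 sub by (intro exI[of _ "S \<union> T"]) auto
      qed
    qed
  qed
qed

lemma nonpositive_groups:
  fixes a :: "'b \<Rightarrow> int"
  assumes "finite I" "r > 0" "\<And>i. i \<in> I \<Longrightarrow> \<bar>a i\<bar> \<le> int r" "sum a I \<le> 0"
  shows "\<exists>\<P>. partition_on I \<P> \<and> (\<forall>J\<in>\<P>. card J \<le> 2 * r ^ 3 + 1 \<and> sum a J \<le> 0)"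
  using assms
proof (induction "card I" arbitrary: I rule: less_induct)
  case less
  show ?case
  proof (cases "I = {}")
    case True
    then show ?thesis by (intro exI[of _ "{}"]) (simp add: partition_on_empty)
  next
    case False
    obtain J where J: "J \<subseteq> I" "J \<noteq> {}" "card J \<le> 2 * r ^ 3 + 1" "sum a J \<le> 0" "sum a (I - J) \<le> 0"
      using nonpositive_part[OF less.prems(1) False less.prems(2-4)] by blast
    have "card (I - J) < card I" using J less.prems(1) by (intro psubset_card_mono) auto
    then obtain \<P> where P: "partition_on (I - J) \<P>" "\<forall>J\<in>\<P>. card J \<le> 2 * r ^ 3 + 1 \<and> sum a J \<le> 0"
      using less.hyps[of "I - J"] less.prems J(5) by fastforce
    have "disjnt J (\<Union>\<P>)" using P(1) by (auto simp: partition_on_def disjnt_def)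
    then have "partition_on I (insert J \<P>)" using P(1) J(1,2) by (simp add: partition_on_insert)
    then show ?thesis using P J by (intro exI[of _ "insert J \<P>"]) auto
  qed
qed

text \<open>
  Taking a partition with the fewest parts, any two parts are together larger than the limit.
\<close>

lemma merge_groups:
  fixes sz :: "'b \<Rightarrow> nat" and a :: "'b \<Rightarrow> int"
  assumes fin: "finite I" and P0: "partition_on I \<P>0" "\<And>J. J \<in> \<P>0 \<Longrightarrow> sum sz J \<le> R \<and> sum a J \<le> 0"
  shows "\<exists>\<P>. partition_on I \<P> \<and> (\<forall>J\<in>\<P>. sum sz J \<le> 2 * R \<and> sum a J \<le> 0) \<and>
     card \<P> * R \<le> sum sz I + R"
proof -
  let ?Q = "\<lambda>\<P>. partition_on I \<P> \<and> (\<forall>J\<in>\<P>. sum sz J \<le> 2 * R \<and> sum a J \<le> 0)"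
  have "?Q \<P>0" using P0 by force
  then obtain \<P> where Q: "?Q \<P>" and min: "\<And>\<P>'. ?Q \<P>' \<Longrightarrow> card \<P> \<le> card \<P>'"
    using ex_has_least_nat[of ?Q \<P>0 card] by blast
  have finP: "finite \<P>" using Q fin by (metis finite_elements)
  have finJ: "finite J" if "J \<in> \<P>" for J
    using that Q fin by (metis partition_onD1 Sup_upper finite_subset)
  have two: "R < sum sz J \<or> R < sum sz J'" if J: "J \<in> \<P>" "J' \<in> \<P>" "J \<noteq> J'" for J J'
  proof (rule ccontr)
    assume *: "\<not> ?thesis"
    define \<P>' where "\<P>' = insert (J \<union> J') (\<P> - {J, J'})"
    have dis: "J \<inter> J' = {}" using J Q by (metis partition_onD2 disjointD)
    have "?Q \<P>'"
    proof (rule conjI)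
      show "partition_on I \<P>'"
      proof (rule partition_onI)
        show "\<Union>\<P>' = I" using Q J by (auto simp: \<P>'_def partition_on_def)
        show "{} \<notin> \<P>'" using Q J by (auto simp: \<P>'_def partition_on_def)
        show "disjnt p p'" if "p \<in> \<P>'" "p' \<in> \<P>'" "p \<noteq> p'" for p p'
          using that Q J unfolding \<P>'_def partition_on_def disjoint_def disjnt_def by blast
      qed
      show "\<forall>K\<in>\<P>'. sum sz K \<le> 2 * R \<and> sum a K \<le> 0"
      proof
        fix K assume "K \<in> \<P>'"
        then consider "K = J \<union> J'" | "K \<in> \<P>" by (auto simp: \<P>'_def)
        then show "sum sz K \<le> 2 * R \<and> sum a K \<le> 0"
        proof cases
          case 1
          then show ?thesis using * Q J dis finJ by (auto simp: sum.union_disjoint intro: add_nonpos_nonpos)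
        qed (use Q in auto)
      qed
    qed
    then have "card \<P> \<le> card \<P>'" by (rule min)
    also have "\<dots> \<le> Suc (card (\<P> - {J, J'}))" unfolding \<P>'_def using finP by (simp add: card_insert_if)
    also have "\<dots> = Suc (card \<P> - 2)" using J finP by (subst card_Diff_subset) auto
    finally have "card \<P> \<le> Suc (card \<P> - 2)" .
    moreover have "card {J, J'} \<le> card \<P>" using J finP by (intro card_mono) auto
    ultimately show False using J(3) by simp
  qed
  have "card \<P> * R \<le> sum sz I + R"
  proof (cases "\<exists>J0\<in>\<P>. sum sz J0 \<le> R")
    case True
    then obtain J0 where J0: "J0 \<in> \<P>" "sum sz J0 \<le> R" by blast
    have "card \<P> * R = R + card (\<P> - {J0}) * R"
      using J0 finP by (simp add: card_Suc_Diff1[symmetric, of \<P> J0] del: card_Diff_insert card_Diff_singleton)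
    also have "card (\<P> - {J0}) * R \<le> (\<Sum>J\<in>\<P> - {J0}. sum sz J)"
      using sum_bounded_below[of "\<P> - {J0}" R "sum sz"] two[OF J0(1)] J0 by fastforce
    also have "\<dots> \<le> (\<Sum>J\<in>\<P>. sum sz J)" using finP by (intro sum_mono2) auto
    also have "\<dots> = sum sz I" using sum.partition[OF fin, of \<P> sz] Q by simp
    finally show ?thesis by simp
  next
    case False
    have "card \<P> * R \<le> (\<Sum>J\<in>\<P>. sum sz J)"
      using sum_bounded_below[of \<P> R "sum sz"] False by fastforce
    then show ?thesis using sum.partition[OF fin, of \<P> sz] Q by simp
  qed
  then show ?thesis using Q by blast
qed

section \<open>Elementary estimates\<close>

text \<open>In the graph of a function the average in-degree is at most 1, so some \<open>x\<close>
  has at most one preimage in \<open>A\<close>. Choosing \<open>x\<close> and deleting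
  \<open>x\<close>, \<open>g x\<close> and that preimage spends at most three elements per
  choice.\<close>

lemma independent_third:
  assumes "finite A" "\<And>x. x \<in> A \<Longrightarrow> g x \<noteq> x"
  shows "\<exists>A'\<subseteq>A. card A \<le> 3 * card A' \<and> (\<forall>x\<in>A'. g x \<notin> A')"
  using assms
proof (induction "card A" arbitrary: A rule: less_induct)
  case less
  show ?case
  proof (cases "A = {}")
    case True
    then show ?thesis by simp
  next
    case False
    have "\<exists>x\<in>A. card {y\<in>A. g y = x} \<le> 1"
    proof (rule ccontr)
      assume *: "\<not> ?thesis"
      have "2 * card A = (\<Sum>x\<in>A. 2)" by simp
      also have "\<dots> \<le> (\<Sum>x\<in>A. card {y\<in>A. g y = x})" using * by (intro sum_mono) force
      also have "\<dots> = card (\<Union>x\<in>A. {y\<in>A. g y = x})"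
        using less.prems(1) by (intro card_UN_disjoint[symmetric]) auto
      also have "\<dots> \<le> card A" using less.prems(1) by (intro card_mono) auto
      finally show False using False less.prems(1) by simp
    qed
    then obtain x where x: "x \<in> A" "card {y\<in>A. g y = x} \<le> 1" by blast
    define X where "X = {x, g x} \<union> {y\<in>A. g y = x}"
    have "card X \<le> card {x, g x} + card {y\<in>A. g y = x}" unfolding X_def by (rule card_Un_le)
    moreover have "card {x, g x} \<le> 2" by (simp add: card_insert_if)
    ultimately have cX: "card X \<le> 3" using x by linarith
    have finX: "finite X" using less.prems(1) by (simp add: X_def)
    have xX: "x \<in> X" by (simp add: X_def)
    have "card (A - X) < card A" using x xX less.prems(1) by (intro psubset_card_mono) auto
    then obtain A' where A': "A' \<subseteq> A - X" "card (A - X) \<le> 3 * card A'" "\<forall>x\<in>A'. g x \<notin> A'"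
      using less.hyps[of "A - X"] less.prems by auto
    have "finite A'" using A'(1) less.prems(1) finite_subset by blast
    then have "card (insert x A') = Suc (card A')" using A'(1) xX by (subst card_insert_disjoint) auto
    moreover have "card A \<le> card (A - X) + card X"
      using diff_card_le_card_Diff[OF finX, of A] by linarith
    ultimately have "card A \<le> 3 * card (insert x A')" using A'(2) cX by linarith
    moreover have "\<forall>y\<in>insert x A'. g y \<notin> insert x A'"
    proof
      fix y assume "y \<in> insert x A'"
      then consider "y = x" | "y \<in> A'" by blast
      then show "g y \<notin> insert x A'"
      proof cases
        case 1
        then show ?thesis using A'(1) less.prems(2)[OF x(1)] by (auto simp: X_def)
      next
        case 2
        then show ?thesis using A'(1,3) by (auto simp: X_def)
      qed
    qed
    ultimately show ?thesis using A'(1) x(1) by (intro exI[of _ "insert x A'"]) auto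
  qed
qed

text \<open>Removing a most expensive element never raises the average; this is repeated until
  \<open>t\<close> elements are left.\<close>

lemma cheap_subset:
  fixes f :: "'b \<Rightarrow> real"
  assumes "finite S" "t \<le> card S"
  shows "\<exists>T\<subseteq>S. card T = t \<and> real (card S) * sum f T \<le> real t * sum f S"
  using assms
proof (induction "card S - t" arbitrary: S)
  case 0
  then show ?case by (intro exI[of _ S]) auto
next
  case (Suc m)
  then have ne: "S \<noteq> {}" "t < card S" by auto
  obtain x where x: "x \<in> S" "\<forall>y\<in>S. f y \<le> f x"
  proof -
    have "Max (f ` S) \<in> f ` S" using Suc.prems(1) ne by (intro Max_in) auto
    then obtain x where "x \<in> S" "Max (f ` S) = f x" by blast
    moreover have "\<forall>y\<in>S. f y \<le> Max (f ` S)" using Suc.prems(1) by simp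
    ultimately show ?thesis using that[of x] by simp
  qed
  define n where "n = card S"
  have n: "n > 0" "card (S - {x}) = n - 1" using ne x Suc.prems(1) by (auto simp: n_def)
  have "m = card (S - {x}) - t" "t \<le> card (S - {x})" using Suc(2) ne n by (auto simp: n_def)
  then obtain T where T: "T \<subseteq> S - {x}" "card T = t" "real (n - 1) * sum f T \<le> real t * sum f (S - {x})"
    using Suc.hyps(1)[of "S - {x}"] Suc.prems(1) n by auto
  have xS: "sum f S = f x + sum f (S - {x})" using x Suc.prems(1) by (simp add: sum.remove)
  have "sum f T \<le> real (card T) * f x"
    by (rule sum_bounded_above) (use x T in auto)
  then have "sum f T \<le> real t * f x" using T(2) by simp
  then have "real (n - 1) * sum f T + sum f T \<le> real t * sum f S"
    using T(3) by (simp add: xS algebra_simps)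
  then have "real n * sum f T \<le> real t * sum f S" using n by (simp add: algebra_simps of_nat_diff)
  then show ?case using T by (intro exI[of _ T]) (auto simp: n_def)
qed

lemma power_add_le:
  fixes x y :: real
  assumes "0 \<le> x" "0 \<le> y"
  shows "(x + y) ^ p \<le> 2 ^ p * (x ^ p + y ^ p)"
proof -
  have "(x + y) ^ p \<le> (2 * max x y) ^ p" using assms by (intro power_mono) auto
  also have "\<dots> = 2 ^ p * max x y ^ p" by (simp add: power_mult_distrib)
  also have "\<dots> \<le> 2 ^ p * (x ^ p + y ^ p)"
    using assms by (intro mult_left_mono) (auto simp: max_def)
  finally show ?thesis .
qed

lemma power_add4_le:
  fixes x y z w :: real
  assumes "0 \<le> x" "0 \<le> y" "0 \<le> z" "0 \<le> w"
  shows "(x + y + z + w) ^ p \<le> 4 ^ p * (x ^ p + y ^ p + z ^ p + w ^ p)"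
proof -
  have "(x + y + z + w) ^ p \<le> (4 * max (max x y) (max z w)) ^ p" using assms by (intro power_mono) auto
  also have "\<dots> = 4 ^ p * max (max x y) (max z w) ^ p" by (simp add: power_mult_distrib)
  also have "\<dots> \<le> 4 ^ p * (x ^ p + y ^ p + z ^ p + w ^ p)"
    using assms by (intro mult_left_mono) (auto simp: max_def)
  finally show ?thesis .
qed

lemma one_add_power_le:
  fixes s :: real
  assumes "0 \<le> s" "s \<le> 1"
  shows "(1 + s) ^ p \<le> 1 + 4 ^ p * s"
proof (induction p)
  case (Suc p)
  have "s * (s * 4 ^ p) \<le> 1 * (s * 4 ^ p)" using assms by (intro mult_right_mono) auto
  moreover have "s * 1 \<le> s * 4 ^ p" using assms by (intro mult_left_mono) auto
  moreover have "(1 + s) ^ Suc p \<le> (1 + s) * (1 + 4 ^ p * s)"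
    using Suc assms by (simp add: mult_left_mono)
  ultimately show ?case using assms by (simp add: algebra_simps)
qed (use assms in simp)

text \<open>Either \<open>y\<close> is small against \<open>x\<close>, and the increase is a small
  multiple of \<open>x ^ p\<close>, or \<open>x\<close> is below \<open>y / s\<close>, and
  everything is charged to \<open>y\<close>. It replaces the triangle inequality for powers where
  the coefficient of \<open>x ^ p\<close> has to stay close to 1.\<close>

lemma power_add_perturb:
  fixes x y s :: real
  assumes "0 \<le> x" "0 \<le> y" "0 < s" "s \<le> 1"
  shows "(x + y) ^ p - x ^ p \<le> 4 ^ p * s * x ^ p + (1 + 1 / s) ^ p * y ^ p"
proof (cases "y \<le> s * x")
  case True
  have "(x + y) ^ p \<le> ((1 + s) * x) ^ p" using assms True by (intro power_mono) (auto simp: algebra_simps)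
  also have "\<dots> = (1 + s) ^ p * x ^ p" by (simp add: power_mult_distrib)
  also have "\<dots> \<le> (1 + 4 ^ p * s) * x ^ p"
    using one_add_power_le assms by (intro mult_right_mono) auto
  finally have "(x + y) ^ p \<le> (1 + 4 ^ p * s) * x ^ p" .
  moreover have "0 \<le> (1 + 1 / s) ^ p * y ^ p" using assms by auto
  ultimately show ?thesis by (simp add: algebra_simps)
next
  case False
  then have "x \<le> y / s" using assms by (simp add: field_simps)
  then have "(x + y) ^ p \<le> ((1 + 1 / s) * y) ^ p"
    using assms by (intro power_mono) (auto simp: algebra_simps)
  then have "(x + y) ^ p \<le> (1 + 1 / s) ^ p * y ^ p" by (simp add: power_mult_distrib)
  moreover have "0 \<le> x ^ p" "0 \<le> 4 ^ p * s * x ^ p" using assms by auto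
  ultimately show ?thesis by linarith
qed

section \<open>Voronoi cells and their contraction\<close>

text \<open>For a metric \<open>d\<close>, the triangle inequality turns this into an equality:
  these are the arcs by which a shortest path towards \<open>u\<close> can continue.\<close>

definition tight :: "('a \<times> 'a) set \<Rightarrow> ('a \<Rightarrow> 'a \<Rightarrow> real) \<Rightarrow> 'a \<Rightarrow> ('a \<times> 'a) set" where
  "tight E d u = {(y, z) \<in> E. d y z + d z u \<le> d y u}"

text \<open>
  A truncated shortest-path metric: either \<open>u\<close> is as far from \<open>x\<close> as possible, or a path of edges
  realises the distance.
\<close>

locale graph_metric =
  fixes V :: "'a set" and E :: "('a \<times> 'a) set" and d :: "'a \<Rightarrow> 'a \<Rightarrow> real"
  assumes finV: "finite V" and EV: "E \<subseteq> V \<times> V" and symE: "sym E"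
    and d_nonneg: "\<And>x y. x \<in> V \<Longrightarrow> y \<in> V \<Longrightarrow> 0 \<le> d x y"
    and d_refl: "\<And>x. x \<in> V \<Longrightarrow> d x x = 0"
    and d_sym: "\<And>x y. x \<in> V \<Longrightarrow> y \<in> V \<Longrightarrow> d x y = d y x"
    and d_triangle: "\<And>x y z. x \<in> V \<Longrightarrow> y \<in> V \<Longrightarrow> z \<in> V \<Longrightarrow> d x z \<le> d x y + d y z"
    and geodesic: "\<And>x u. x \<in> V \<Longrightarrow> u \<in> V \<Longrightarrow>
       (\<forall>w\<in>V. d x w \<le> d x u) \<or> (x, u) \<in> (tight E d u)\<^sup>*"
begin

lemma tight_path_between:
  assumes "(x, y) \<in> (tight E d u)\<^sup>*" "x \<in> V" "u \<in> V"
  shows "y \<in> V \<and> d x y + d y u \<le> d x u"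
  using assms(1)
proof (induction rule: rtrancl_induct)
  case base
  then show ?case using assms d_refl by simp
next
  case (step y z)
  then have "(y, z) \<in> E" "d y z + d z u \<le> d y u" by (auto simp: tight_def)
  moreover have "z \<in> V" using \<open>(y, z) \<in> E\<close> EV by blast
  moreover have "d x z \<le> d x y + d y z" using d_triangle assms \<open>z \<in> V\<close> step by blast
  ultimately show ?case using step by linarith
qed

text \<open>
  Cells are grown along tight edges. Assigning every vertex to a nearest center would not do: with
  edges of weight 0 a center need not lie in its own cell, and cells need not be connected.
\<close>

definition voronoi :: "'a set \<Rightarrow> 'a set \<times> ('a \<Rightarrow> 'a) \<Rightarrow> bool" where
  "voronoi F Av \<longleftrightarrow> (case Av of (A, v) \<Rightarrow> F \<subseteq> A \<and> A \<subseteq> V \<and> v ` A \<subseteq> F \<and> (\<forall>f\<in>F. v f = f) \<and>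
     (\<forall>x\<in>A. \<forall>g\<in>F. d x (v x) \<le> d x g) \<and> (\<forall>f\<in>F. conn E {x\<in>A. v x = f}))"

text \<open>On the tight path from \<open>x\<close> to its nearest center \<open>f\<close>, some arc
  \<open>(y, z)\<close> enters \<open>A\<close>, and \<open>y\<close> joins the cell of
  \<open>z\<close>. As \<open>y\<close> is on a shortest path, \<open>f\<close> is nearest to
  \<open>y\<close> as well; and going through \<open>z\<close> to the center of \<open>z\<close> is
  no longer than going through \<open>z\<close> to \<open>f\<close>. The new arc keeps the cell
  connected.\<close>

lemma voronoi_extend:
  assumes vor: "voronoi F (A, v)" and F: "F \<subseteq> V" and x: "x \<in> V - A" and f: "f \<in> F"
    and near: "\<forall>g\<in>F. d x f \<le> d x g" and path: "(x, f) \<in> (tight E d f)\<^sup>*"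
  shows "\<exists>y v'. y \<in> V - A \<and> voronoi F (insert y A, v')"
proof -
  note A = vor[unfolded voronoi_def prod.case]
  have "\<exists>y z. (x, y) \<in> (tight E d f)\<^sup>* \<and> y \<notin> A \<and> z \<in> A \<and> (y, z) \<in> tight E d f"
  proof (rule ccontr)
    assume *: "\<not> ?thesis"
    have "(x, y) \<in> (tight E d f)\<^sup>* \<Longrightarrow> y \<notin> A" for y
      by (induction rule: rtrancl_induct) (use x * in blast)+
    then show False using path f A by blast
  qed
  then obtain y z where yz: "(x, y) \<in> (tight E d f)\<^sup>*" "y \<notin> A" "z \<in> A" "(y, z) \<in> tight E d f" by blast
  have fV: "f \<in> V" using f F by blast
  have y: "y \<in> V" "d x y + d y f \<le> d x f" using tight_path_between[OF yz(1)] x fV by auto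
  have zV: "z \<in> V" and vz: "v z \<in> F" "v z \<in> V" using A yz(3) F by auto
  have E: "(y, z) \<in> E" and tight: "d y z + d z f \<le> d y f" using yz(4) by (auto simp: tight_def)
  have yf: "d y f \<le> d y g" if "g \<in> F" for g
  proof -
    have "g \<in> V" using that F by blast
    then have "d x g \<le> d x y + d y g" using d_triangle x y by blast
    moreover have "d x f \<le> d x g" using near that by blast
    ultimately show ?thesis using y by linarith
  qed
  have dvz: "d y (v z) \<le> d y g" if "g \<in> F" for g
  proof -
    have "d y (v z) \<le> d y z + d z (v z)" using d_triangle y zV vz by blast
    moreover have "d z (v z) \<le> d z f" using A yz(3) f by blast
    ultimately show ?thesis using tight yf[OF that] by linarith
  qed
  let ?v = "v(y := v z)"
  have yF: "y \<notin> F" using yz A by blast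
  have cells: "conn E {x \<in> insert y A. ?v x = g}" if g: "g \<in> F" for g
  proof (cases "g = v z")
    case True
    have "{x \<in> insert y A. ?v x = g} = {x\<in>A. v x = g} \<union> {y}" using True yz(2) by auto
    moreover have "conn E ({x\<in>A. v x = g} \<union> {y})"
      by (rule conn_Un_edge[OF symE _ conn_singleton, of _ z y])
        (use A g True yz symD[OF symE E] in auto)
    ultimately show ?thesis by simp
  next
    case False
    then have "{x \<in> insert y A. ?v x = g} = {x\<in>A. v x = g}" using yz(2) by auto
    then show ?thesis using A g by simp
  qed
  have "?v ` insert y A \<subseteq> F" using A vz by auto
  moreover have "\<forall>g\<in>F. ?v g = g" using A yF by auto
  moreover have "\<forall>x\<in>insert y A. \<forall>g\<in>F. d x (?v x) \<le> d x g" using A dvz by simp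
  ultimately have "voronoi F (insert y A, ?v)"
    unfolding voronoi_def prod.case using A y(1) cells by (intro conjI ballI) auto
  then show ?thesis using y(1) yz(2) by blast
qed

text \<open>Suppose a largest cell structure misses \<open>x\<close>, which has a tight path to a
  center \<open>u\<close>. Its nearest center \<open>f\<close> has none, or the structure could
  grow, so \<open>f\<close> is at the greatest possible distance. Then all centers are equally near,
  \<open>u\<close> among them, and the structure can grow towards \<open>u\<close>.\<close>

lemma voronoi_maximal:
  assumes F: "F \<subseteq> V"
  obtains A v where "voronoi F (A, v)"
    "\<And>x f. x \<in> V \<Longrightarrow> f \<in> F \<Longrightarrow> (x, f) \<in> (tight E d f)\<^sup>* \<Longrightarrow> x \<in> A"
proof -
  have "d x x \<le> d x y" if "x \<in> F" "y \<in> F" for x y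
    using d_refl[of x] d_nonneg[of x y] that F by (simp add: subset_iff)
  moreover have "{x \<in> F. x = f} = {f}" if "f \<in> F" for f using that by auto
  ultimately have init: "voronoi F (F, \<lambda>x. x)"
    unfolding voronoi_def prod.case using F by (auto simp: conn_singleton)
  have "\<forall>Av. voronoi F Av \<longrightarrow> card (fst Av) < Suc (card V)"
    using card_mono[OF finV] by (auto simp: voronoi_def less_Suc_eq_le)
  from ex_has_greatest_nat[where P = "voronoi F" and f = "\<lambda>Av. card (fst Av)", OF init this]
  obtain A v where Av: "voronoi F (A, v)" and max: "\<And>A' v'. voronoi F (A', v') \<Longrightarrow> card A' \<le> card A"
    by auto
  have AV: "A \<subseteq> V" "F \<subseteq> A" using Av by (auto simp: voronoi_def)
  have finA: "finite A" using AV finV finite_subset by blast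
  have noext: "(x, f) \<notin> (tight E d f)\<^sup>*" if "x \<in> V - A" "f \<in> F" "\<forall>g\<in>F. d x f \<le> d x g" for x f
  proof
    assume "(x, f) \<in> (tight E d f)\<^sup>*"
    from voronoi_extend[OF Av F that this] obtain y v' where "y \<in> V - A" "voronoi F (insert y A, v')"
      by blast
    then show False using max[of "insert y A" v'] finA by simp
  qed
  have "x \<in> A" if x: "x \<in> V" "u \<in> F" "(x, u) \<in> (tight E d u)\<^sup>*" for x u
  proof (rule ccontr)
    assume xA: "x \<notin> A"
    have "finite (d x ` F)" "d x ` F \<noteq> {}" using F finV finite_subset x by blast+
    then have "Min (d x ` F) \<in> d x ` F" "\<forall>g\<in>F. Min (d x ` F) \<le> d x g" by auto
    then obtain f where f: "f \<in> F" "\<forall>g\<in>F. d x f \<le> d x g" by auto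
    have "f \<in> V" "u \<in> V" using f x F by auto
    have "(x, f) \<notin> (tight E d f)\<^sup>*" using noext[of x f] x xA f by blast
    then have "\<forall>w\<in>V. d x w \<le> d x f" using geodesic[OF x(1) \<open>f \<in> V\<close>] by blast
    then have "\<forall>g\<in>F. d x u \<le> d x g" using f(2) \<open>u \<in> V\<close> by force
    then show False using noext[of x u] x xA by blast
  qed
  then show ?thesis using that Av by blast
qed

text \<open>Cells are connected and disjoint, so replacing the centers in a branch set by their
  cells lifts a clique model from the contracted graph.\<close>

lemma clique_minor_of_contraction:
  assumes vor: "voronoi F (A, v)"
    and minor: "has_clique_minor {(v x, v y) | x y. x \<in> A \<and> y \<in> A \<and> (x, y) \<in> E} F h"
  shows "has_clique_minor E V h"
proof -
  define Q where "Q = {(v x, v y) | x y. x \<in> A \<and> y \<in> A \<and> (x, y) \<in> E}"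
  note A = vor[unfolded voronoi_def prod.case]
  define S where "S C = {x\<in>A. v x \<in> C}" for C
  obtain \<C> where C: "clique_model Q F \<C>" "card \<C> = h"
    using minor unfolding has_clique_minor_def Q_def by blast
  have CF: "C \<subseteq> F" "conn Q C" if "C \<in> \<C>" for C using C(1) that by (auto simp: clique_model_def)
  have FS: "F \<inter> S C = C" if "C \<in> \<C>" for C using CF[OF that] A by (auto simp: S_def)
  have inj: "inj_on S \<C>" using FS by (metis inj_onI)
  have cellS: "(E \<inter> {x\<in>A. v x = f} \<times> {x\<in>A. v x = f})\<^sup>* \<subseteq> (E \<inter> S C \<times> S C)\<^sup>*" if "f \<in> C" for f C
    by (rule rtrancl_restrict_mono) (use that in \<open>auto simp: S_def\<close>)
  have cell: "(x, y) \<in> (E \<inter> S C \<times> S C)\<^sup>*"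
    if "C \<in> \<C>" "f \<in> C" "x \<in> A" "v x = f" "y \<in> A" "v y = f" for x y f C
  proof -
    have "conn E {x\<in>A. v x = f}" using A CF(1)[OF that(1)] that(2) by blast
    then show ?thesis using cellS[OF that(2)] that unfolding conn_def by blast
  qed
  have connS: "conn E (S C)" if CC: "C \<in> \<C>" for C
  proof -
    obtain f0 where f0: "f0 \<in> C" using conn_nonempty[OF CF(2)[OF CC]] by blast
    have inA: "f \<in> A" "v f = f" if "f \<in> C" for f using that CF(1)[OF CC] A by auto
    have reach: "(f0, f) \<in> (E \<inter> S C \<times> S C)\<^sup>*" if "(f0, f) \<in> (Q \<inter> C \<times> C)\<^sup>*" for f
      using that
    proof (induction rule: rtrancl_induct)
      case (step f g)
      then have fg: "f \<in> C" "g \<in> C" "(f, g) \<in> Q" by auto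
      then obtain x y where xy: "x \<in> A" "y \<in> A" "v x = f" "v y = g" "(x, y) \<in> E" by (auto simp: Q_def)
      have "(f, x) \<in> (E \<inter> S C \<times> S C)\<^sup>*" "(y, g) \<in> (E \<inter> S C \<times> S C)\<^sup>*"
        using cell[OF CC] fg xy inA by auto
      moreover have "(x, y) \<in> E \<inter> S C \<times> S C" using xy fg by (auto simp: S_def)
      ultimately show ?case using step.IH by (meson rtrancl.rtrancl_into_rtrancl rtrancl_trans)
    qed simp
    show ?thesis
    proof (rule connI_root[OF symE])
      show "f0 \<in> S C" using f0 inA by (auto simp: S_def)
      fix x assume "x \<in> S C"
      then have x: "x \<in> A" "v x \<in> C" by (auto simp: S_def)
      have "(f0, v x) \<in> (Q \<inter> C \<times> C)\<^sup>*" using CF(2)[OF CC] f0 x by (auto simp: conn_def)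
      then show "(f0, x) \<in> (E \<inter> S C \<times> S C)\<^sup>*"
        using reach cell[OF CC x(2), of "v x" x] inA[OF x(2)] x by (meson rtrancl_trans)
    qed
  qed
  have "clique_model E V (S ` \<C>)"
    unfolding clique_model_def
  proof (intro conjI ballI impI)
    show "finite (S ` \<C>)" using C(1) by (simp add: clique_model_def)
    fix B assume "B \<in> S ` \<C>"
    then obtain C1 where C1: "C1 \<in> \<C>" "B = S C1" by blast
    then show "B \<subseteq> V" "conn E B" using A connS by (auto simp: S_def)
    fix B' assume "B' \<in> S ` \<C>" "B \<noteq> B'"
    then obtain C2 where C2: "C2 \<in> \<C>" "B' = S C2" "C1 \<noteq> C2" using C1 by blast
    have *: "C1 \<inter> C2 = {}" "\<exists>u\<in>C1. \<exists>v\<in>C2. (u, v) \<in> Q"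
      using C(1) C1(1) C2(1,3) unfolding clique_model_def by simp_all
    then show "B \<inter> B' = {}" using C1 C2 by (auto simp: S_def)
    show "\<exists>u\<in>B. \<exists>v\<in>B'. (u, v) \<in> E" using *(2) C1 C2 by (force simp: Q_def S_def)
  qed
  then show ?thesis
    unfolding has_clique_minor_def using C(2) card_image[OF inj] by blast
qed

text \<open>A vertex \<open>y\<close> on a shortest path from \<open>c\<close> to \<open>u\<close>
  has a cell center no farther from \<open>y\<close> than \<open>u\<close> is, hence no farther from
  \<open>c\<close> than \<open>u\<close>. Reading off the cell centers along the path gives a walk
  in the contracted graph through centers that all serve \<open>c\<close> at least as well as
  \<open>u\<close>.\<close>

lemma anchors:
  assumes F: "F \<subseteq> V" "F \<noteq> {}" and nominor: "\<not> has_clique_minor E V h"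
  obtains Q anchor where "sym Q" "\<not> has_clique_minor Q F h" "\<And>c. c \<in> V \<Longrightarrow> anchor c \<in> F"
    "\<And>c u. c \<in> V \<Longrightarrow> u \<in> F \<Longrightarrow> (\<forall>w\<in>F. d c w \<le> d c u) \<or>
       (anchor c, u) \<in> (Q \<inter> {w\<in>F. d c w \<le> d c u} \<times> {w\<in>F. d c w \<le> d c u})\<^sup>*"
proof -
  obtain A v where vor: "voronoi F (A, v)"
    and inA: "\<And>x f. x \<in> V \<Longrightarrow> f \<in> F \<Longrightarrow> (x, f) \<in> (tight E d f)\<^sup>* \<Longrightarrow> x \<in> A"
    using voronoi_maximal[OF F(1)] by blast
  note A = vor[unfolded voronoi_def prod.case]
  define Q where "Q = {(v x, v y) | x y. x \<in> A \<and> y \<in> A \<and> (x, y) \<in> E}"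
  obtain f0 where f0: "f0 \<in> F" using F by blast
  \<comment> \<open>A vertex outside all cells has no tight path to any center, so the first
    alternative holds for it and any default anchor will do.\<close>
  define anchor where "anchor c = (if c \<in> A then v c else f0)" for c
  show thesis
  proof (rule that[of Q anchor])
    show "sym Q" using symE by (auto simp: Q_def sym_def)
    show "\<not> has_clique_minor Q F h" using clique_minor_of_contraction[OF vor] nominor unfolding Q_def by blast
    show "anchor c \<in> F" if "c \<in> V" for c using A f0 by (auto simp: anchor_def)
    fix c u assume c: "c \<in> V" and u: "u \<in> F"
    have uV: "u \<in> V" using u F by blast
    let ?S = "{w\<in>F. d c w \<le> d c u}"
    show "(\<forall>w\<in>F. d c w \<le> d c u) \<or> (anchor c, u) \<in> (Q \<inter> ?S \<times> ?S)\<^sup>*"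
    proof (cases "(c, u) \<in> (tight E d u)\<^sup>*")
      case False
      then show ?thesis using geodesic[OF c uV] F by blast
    next
      case True
      have on: "y \<in> A \<and> v y \<in> ?S" if y: "(c, y) \<in> (tight E d u)\<^sup>*" "(y, u) \<in> (tight E d u)\<^sup>*" for y
      proof -
        have b: "y \<in> V" "d c y + d y u \<le> d c u" using tight_path_between[OF y(1) c uV] by auto
        then have yA: "y \<in> A" using inA u y(2) by blast
        then have vy: "v y \<in> F" "v y \<in> V" "d y (v y) \<le> d y u" using A u F by auto
        have "d c (v y) \<le> d c y + d y (v y)" using d_triangle c b(1) vy(2) by blast
        then show ?thesis using b vy yA by auto
      qed
      have walk: "(v c, v y) \<in> (Q \<inter> ?S \<times> ?S)\<^sup>*" if "(c, y) \<in> (tight E d u)\<^sup>*" "(y, u) \<in> (tight E d u)\<^sup>*" for y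
        using that
      proof (induction rule: rtrancl_induct)
        case (step y z)
        have yu: "(y, u) \<in> (tight E d u)\<^sup>*" using step by (meson converse_rtrancl_into_rtrancl)
        have cz: "(c, z) \<in> (tight E d u)\<^sup>*" using step by (meson rtrancl.rtrancl_into_rtrancl)
        have "(y, z) \<in> E" using step(2) by (simp add: tight_def)
        then have "(v y, v z) \<in> Q \<inter> ?S \<times> ?S"
          using on[OF step(1) yu] on[OF cz step(4)] by (auto simp: Q_def)
        then show ?case using step.IH[OF yu] by (meson rtrancl.rtrancl_into_rtrancl)
      qed simp
      have "v u = u" using A u by blast
      moreover have "c \<in> A" using inA[OF c u True] .
      ultimately show ?thesis using walk[OF True] by (simp add: anchor_def)
    qed
  qed
qed

end

section \<open>Balanced divisions and exchanges\<close>

text \<open>Bounds the growth of the solution in an exchange. It is signed, since regions that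
  shrink the solution must compensate for others.\<close>

definition surplus :: "'a set \<Rightarrow> 'a set \<Rightarrow> 'a set \<Rightarrow> 'a set \<Rightarrow> int" where
  "surplus L Op P B = int (card (Op \<inter> P)) + int (card B) - int (card (L \<inter> P))"

text \<open>
  Interiors \<open>P g\<close> and boundaries \<open>B g\<close> of the regions of a division, such that exchanging the
  elements of \<open>L\<close> in \<open>P g\<close> for those of \<open>Op\<close> in \<open>P g\<close> and for \<open>B g\<close> does not increase the size.
\<close>

definition balanced_family ::
  "('a \<times> 'a) set \<Rightarrow> 'a set \<Rightarrow> 'a set \<Rightarrow> 'a set \<Rightarrow> nat \<Rightarrow> 'g set \<Rightarrow> ('g \<Rightarrow> 'a set) \<Rightarrow> ('g \<Rightarrow> 'a set) \<Rightarrow> bool" where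
  "balanced_family Q F L Op T \<G> P B \<longleftrightarrow> finite \<G> \<and>
     (\<forall>g\<in>\<G>. \<forall>g'\<in>\<G>. g \<noteq> g' \<longrightarrow> P g \<inter> P g' = {} \<and> P g \<inter> B g' = {}) \<and>
     (\<Union>g\<in>\<G>. P g \<union> B g) = F \<and>
     (\<forall>g\<in>\<G>. \<forall>x\<in>P g. \<forall>y\<in>F. (x, y) \<in> Q \<longrightarrow> y \<in> P g \<union> B g) \<and>
     (\<forall>g\<in>\<G>. card (P g) + card (B g) \<le> T \<and> surplus L Op (P g) (B g) \<le> 0)"

lemma sum_card_eq_sum_mult:
  assumes "finite I" "finite U" "\<And>i. i \<in> I \<Longrightarrow> S i \<subseteq> U"
  shows "(\<Sum>i\<in>I. card (S i)) = (\<Sum>v\<in>U. card {i\<in>I. v \<in> S i})"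
proof -
  have "(\<Sum>i\<in>I. card (S i)) = (\<Sum>i\<in>I. \<Sum>v\<in>U. if v \<in> S i then 1 else 0)"
  proof (rule sum.cong)
    fix i assume "i \<in> I"
    then have "S i = {v\<in>U. v \<in> S i}" using assms(3) by blast
    then show "card (S i) = (\<Sum>v\<in>U. if v \<in> S i then 1 else 0)"
      using assms(2) by (simp add: sum.If_cases Int_def)
  qed simp
  also have "\<dots> = (\<Sum>v\<in>U. \<Sum>i\<in>I. if v \<in> S i then 1 else 0)" by (rule sum.swap)
  also have "\<dots> = (\<Sum>v\<in>U. card {i\<in>I. v \<in> S i})"
    using assms(1) by (simp add: sum.If_cases Int_def)
  finally show ?thesis .
qed

text \<open>Regions of a division are balanced only in total, so they are grouped: the surpluses are
  bounded by \<open>r\<close>, at most \<open>2 * r ^ 3 + 1\<close> regions cancel each other, and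
  \<open>R\<close> bounds the vertices of such a group. Merging small groups keeps their number low.
  The members of \<G> are sets of region indices.\<close>

lemma balanced_family_exists:
  fixes \<eta> :: real
  assumes Q: "sym Q" and nominor: "\<not> has_clique_minor Q F h" and F: "finite F" and h: "h > 0"
    and \<eta>: "0 < \<eta>" "\<eta> \<le> 1" and r: "16 * real (h * (2 * h + 1)) / \<eta> \<le> sqrt (real r)" "r > 0"
    and R: "R = (2 * r ^ 3 + 1) * r"
    and slack: "real (card (Op \<inter> F)) + 4 * \<eta> * card F \<le> real (card (L \<inter> F))"
  obtains \<G> :: "nat set set" and P B where "balanced_family Q F L Op (2 * R) \<G> P B"
    "card \<G> * R \<le> 2 * card F + R"
proof -
  obtain Rs where Rs: "covers Q F Rs" "\<And>R. R \<in> set Rs \<Longrightarrow> real (card R) \<le> real r"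
     "real (sum_list (map card Rs)) \<le> (1 + \<eta>) * card F"
    using division[OF Q nominor F h \<eta> r(1)] by blast
  define I where "I = {..<length Rs}"
  have finI: "finite I" by (simp add: I_def)
  define b where "b i = Rs ! i \<inter> (\<Union>j\<in>I - {i}. Rs ! j)" for i
  define q where "q i = Rs ! i - b i" for i
  have RsF: "Rs ! i \<subseteq> F" if "i \<in> I" for i
    using Rs(1) that by (force simp: covers_def I_def)
  have finR: "finite (Rs ! i)" if "i \<in> I" for i using RsF[OF that] F finite_subset by blast
  have fin: "finite (b i)" "finite (q i)" if "i \<in> I" for i
    using finR[OF that] by (auto simp: b_def q_def)
  have Rq: "Rs ! i = q i \<union> b i" "q i \<inter> b i = {}" for i by (auto simp: q_def b_def)
  have cR: "card (Rs ! i) = card (q i) + card (b i)" if "i \<in> I" for i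
    using Rq[of i] fin[OF that] by (metis card_Un_disjoint)
  have cr: "card (Rs ! i) \<le> r" if "i \<in> I" for i
    using Rs(2)[of "Rs ! i"] that by (simp add: I_def)
  have only: "x \<in> q i \<Longrightarrow> x \<in> Rs ! j \<Longrightarrow> i \<in> I \<Longrightarrow> j \<in> I \<Longrightarrow> i = j" for x i j
    by (auto simp: q_def b_def)
  have qq: "i \<noteq> j \<Longrightarrow> i \<in> I \<Longrightarrow> j \<in> I \<Longrightarrow> q i \<inter> q j = {}" for i j
    using only[of _ i j] Rq[of j] by blast
  have qb: "i \<in> I \<Longrightarrow> j \<in> I \<Longrightarrow> q i \<inter> b j = {}" for i j
    using only[of _ i j] Rq[of j] by blast
  have FU: "F = (\<Union>i\<in>I. Rs ! i)"
    using Rs(1) by (auto simp: covers_def I_def set_conv_nth)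
  define Bd where "Bd = (\<Union>i\<in>I. b i)"
  define Qd where "Qd = (\<Union>i\<in>I. q i)"
  have FQB: "F = Qd \<union> Bd" "Qd \<inter> Bd = {}"
    using FU Rq(1) qb unfolding Qd_def Bd_def by auto blast
  have finB: "finite Bd" "finite Qd" using fin finI by (auto simp: Bd_def Qd_def)
  have cF: "card F = card Qd + card Bd" using FQB finB by (simp add: card_Un_disjoint)
  have sumR: "sum_list (map card Rs) = (\<Sum>i\<in>I. card (Rs ! i))"
    by (simp add: sum_list_sum_nth I_def lessThan_atLeast0)
  have sumX: "(\<Sum>i\<in>I. card (X \<inter> q i)) = card (X \<inter> Qd)" for X
  proof -
    have "card (\<Union>i\<in>I. X \<inter> q i) = (\<Sum>i\<in>I. card (X \<inter> q i))"
      by (rule card_UN_disjoint) (use finI fin qq in blast)+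
    moreover have "(\<Union>i\<in>I. X \<inter> q i) = X \<inter> Qd" by (auto simp: Qd_def)
    ultimately show ?thesis by simp
  qed
  have sumq: "(\<Sum>i\<in>I. card (q i)) = card Qd" using sumX[of UNIV] by simp
  \<comment> \<open>A boundary vertex lies in at least two regions. So \<open>card Bd\<close> is at
    most the excess \<open>\<eta> * card F\<close> of the total size of the regions, and the
    multiplicities of boundary vertices sum to at most twice that.\<close>
  have double: "2 * card Bd \<le> (\<Sum>i\<in>I. card (b i))"
  proof -
    have "2 * card Bd = (\<Sum>v\<in>Bd. 2)" by simp
    also have "\<dots> \<le> (\<Sum>v\<in>Bd. card {i\<in>I. v \<in> b i})"
    proof (rule sum_mono)
      fix v assume "v \<in> Bd"
      then obtain i j where "i \<in> I" "j \<in> I" "i \<noteq> j" "v \<in> Rs ! i" "v \<in> Rs ! j"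
        by (auto simp: Bd_def b_def)
      then have "{i, j} \<subseteq> {i\<in>I. v \<in> b i}" "card {i, j} = 2" by (auto simp: b_def)
      moreover have "finite {i\<in>I. v \<in> b i}" using finI by simp
      ultimately show "2 \<le> card {i\<in>I. v \<in> b i}" by (metis card_mono)
    qed
    also have "\<dots> = (\<Sum>i\<in>I. card (b i))"
      by (rule sum_card_eq_sum_mult[symmetric]) (use finI finB in \<open>auto simp: Bd_def\<close>)
    finally show ?thesis .
  qed
  have sumRI: "(\<Sum>i\<in>I. card (Rs ! i)) = card Qd + (\<Sum>i\<in>I. card (b i))"
    using cR sumq by (simp add: sum.distrib)
  define a where "a i = surplus L Op (q i) (b i)" for i
  have "sum a I = int (card (Op \<inter> Qd)) + int (\<Sum>i\<in>I. card (b i)) - int (card (L \<inter> Qd))"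
    unfolding a_def surplus_def
    by (simp add: sum.distrib sum_subtractf sumX[symmetric])
  moreover have "card (L \<inter> F) \<le> card (L \<inter> Qd) + card Bd"
  proof -
    have "card (L \<inter> F) \<le> card ((L \<inter> Qd) \<union> Bd)" using FQB finB by (intro card_mono) auto
    also have "\<dots> \<le> card (L \<inter> Qd) + card Bd" by (rule card_Un_le)
    finally show ?thesis .
  qed
  moreover have "card (Op \<inter> Qd) \<le> card (Op \<inter> F)" using FQB F by (intro card_mono) auto
  moreover have "real (\<Sum>i\<in>I. card (b i)) \<le> 2 * \<eta> * card F"
  proof -
    have "real (card Qd) + real (\<Sum>i\<in>I. card (b i)) \<le> (1 + \<eta>) * card F"
      using Rs(3) sumR sumRI by simp
    then have "real (\<Sum>i\<in>I. card (b i)) \<le> \<eta> * card F + real (card Bd)"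
      by (simp add: cF algebra_simps)
    then show ?thesis using double by linarith
  qed
  \<comment> \<open>The slack pays \<open>2 * \<eta> * card F\<close> for the boundaries added and
    \<open>\<eta> * card F\<close> for elements of \<open>L\<close> on the boundary, which no region
    gives up.\<close>
  ultimately have suma: "sum a I \<le> 0"
    using slack double by linarith
  have abd: "\<bar>a i\<bar> \<le> int r" if "i \<in> I" for i
  proof -
    have "card (Op \<inter> q i) \<le> card (q i)" "card (L \<inter> q i) \<le> card (q i)"
      using fin[OF that] by (auto intro: card_mono)
    then show ?thesis using cr[OF that] cR[OF that] by (auto simp: a_def surplus_def)
  qed
  obtain \<P>0 where P0: "partition_on I \<P>0" "\<forall>J\<in>\<P>0. card J \<le> 2 * r ^ 3 + 1 \<and> sum a J \<le> 0"
    using nonpositive_groups[OF finI r(2) abd suma] by blast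
  have "sum (\<lambda>i. card (Rs ! i)) J \<le> R \<and> sum a J \<le> 0" if "J \<in> \<P>0" for J
  proof -
    have "J \<subseteq> I" using P0(1) that by (auto simp: partition_on_def)
    then have "sum (\<lambda>i. card (Rs ! i)) J \<le> card J * r"
      using sum_bounded_above[of J "\<lambda>i. card (Rs ! i)" r] cr by force
    also have "\<dots> \<le> R" unfolding R using P0(2) that by (intro mult_right_mono) auto
    finally show ?thesis using P0(2) that by blast
  qed
  from merge_groups[OF finI P0(1) this] obtain \<P> where P: "partition_on I \<P>"
    "\<forall>J\<in>\<P>. sum (\<lambda>i. card (Rs ! i)) J \<le> 2 * R \<and> sum a J \<le> 0"
    "card \<P> * R \<le> sum (\<lambda>i. card (Rs ! i)) I + R" by blast
  have JI: "J \<subseteq> I" if "J \<in> \<P>" for J using P(1) that by (auto simp: partition_on_def)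
  define PP where "PP J = (\<Union>i\<in>J. q i)" for J
  define BB where "BB J = (\<Union>i\<in>J. b i)" for J
  have finJ: "finite J" if "J \<in> \<P>" for J using JI[OF that] finI finite_subset by blast
  have cPP: "card (X \<inter> PP J) = (\<Sum>i\<in>J. card (X \<inter> q i))" if "J \<in> \<P>" for X J
  proof -
    have "card (\<Union>i\<in>J. X \<inter> q i) = (\<Sum>i\<in>J. card (X \<inter> q i))"
      by (rule card_UN_disjoint) (use finJ[OF that] JI[OF that] fin qq in blast)+
    moreover have "(\<Union>i\<in>J. X \<inter> q i) = X \<inter> PP J" by (auto simp: PP_def)
    ultimately show ?thesis by simp
  qed
  have cBB: "card (BB J) \<le> (\<Sum>i\<in>J. card (b i))" if "J \<in> \<P>" for J
    unfolding BB_def by (rule card_UN_le[OF finJ[OF that]])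
  have "balanced_family Q F L Op (2 * R) \<P> PP BB"
    unfolding balanced_family_def
  proof (intro conjI ballI impI)
    show "finite \<P>" using P(1) finI by (metis finite_elements)
    have "(\<Union>J\<in>\<P>. PP J \<union> BB J) = (\<Union>i\<in>\<Union>\<P>. Rs ! i)" using Rq by (auto simp: PP_def BB_def)
    also have "\<Union>\<P> = I" using P(1) by (simp add: partition_on_def)
    finally show "(\<Union>J\<in>\<P>. PP J \<union> BB J) = F" using FU by simp
  next
    fix J J' assume J: "J \<in> \<P>" "J' \<in> \<P>" "J \<noteq> J'"
    have dis: "J \<inter> J' = {}" using J P(1) by (auto simp: partition_on_def disjoint_def)
    have ne: "i \<noteq> j" "i \<in> I" "j \<in> I" if "i \<in> J" "j \<in> J'" for i j
      using that dis JI[OF J(1)] JI[OF J(2)] by auto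
    have ij: "q i \<inter> q j = {}" "q i \<inter> b j = {}" if "i \<in> J" "j \<in> J'" for i j
      using qq[OF ne[OF that]] qb[OF ne(2,3)[OF that]] by simp_all
    show "PP J \<inter> PP J' = {}" using ij(1) unfolding PP_def by blast
    show "PP J \<inter> BB J' = {}" using ij(2) unfolding PP_def BB_def by blast
  next
    fix J x y assume J: "J \<in> \<P>" and x: "x \<in> PP J" and y: "y \<in> F" "(x, y) \<in> Q"
    obtain i where i: "i \<in> J" "x \<in> q i" using x by (auto simp: PP_def)
    have iI: "i \<in> I" using i JI[OF J] by blast
    have "x \<in> F" using i iI FU Rq by blast
    then obtain S where "S \<in> set Rs" "x \<in> S" "y \<in> S" using Rs(1) y by (auto simp: covers_def)
    then obtain j where j: "j \<in> I" "x \<in> Rs ! j" "y \<in> Rs ! j" by (auto simp: I_def in_set_conv_nth)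
    then have "j = i" using only[OF i(2) j(2) iI j(1)] by simp
    then show "y \<in> PP J \<union> BB J" using j i Rq by (auto simp: PP_def BB_def)
  next
    fix J assume J: "J \<in> \<P>"
    have "card (PP J) + card (BB J) \<le> (\<Sum>i\<in>J. card (q i)) + (\<Sum>i\<in>J. card (b i))"
      using cPP[OF J, of UNIV] cBB[OF J] by simp
    also have "\<dots> = (\<Sum>i\<in>J. card (Rs ! i))"
      unfolding sum.distrib[symmetric] by (rule sum.cong) (use cR JI[OF J] in auto)
    finally show "card (PP J) + card (BB J) \<le> 2 * R" using P(2) J by force
    have "surplus L Op (PP J) (BB J) \<le> sum a J"
      unfolding surplus_def a_def cPP[OF J]
      using cBB[OF J] by (simp add: sum.distrib sum_subtractf flip: of_nat_sum)
    then show "surplus L Op (PP J) (BB J) \<le> 0" using P(2) J by force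
  qed
  moreover have "card \<P> * R \<le> 2 * card F + R"
  proof -
    have "real (\<Sum>i\<in>I. card (Rs ! i)) \<le> (1 + \<eta>) * card F" using Rs(3) sumR by simp
    also have "\<dots> \<le> 2 * real (card F)" using \<eta> by (intro mult_right_mono) auto
    finally have "(\<Sum>i\<in>I. card (Rs ! i)) \<le> 2 * card F" by linarith
    then show ?thesis using P(3) by linarith
  qed
  ultimately show ?thesis using that by blast
qed

section \<open>Distances to center sets, and exchanges along a family of regions\<close>

definition set_dist :: "('a \<Rightarrow> 'a \<Rightarrow> real) \<Rightarrow> 'a \<Rightarrow> 'a set \<Rightarrow> real" where
  "set_dist d c M = Min (d c ` M)"

definition real_cost :: "('a \<Rightarrow> 'a \<Rightarrow> real) \<Rightarrow> nat \<Rightarrow> 'a set \<Rightarrow> 'a set \<Rightarrow> real" where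
  "real_cost d p C M = (\<Sum>c\<in>C. set_dist d c M ^ p)"

lemma set_dist_le: "finite M \<Longrightarrow> m \<in> M \<Longrightarrow> set_dist d c M \<le> d c m"
  by (simp add: set_dist_def)

lemma set_dist_attained:
  assumes "finite M" "M \<noteq> {}"
  obtains m where "m \<in> M" "set_dist d c M = d c m" "\<And>u. u \<in> M \<Longrightarrow> d c m \<le> d c u"
proof -
  have "Min (d c ` M) \<in> d c ` M" using assms by (intro Min_in) auto
  then obtain m where "m \<in> M" "Min (d c ` M) = d c m" by blast
  then show ?thesis using that[of m] assms by (simp add: set_dist_def) (metis Min_le finite_imageI imageI)
qed

context graph_metric
begin

lemma set_dist_nonneg: "c \<in> V \<Longrightarrow> M \<subseteq> V \<Longrightarrow> M \<noteq> {} \<Longrightarrow> 0 \<le> set_dist d c M"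
  using set_dist_attained[of M d c] finite_subset[OF _ finV] d_nonneg by (metis subsetD)

lemma real_cost_nonneg: "C \<subseteq> V \<Longrightarrow> M \<subseteq> V \<Longrightarrow> M \<noteq> {} \<Longrightarrow> 0 \<le> real_cost d p C M"
  unfolding real_cost_def by (intro sum_nonneg zero_le_power set_dist_nonneg) auto

lemma real_cost_mono: "C \<subseteq> V \<Longrightarrow> M \<subseteq> M' \<Longrightarrow> M' \<subseteq> V \<Longrightarrow> M \<noteq> {} \<Longrightarrow> real_cost d p C M' \<le> real_cost d p C M"
  unfolding real_cost_def
proof (intro sum_mono power_mono)
  fix c assume a: "C \<subseteq> V" "M \<subseteq> M'" "M' \<subseteq> V" "M \<noteq> {}" "c \<in> C"
  have f: "finite M'" "finite M" using a finite_subset[OF _ finV] by (blast, metis a(2,3) order_trans)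
  obtain m where "m \<in> M" "set_dist d c M = d c m" using set_dist_attained[OF f(2) a(4), of d c] by blast
  then show "set_dist d c M' \<le> set_dist d c M" using set_dist_le[OF f(1)] a by auto
  show "0 \<le> set_dist d c M'" using a by (intro set_dist_nonneg) auto
qed

end

text \<open>Follow the walk of centers from the anchor to \<open>u\<close>. If it leaves
  \<open>P\<close>, its first step out lands in \<open>B\<close> or \<open>K\<close>, on a center
  that is present and no farther than \<open>u\<close>; otherwise \<open>u\<close> is in
  \<open>P\<close> and was itself added.\<close>

lemma exchange_new_center:
  fixes d :: "'a \<Rightarrow> 'a \<Rightarrow> real"
  assumes alt: "(\<forall>w\<in>F. d c w \<le> d c u) \<or>
       (x, u) \<in> (Q \<inter> {w\<in>F. d c w \<le> d c u} \<times> {w\<in>F. d c w \<le> d c u})\<^sup>*"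
    and u: "u \<in> Op" and x: "x \<in> P" and M: "Op \<inter> P \<subseteq> M" "B \<subseteq> M" "K \<subseteq> M" "M \<noteq> {}" "M \<subseteq> F"
    and out: "\<And>a b. a \<in> P \<Longrightarrow> b \<in> F \<Longrightarrow> (a, b) \<in> Q \<Longrightarrow> b \<in> P \<union> B \<union> K"
  shows "\<exists>m\<in>M. d c m \<le> d c u"
  using alt
proof
  assume "\<forall>w\<in>F. d c w \<le> d c u"
  then show ?thesis using M by blast
next
  assume path: "(x, u) \<in> (Q \<inter> {w\<in>F. d c w \<le> d c u} \<times> {w\<in>F. d c w \<le> d c u})\<^sup>*"
  show ?thesis
  proof (rule ccontr)
    assume *: "\<not> ?thesis"
    have "u \<in> P"
      by (rule rtrancl_closed[OF path x]) (use out * M in blast)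
    then have "u \<in> M" using u M by blast
    then show False using * by auto
  qed
qed

text \<open>The mirror image: a walk starting outside \<open>P\<close> can enter \<open>P\<close>
  only from a center in \<open>B\<close> or \<open>K\<close>; if it never enters, \<open>u\<close>
  was not removed.\<close>

lemma exchange_old_center:
  fixes d :: "'a \<Rightarrow> 'a \<Rightarrow> real"
  assumes alt: "(\<forall>w\<in>F. d c w \<le> d c u) \<or>
       (x, u) \<in> (Q \<inter> {w\<in>F. d c w \<le> d c u} \<times> {w\<in>F. d c w \<le> d c u})\<^sup>*"
    and Q: "sym Q" and u: "u \<in> L" and x: "x \<notin> P"
    and M: "L - P \<subseteq> M" "B \<subseteq> M" "K \<subseteq> M" "M \<noteq> {}" "M \<subseteq> F"
    and out: "\<And>a b. a \<in> P \<Longrightarrow> b \<in> F \<Longrightarrow> (a, b) \<in> Q \<Longrightarrow> b \<in> P \<union> B \<union> K"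
  shows "\<exists>m\<in>M. d c m \<le> d c u"
  using alt
proof
  assume "\<forall>w\<in>F. d c w \<le> d c u"
  then show ?thesis using M by blast
next
  assume path: "(x, u) \<in> (Q \<inter> {w\<in>F. d c w \<le> d c u} \<times> {w\<in>F. d c w \<le> d c u})\<^sup>*"
  show ?thesis
  proof (rule ccontr)
    assume *: "\<not> ?thesis"
    have "u \<in> - P"
    proof (rule rtrancl_closed[OF path])
      fix a b assume ab: "a \<in> - P" "(a, b) \<in> Q \<inter> {w\<in>F. d c w \<le> d c u} \<times> {w\<in>F. d c w \<le> d c u}"
      show "b \<in> - P"
      proof
        assume "b \<in> P"
        then have "a \<in> P \<union> B \<union> K" using out[of b a] ab symD[OF Q] by blast
        then show False using ab * M by blast
      qed
    qed (use x in simp)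
    then have "u \<in> M" using u M by blast
    then show False using * by auto
  qed
qed

lemma power_diff_nonpos:
  fixes x y :: real
  assumes "0 \<le> x" "x \<le> y"
  shows "x ^ p - y ^ p \<le> 0"
  using power_mono[OF assms(2,1), of p] by simp

text \<open>
  If \<open>Q\<close> is the contracted Voronoi graph of \<open>Lp \<union> Op\<close>, each client is served at its
  \<open>Op\<close>-distance in the exchange of the region of its anchor, and at its \<open>L\<close>-distance in all others.
\<close>

lemma (in graph_metric) exchange_family:
  assumes nominor: "\<not> has_clique_minor E V h"
    and C: "C \<subseteq> V" and L: "L \<subseteq> Lp" "Lp \<subseteq> V" "L \<noteq> {}" and Op: "Op \<subseteq> V" "Op \<noteq> {}"
    and K: "K \<subseteq> L" "K \<subseteq> Op"
    and fam: "\<And>Q. sym Q \<Longrightarrow> \<not> has_clique_minor Q (Lp \<union> Op - K) h \<Longrightarrow>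
       \<exists>(\<G>::'g set) P B. balanced_family Q (Lp \<union> Op - K) Lp Op T \<G> P B \<and> real (card \<G>) \<le> m"
    and opt: "\<And>M. M \<subseteq> V \<Longrightarrow> M \<noteq> {} \<Longrightarrow> card M \<le> card Lp \<Longrightarrow> card (L - M) + card (M - L) \<le> 2 * T
       \<Longrightarrow> (1 - e) * real_cost d p C L \<le> real_cost d p C M"
    and e: "e \<ge> 0"
  shows "(1 - m * e) * real_cost d p C L \<le> real_cost d p C Op"
proof -
  define F where "F = Lp \<union> Op"
  have F: "F \<subseteq> V" "F \<noteq> {}" using L Op by (auto simp: F_def)
  obtain Q anchor where Q: "sym Q" "\<not> has_clique_minor Q F h" and anc: "\<And>c. c \<in> V \<Longrightarrow> anchor c \<in> F"
    and walk: "\<And>c u. c \<in> V \<Longrightarrow> u \<in> F \<Longrightarrow> (\<forall>w\<in>F. d c w \<le> d c u) \<or>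
       (anchor c, u) \<in> (Q \<inter> {w\<in>F. d c w \<le> d c u} \<times> {w\<in>F. d c w \<le> d c u})\<^sup>*"
    using anchors[OF F nominor] by blast
  have near: "d c (anchor c) \<le> d c u" if "c \<in> V" "u \<in> F" for c u
    using walk[OF that]
  proof
    assume "(anchor c, u) \<in> (Q \<inter> {w\<in>F. d c w \<le> d c u} \<times> {w\<in>F. d c w \<le> d c u})\<^sup>*"
    then show ?thesis by (cases rule: converse_rtranclE) auto
  qed (use anc that in blast)
  have "\<not> has_clique_minor Q (Lp \<union> Op - K) h"
    using Q(2) has_clique_minor_mono[of Q "Lp \<union> Op - K" h F] by (auto simp: F_def)
  then obtain \<G> :: "'g set" and P B where bf: "balanced_family Q (Lp \<union> Op - K) Lp Op T \<G> P B" and m: "real (card \<G>) \<le> m"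
    using fam[OF Q(1)] by blast
  note bf' = bf[unfolded balanced_family_def]
  have finG: "finite \<G>" using bf' by blast
  have PBF: "P g \<subseteq> F - K" "B g \<subseteq> F - K" if "g \<in> \<G>" for g
  proof -
    have "(\<Union>g\<in>\<G>. P g \<union> B g) = F - K" using bf' by (simp add: F_def)
    then show "P g \<subseteq> F - K" "B g \<subseteq> F - K" using that by blast+
  qed
  have out: "b \<in> P g \<union> B g \<union> K" if "g \<in> \<G>" "a \<in> P g" "b \<in> F" "(a, b) \<in> Q" for g a b
  proof (cases "b \<in> K")
    case False
    have "\<forall>g\<in>\<G>. \<forall>x\<in>P g. \<forall>y\<in>F - K. (x, y) \<in> Q \<longrightarrow> y \<in> P g \<union> B g" using bf' by (simp add: F_def)
    then show ?thesis using that False by blast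
  qed blast
  obtain x0 where x0: "x0 \<in> L" using L by blast
  define M0 where "M0 g = (L - P g) \<union> (Op \<inter> P g) \<union> B g" for g
  \<comment> \<open>The exchange may remove everything; an arbitrary center is kept then, because
    distances to the empty set are meaningless here.\<close>
  define M where "M g = (if M0 g = {} then {x0} else M0 g)" for g
  have Msub: "M0 g \<subseteq> M g" "M g \<noteq> {}" for g by (auto simp: M_def)
  have MF: "M g \<subseteq> F" if "g \<in> \<G>" for g
    using PBF[OF that] x0 L by (auto simp: M_def M0_def F_def)
  have finF: "finite F" using F finV finite_subset by blast
  have finLp: "finite Lp" using finF by (simp add: F_def)
  have finL: "finite L" using L finLp finite_subset by blast
  have KM: "K \<subseteq> M g" if "g \<in> \<G>" for g
    using K PBF(1)[OF that] Msub(1)[of g] by (auto simp: M0_def)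
  have better: "(1 - e) * real_cost d p C L \<le> real_cost d p C (M g)" if g: "g \<in> \<G>" for g
  proof (rule opt)
    show "M g \<subseteq> V" "M g \<noteq> {}" using MF[OF g] F Msub by auto
    have sz: "card (P g) + card (B g) \<le> T" "surplus Lp Op (P g) (B g) \<le> 0" using bf' g by auto
    have fin: "finite (P g)" "finite (B g)" using PBF[OF g] finF finite_subset by (metis Diff_subset order_trans)+
    have "card (L - M g) \<le> card (P g)"
      using fin finL Msub(1)[of g] by (intro card_mono) (auto simp: M0_def)
    moreover have "card (M g - L) \<le> card (P g \<union> B g)"
      using fin x0 by (intro card_mono) (auto simp: M_def M0_def split: if_splits)
    moreover have "card (P g \<union> B g) \<le> card (P g) + card (B g)" by (rule card_Un_le)
    ultimately show "card (L - M g) + card (M g - L) \<le> 2 * T" using sz by linarith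
    show "card (M g) \<le> card Lp"
    proof (cases "M0 g = {}")
      case True
      have "card {x0} \<le> card Lp" using x0 L finLp by (intro card_mono) auto
      then show ?thesis using True by (simp add: M_def)
    next
      case False
      \<comment> \<open>The surplus is balanced against \<open>Lp\<close>, so \<open>L\<close> is
        enlarged to \<open>Lp\<close>; the size is then at most \<open>card Lp\<close> plus the
        surplus.\<close>
      have "M g \<subseteq> (Lp - P g) \<union> (Op \<inter> P g) \<union> B g" using False L by (auto simp: M_def M0_def)
      then have "card (M g) \<le> card ((Lp - P g) \<union> (Op \<inter> P g) \<union> B g)"
        using fin finLp by (intro card_mono) auto
      also have "\<dots> \<le> card (Lp - P g) + card (Op \<inter> P g) + card (B g)"
        by (meson add_le_mono card_Un_le le_refl order_trans)
      also have "card (Lp - P g) = card Lp - card (Lp \<inter> P g)"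
        using finLp by (simp add: card_Diff_subset_Int)
      finally show ?thesis using sz(2) card_mono[OF finLp, of "Lp \<inter> P g"] by (simp add: surplus_def)
    qed
  qed
  have client: "(\<Sum>g\<in>\<G>. set_dist d c (M g) ^ p - set_dist d c L ^ p) \<le> set_dist d c Op ^ p - set_dist d c L ^ p"
    if c: "c \<in> C" for c
  proof -
    have cV: "c \<in> V" using c C by blast
    have finM: "finite (M g)" if "g \<in> \<G>" for g using MF[OF that] finF finite_subset by blast
    have finO: "finite Op" using finF by (simp add: F_def)
    obtain l where l: "l \<in> L" "set_dist d c L = d c l" using set_dist_attained[OF finL L(3), of d c] by blast
    obtain oo where oo: "oo \<in> Op" "set_dist d c Op = d c oo" using set_dist_attained[OF finO Op(2), of d c] by blast
    have lF: "l \<in> F" "oo \<in> F" using l oo L by (auto simp: F_def)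
    have Mnn: "0 \<le> set_dist d c (M g)" if "g \<in> \<G>" for g
      using MF[OF that] F Msub(2) by (intro set_dist_nonneg[OF cV]) auto
    have old: "set_dist d c (M g) \<le> set_dist d c L" if g: "g \<in> \<G>" and a: "anchor c \<notin> P g" for g
    proof -
      have "\<exists>m\<in>M g. d c m \<le> d c l"
        by (rule exchange_old_center[where d = d and c = c and u = l, OF walk[OF cV lF(1)] Q(1) l(1) a, where B = "B g" and K = K])
          (use Msub[of g] KM[OF g] MF[OF g] out[OF g] in \<open>auto simp: M0_def\<close>)
      then show ?thesis using set_dist_le[OF finM[OF g], of _ d c] l by force
    qed
    have old0: "set_dist d c (M g) ^ p - set_dist d c L ^ p \<le> 0" if "g \<in> \<G>" "anchor c \<notin> P g" for g
      using old[OF that] Mnn[OF that(1)] by (intro power_diff_nonpos)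
    show ?thesis
    proof (cases "anchor c \<in> K")
      case True
      then have "anchor c \<notin> P g" if "g \<in> \<G>" for g using PBF[OF that] by blast
      then have "(\<Sum>g\<in>\<G>. set_dist d c (M g) ^ p - set_dist d c L ^ p) \<le> 0"
        using old0 by (intro sum_nonpos) auto
      \<comment> \<open>An anchor in \<open>K\<close> is a nearest element of \<open>F\<close> and
        belongs to \<open>L\<close>, so such a client pays no more under \<open>L\<close> than under
        \<open>Op\<close>, and no exchange needs to help it.\<close>
      moreover have "set_dist d c L \<le> set_dist d c Op"
        using set_dist_le[OF finL, of "anchor c" d c] True K near[OF cV lF(2)] oo by force
      moreover have "0 \<le> set_dist d c L" using L by (intro set_dist_nonneg[OF cV]) auto
      ultimately show ?thesis using power_mono[of "set_dist d c L" "set_dist d c Op" p] by linarith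
    next
      case False
      then have "anchor c \<in> F - K" using anc[OF cV] by blast
      moreover have "(\<Union>g\<in>\<G>. P g \<union> B g) = F - K" using bf' by (simp add: F_def)
      ultimately obtain g0 where g0: "g0 \<in> \<G>" "anchor c \<in> P g0 \<union> B g0" by blast
      have new: "set_dist d c (M g0) \<le> set_dist d c Op"
      proof (cases "anchor c \<in> P g0")
        case True
        have "\<exists>m\<in>M g0. d c m \<le> d c oo"
          by (rule exchange_new_center[where d = d and c = c and u = oo, OF walk[OF cV lF(2)] oo(1) True, where B = "B g0" and K = K])
            (use Msub[of g0] KM[OF g0(1)] MF[OF g0(1)] out[OF g0(1)] in \<open>auto simp: M0_def\<close>)
        then show ?thesis using set_dist_le[OF finM[OF g0(1)], of _ d c] oo by force
      next
        case False
        then have "anchor c \<in> M g0" using g0 Msub(1)[of g0] by (auto simp: M0_def)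
        then show ?thesis using set_dist_le[OF finM[OF g0(1)], of "anchor c" d c] near[OF cV lF(2)] oo by force
      qed
      have "anchor c \<notin> P g" if "g \<in> \<G> - {g0}" for g
      proof -
        have "P g \<inter> P g0 = {}" "P g \<inter> B g0 = {}" using bf' that g0(1) by auto
        then show ?thesis using g0(2) by blast
      qed
      then have "(\<Sum>g\<in>\<G> - {g0}. set_dist d c (M g) ^ p - set_dist d c L ^ p) \<le> 0"
        using old0 by (intro sum_nonpos) auto
      moreover have "set_dist d c (M g0) ^ p \<le> set_dist d c Op ^ p"
        using new Mnn[OF g0(1)] by (rule power_mono)
      ultimately show ?thesis using finG g0(1) by (simp add: sum.remove)
    qed
  qed
  have "real (card \<G>) * (- e * real_cost d p C L) \<le> (\<Sum>g\<in>\<G>. real_cost d p C (M g) - real_cost d p C L)"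
  proof (rule sum_bounded_below)
    show "- e * real_cost d p C L \<le> real_cost d p C (M g) - real_cost d p C L" if "g \<in> \<G>" for g
      using better[OF that] by (simp add: algebra_simps)
  qed
  also have "\<dots> = (\<Sum>c\<in>C. \<Sum>g\<in>\<G>. set_dist d c (M g) ^ p - set_dist d c L ^ p)"
    unfolding real_cost_def sum_subtractf[symmetric] by (rule sum.swap)
  also have "\<dots> \<le> (\<Sum>c\<in>C. set_dist d c Op ^ p - set_dist d c L ^ p)"
    by (rule sum_mono) (rule client)
  also have "\<dots> = real_cost d p C Op - real_cost d p C L" by (simp add: real_cost_def sum_subtractf)
  finally have *: "real_cost d p C L - real (card \<G>) * (e * real_cost d p C L) \<le> real_cost d p C Op" by (simp add: algebra_simps)
  have "0 \<le> real_cost d p C L" using L by (intro real_cost_nonneg[OF C]) auto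
  then have "real (card \<G>) * (e * real_cost d p C L) \<le> m * (e * real_cost d p C L)"
    using m e by (intro mult_right_mono) auto
  then show ?thesis using * by (simp add: algebra_simps)
qed

section \<open>Comparing two solutions\<close>

lemma sum_fibres:
  fixes F :: "'b \<Rightarrow> real"
  assumes "finite X" "finite S" "g ` X \<subseteq> S"
  shows "(\<Sum>c\<in>X. F (g c)) = (\<Sum>f\<in>S. real (card {c\<in>X. g c = f}) * F f)"
proof -
  have "(\<Sum>c\<in>X. F (g c)) = (\<Sum>f\<in>S. \<Sum>c\<in>{c\<in>X. g c = f}. F (g c))"
    by (rule sum.group[symmetric]) (use assms in auto)
  also have "\<dots> = (\<Sum>f\<in>S. \<Sum>c\<in>{c\<in>X. g c = f}. F f)" by (intro sum.cong) auto
  finally show ?thesis by simp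
qed

lemma majority_unique:
  fixes \<delta> :: real
  assumes "finite Z" "X \<subseteq> Z" "Y \<subseteq> Z" "X \<inter> Y = {}" "X \<noteq> {}" "\<delta> < 1/2"
    "(1 - \<delta>) * card Z \<le> card X" "(1 - \<delta>) * card Z \<le> card Y"
  shows False
proof -
  have fin: "finite X" "finite Y" by (rule finite_subset[OF _ assms(1)], fact assms)+
  have "card X + card Y = card (X \<union> Y)" using fin assms(4) by (simp add: card_Un_disjoint)
  also have "\<dots> \<le> card Z" using assms by (intro card_mono) auto
  finally have "real (card X) + real (card Y) \<le> real (card Z)" by linarith
  moreover have "card Z > 0" using assms by (auto simp: card_gt_0_iff)
  then have "1/2 * real (card Z) < (1 - \<delta>) * card Z" using assms(6) by (intro mult_strict_right_mono) auto
  ultimately show False using assms(7,8) by linarith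
qed

locale two_solutions = graph_metric V E d for V :: "'a set" and E d +
  fixes C L Op :: "'a set" and p :: nat and ctrL ctrO :: "'a \<Rightarrow> 'a" and \<delta> :: real
  assumes CV: "C \<subseteq> V" and LV: "L \<subseteq> V" and OV: "Op \<subseteq> V" and p0: "p > 0"
    and ctrL: "\<And>c. c \<in> C \<Longrightarrow> ctrL c \<in> L" and ctrO: "\<And>c. c \<in> C \<Longrightarrow> ctrO c \<in> Op"
    and \<delta>0: "0 < \<delta>" and \<delta>2: "\<delta> < 1/2"
begin

definition "cl c = d c (ctrL c)"
definition "co c = d c (ctrO c)"
definition "costs = (\<Sum>c\<in>C. cl c ^ p + co c ^ p)"
definition "VL l = {c\<in>C. ctrL c = l}"
definition "VO f = {c\<in>C. ctrO c = f}"

text \<open>Each cluster lies in the other up to a \<delta> share. As \<delta> is below 1/2,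
  majorities overlap and partners are unique, which justifies \<open>mate\<close> and
  \<open>mateL\<close>.\<close>

definition "isolated l f \<longleftrightarrow> VL l \<inter> VO f \<noteq> {} \<and> (1 - \<delta>) * card (VL l) \<le> card (VL l \<inter> VO f) \<and>
   (1 - \<delta>) * card (VO f) \<le> card (VL l \<inter> VO f)"
definition "isoO = {f. \<exists>l. isolated l f}"
definition "isoL = {l. \<exists>f. isolated l f}"
definition "mate f = (THE l. isolated l f)"
definition "mateL l = (THE f. isolated l f)"
definition "gap f = d f (mate f)"
definition "core f = VL (mate f) \<inter> VO f"

lemma finC: "finite C" and finL: "finite L" and finO: "finite Op"
  using finite_subset[OF CV finV] finite_subset[OF LV finV] finite_subset[OF OV finV] by simp_all

lemma finVL: "finite (VL l)" and finVO: "finite (VO f)"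
  using finC by (auto simp: VL_def VO_def)

lemma centers_V: "c \<in> C \<Longrightarrow> c \<in> V" "c \<in> C \<Longrightarrow> ctrL c \<in> V" "c \<in> C \<Longrightarrow> ctrO c \<in> V"
  using CV LV OV ctrL ctrO by auto

lemma cl_nonneg: "c \<in> C \<Longrightarrow> 0 \<le> cl c" and co_nonneg: "c \<in> C \<Longrightarrow> 0 \<le> co c"
  using centers_V by (auto simp: cl_def co_def d_nonneg)

lemma iso_unique_l:
  assumes "isolated l f" "isolated l' f"
  shows "l = l'"
proof (rule ccontr)
  assume "l \<noteq> l'"
  then have "(VL l \<inter> VO f) \<inter> (VL l' \<inter> VO f) = {}" by (auto simp: VL_def)
  then show False
    using majority_unique[OF finVO _ _ _ _ \<delta>2, of "VL l \<inter> VO f" f "VL l' \<inter> VO f"] assms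
    by (auto simp: isolated_def)
qed

lemma iso_unique_f:
  assumes "isolated l f" "isolated l f'"
  shows "f = f'"
proof (rule ccontr)
  assume "f \<noteq> f'"
  then have "(VL l \<inter> VO f) \<inter> (VL l \<inter> VO f') = {}" by (auto simp: VO_def)
  then show False
    using majority_unique[OF finVL _ _ _ _ \<delta>2, of "VL l \<inter> VO f" l "VL l \<inter> VO f'"] assms
    by (auto simp: isolated_def)
qed

lemma mate_eq: "isolated l f \<Longrightarrow> mate f = l" and mateL_eq: "isolated l f \<Longrightarrow> mateL l = f"
  unfolding mate_def mateL_def using iso_unique_l iso_unique_f by blast+

lemma iso_mate: "f \<in> isoO \<Longrightarrow> isolated (mate f) f"
  using mate_eq by (auto simp: isoO_def)

lemma iso_mateL: "l \<in> isoL \<Longrightarrow> isolated l (mateL l)"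
  using mateL_eq by (auto simp: isoL_def)

lemma iso_in: "isolated l f \<Longrightarrow> l \<in> L" "isolated l f \<Longrightarrow> f \<in> Op"
  using ctrL ctrO by (auto simp: isolated_def VL_def VO_def)

lemma isoO_sub: "isoO \<subseteq> Op" and isoL_sub: "isoL \<subseteq> L"
  using iso_in by (auto simp: isoO_def isoL_def)

lemma finiso: "finite isoO" "finite isoL"
  using isoO_sub isoL_sub finO finL finite_subset by auto

lemma bij_mate: "bij_betw mate isoO isoL"
  by (rule bij_betw_byWitness[of _ mateL])
    (use iso_mate iso_mateL mate_eq mateL_eq in \<open>auto simp: isoO_def isoL_def\<close>)

lemma card_iso: "card isoL = card isoO"
  using bij_betw_same_card[OF bij_mate] by simp

lemma mate_V: "f \<in> isoO \<Longrightarrow> mate f \<in> V" "f \<in> isoO \<Longrightarrow> f \<in> V" "f \<in> isoO \<Longrightarrow> mate f \<in> isoL"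
proof -
  assume f: "f \<in> isoO"
  show "mate f \<in> V" "f \<in> V" using iso_in[OF iso_mate[OF f]] LV OV by blast+
  show "mate f \<in> isoL" using iso_mate[OF f] by (auto simp: isoL_def)
qed

lemma gap_nonneg: "f \<in> isoO \<Longrightarrow> 0 \<le> gap f"
  using mate_V d_nonneg by (simp add: gap_def)

lemma gap_le:
  assumes "f \<in> isoO" "c \<in> core f"
  shows "gap f \<le> cl c + co c"
proof -
  have c: "c \<in> C" "ctrL c = mate f" "ctrO c = f" using assms by (auto simp: core_def VL_def VO_def)
  have "gap f \<le> d f c + d c (mate f)"
    unfolding gap_def using d_triangle mate_V[OF assms(1)] centers_V(1)[OF c(1)] by blast
  moreover have "d f c = d c f" using d_sym mate_V[OF assms(1)] centers_V(1)[OF c(1)] by blast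
  ultimately show ?thesis using c by (simp add: cl_def co_def)
qed

lemma costs_nonneg: "0 \<le> costs"
  unfolding costs_def by (intro sum_nonneg add_nonneg_nonneg zero_le_power cl_nonneg co_nonneg)

text \<open>Every client in the core witnesses that the gap is at most \<open>cl c + co c\<close>,
  and cores are disjoint, so each client is charged once.\<close>

lemma sum_core_gap: "(\<Sum>f\<in>isoO. real (card (core f)) * gap f ^ p) \<le> 2 ^ p * costs"
proof -
  have "(\<Sum>f\<in>isoO. real (card (core f)) * gap f ^ p) \<le> (\<Sum>f\<in>isoO. \<Sum>c\<in>core f. 2 ^ p * (cl c ^ p + co c ^ p))"
  proof (rule sum_mono)
    fix f assume f: "f \<in> isoO"
    show "real (card (core f)) * gap f ^ p \<le> (\<Sum>c\<in>core f. 2 ^ p * (cl c ^ p + co c ^ p))"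
    proof (rule sum_bounded_below)
      fix c assume c: "c \<in> core f"
      then have "c \<in> C" by (simp add: core_def VL_def)
      have "gap f ^ p \<le> (cl c + co c) ^ p" by (intro power_mono gap_le gap_nonneg f c)
      also have "\<dots> \<le> 2 ^ p * (cl c ^ p + co c ^ p)"
        by (intro power_add_le cl_nonneg co_nonneg \<open>c \<in> C\<close>)
      finally show "gap f ^ p \<le> 2 ^ p * (cl c ^ p + co c ^ p)" .
    qed
  qed
  also have "\<dots> = (\<Sum>c\<in>(\<Union>f\<in>isoO. core f). 2 ^ p * (cl c ^ p + co c ^ p))"
    by (rule sum.UNION_disjoint[symmetric]) (use finiso finVL in \<open>auto simp: core_def VO_def\<close>)
  also have "\<dots> \<le> (\<Sum>c\<in>C. 2 ^ p * (cl c ^ p + co c ^ p))"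
    by (rule sum_mono2) (use finC cl_nonneg co_nonneg in \<open>auto simp: core_def VO_def\<close>)
  also have "\<dots> = 2 ^ p * costs" by (simp add: costs_def sum_distrib_left)
  finally show ?thesis .
qed

text \<open>The core holds at least half of either cluster, so the \<delta> share outside it is at
  most a \<open>2 * \<delta>\<close> multiple of the core.\<close>

lemma card_core:
  assumes "f \<in> isoO"
  shows "real (card (VO f)) \<le> 2 * card (core f)" "real (card (VO f - core f)) \<le> 2 * \<delta> * card (core f)"
    "real (card (VL (mate f) - core f)) \<le> 2 * \<delta> * card (core f)"
proof -
  have i: "(1 - \<delta>) * card (VL (mate f)) \<le> card (core f)" "(1 - \<delta>) * card (VO f) \<le> card (core f)"
    using iso_mate[OF assms] by (auto simp: isolated_def core_def)
  have half: "n / 2 \<le> (1 - \<delta>) * n" if "n \<ge> 0" for n :: real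
    using mult_right_mono[of "1/2" "1 - \<delta>" n] that \<delta>2 by simp
  have a: "real (card (VO f)) \<le> 2 * card (core f)" using i(2) half[of "card (VO f)"] by simp
  have b: "real (card (VL (mate f))) \<le> 2 * card (core f)" using i(1) half[of "card (VL (mate f))"] by simp
  have m: "real (card (S - core f)) = real (card S) - card (core f)" if "core f \<subseteq> S" "finite S" for S
    using that finite_subset by (subst card_Diff_subset) (auto simp: of_nat_diff card_mono)
  have "real (card (VO f - core f)) \<le> \<delta> * card (VO f)"
    using i(2) m[of "VO f"] finVO by (simp add: core_def algebra_simps)
  also have "\<dots> \<le> \<delta> * (2 * card (core f))" using a \<delta>0 by (intro mult_left_mono) auto
  finally show "real (card (VO f - core f)) \<le> 2 * \<delta> * card (core f)" by simp
  have "real (card (VL (mate f) - core f)) \<le> \<delta> * card (VL (mate f))"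
    using i(1) m[of "VL (mate f)"] finVL by (simp add: core_def algebra_simps)
  also have "\<dots> \<le> \<delta> * (2 * card (core f))" using b \<delta>0 by (intro mult_left_mono) auto
  finally show "real (card (VL (mate f) - core f)) \<le> 2 * \<delta> * card (core f)" by simp
  show "real (card (VO f)) \<le> 2 * card (core f)" by (rule a)
qed

text \<open>Price of sending clients across gaps when each gap is used by at most \<open>q\<close>
  times as many clients as its core has. The stray clients below get by with
  \<open>q = 2 * \<delta>\<close>.\<close>

lemma sum_gap_fibres:
  fixes q :: real
  assumes "X \<subseteq> C" "g ` X \<subseteq> isoO" "q \<ge> 0"
    "\<And>f. f \<in> isoO \<Longrightarrow> real (card {c\<in>X. g c = f}) \<le> q * card (core f)"
  shows "(\<Sum>c\<in>X. gap (g c) ^ p) \<le> q * 2 ^ p * costs"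
proof -
  have "(\<Sum>c\<in>X. gap (g c) ^ p) = (\<Sum>f\<in>isoO. real (card {c\<in>X. g c = f}) * gap f ^ p)"
    by (rule sum_fibres[OF finite_subset[OF assms(1) finC] finiso(1) assms(2)])
  also have "\<dots> \<le> (\<Sum>f\<in>isoO. (q * card (core f)) * gap f ^ p)"
    by (intro sum_mono mult_right_mono assms zero_le_power gap_nonneg)
  also have "\<dots> = q * (\<Sum>f\<in>isoO. real (card (core f)) * gap f ^ p)"
    by (simp add: sum_distrib_left mult.assoc)
  also have "\<dots> \<le> q * (2 ^ p * costs)" by (intro mult_left_mono sum_core_gap assms)
  finally show ?thesis by simp
qed

text \<open>Clients of isolated clusters outside the cores, seen from \<open>Op\<close> and from
  \<open>L\<close>; the core clients are handled without any error.\<close>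

definition "strayO = {c\<in>C. ctrO c \<in> isoO \<and> ctrL c \<noteq> mate (ctrO c)}"
definition "strayL = {c\<in>C. ctrL c \<in> isoL \<and> ctrO c \<noteq> mateL (ctrL c)}"

lemma sum_gap_all: "(\<Sum>c\<in>{c\<in>C. ctrO c \<in> isoO}. gap (ctrO c) ^ p) \<le> 2 * 2 ^ p * costs"
proof (rule sum_gap_fibres)
  fix f assume f: "f \<in> isoO"
  then have "{c \<in> {c\<in>C. ctrO c \<in> isoO}. ctrO c = f} = VO f" by (auto simp: VO_def)
  then show "real (card {c \<in> {c\<in>C. ctrO c \<in> isoO}. ctrO c = f}) \<le> 2 * real (card (core f))"
    using card_core(1)[OF f] by simp
qed auto

lemma sum_gap_strayO: "(\<Sum>c\<in>strayO. gap (ctrO c) ^ p) \<le> 2 * \<delta> * 2 ^ p * costs"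
proof (rule sum_gap_fibres)
  fix f assume f: "f \<in> isoO"
  then have "{c \<in> strayO. ctrO c = f} = VO f - core f" by (auto simp: strayO_def VO_def VL_def core_def)
  then show "real (card {c \<in> strayO. ctrO c = f}) \<le> 2 * \<delta> * real (card (core f))"
    using card_core(2)[OF f] by simp
qed (use \<delta>0 in \<open>auto simp: strayO_def\<close>)

lemma sum_gap_strayL: "(\<Sum>c\<in>strayL. gap (mateL (ctrL c)) ^ p) \<le> 2 * \<delta> * 2 ^ p * costs"
proof (rule sum_gap_fibres)
  show "(\<lambda>c. mateL (ctrL c)) ` strayL \<subseteq> isoO" using iso_mateL by (auto simp: strayL_def isoO_def)
  fix f assume f: "f \<in> isoO"
  have "mateL l = f \<Longrightarrow> l \<in> isoL \<Longrightarrow> l = mate f" for l using mate_eq[OF iso_mateL, of l] by auto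
  then have "{c \<in> strayL. mateL (ctrL c) = f} \<subseteq> VL (mate f) - core f"
    by (auto simp: strayL_def VO_def VL_def core_def)
  then have "card {c \<in> strayL. mateL (ctrL c) = f} \<le> card (VL (mate f) - core f)"
    using finVL by (intro card_mono) auto
  then show "real (card {c \<in> strayL. mateL (ctrL c) = f}) \<le> 2 * \<delta> * real (card (core f))"
    using card_core(3)[OF f] by linarith
qed (use \<delta>0 in \<open>auto simp: strayL_def\<close>)

text \<open>
  The clusters of the centers in \<open>removable\<close> overlap clusters of \<open>L\<close> that they do not dominate, so
  their clients can be rerouted cheaply.
\<close>

definition "dominated f = {l\<in>L. VL l \<noteq> {} \<and> (1 - \<delta>) * card (VL l) \<le> card (VL l \<inter> VO f)}"
definition "removable = {f \<in> Op - isoO. card (dominated f) \<le> 1}"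

lemma dominated_disjoint: "f \<noteq> f' \<Longrightarrow> dominated f \<inter> dominated f' = {}"
proof (rule ccontr)
  assume "f \<noteq> f'" "dominated f \<inter> dominated f' \<noteq> {}"
  then obtain l where l: "VL l \<noteq> {}" "(1 - \<delta>) * card (VL l) \<le> card (VL l \<inter> VO f)"
    "(1 - \<delta>) * card (VL l) \<le> card (VL l \<inter> VO f')" by (auto simp: dominated_def)
  have "0 < (1 - \<delta>) * card (VL l)"
    using l(1) finVL \<delta>2 by (intro mult_pos_pos) (auto simp: card_gt_0_iff)
  then have "VL l \<inter> VO f \<noteq> {}" using l(2) by (metis card.empty not_le of_nat_0)
  moreover have "(VL l \<inter> VO f) \<inter> (VL l \<inter> VO f') = {}" using \<open>f \<noteq> f'\<close> by (auto simp: VO_def)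
  ultimately show False
    using majority_unique[OF finVL, of "VL l \<inter> VO f" l "VL l \<inter> VO f'" \<delta>] \<delta>2 l(2,3) by blast
qed

text \<open>The sets of dominated clusters are disjoint; an isolated center has at least one, and
  any other non-removable center at least two. Counting against \<open>card L \<le> card Op\<close>
  leaves at most as many non-removable as removable centers outside \<open>isoO\<close>.\<close>

lemma card_removable:
  assumes "card L \<le> card Op"
  shows "card (Op - isoO) \<le> 2 * card removable"
proof -
  have finLam: "finite (dominated f)" for f using finL by (auto simp: dominated_def)
  define N where "N = Op - isoO - removable"
  have "removable \<subseteq> Op - isoO" by (auto simp: removable_def)
  then have cN: "card (Op - isoO) = card N + card removable"
    unfolding N_def using finO
    by (metis card_Diff_subset card_mono finite_Diff finite_subset le_add_diff_inverse2)
  have cO: "card Op = card isoO + card (Op - isoO)"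
    using isoO_sub finO finiso by (metis card_Diff_subset card_mono le_add_diff_inverse)
  have "card isoO + 2 * card N \<le> (\<Sum>f\<in>isoO. card (dominated f)) + (\<Sum>f\<in>N. card (dominated f))"
  proof (rule add_mono)
    have "1 \<le> card (dominated f)" if "f \<in> isoO" for f
    proof -
      have "mate f \<in> dominated f" using iso_mate[OF that] iso_in by (auto simp: dominated_def isolated_def)
      then show ?thesis using finLam by (metis Suc_leI card_gt_0_iff empty_iff One_nat_def)
    qed
    then show "card isoO \<le> (\<Sum>f\<in>isoO. card (dominated f))"
      using sum_bounded_below[of isoO 1 "\<lambda>f. card (dominated f)"] by simp
    have "2 \<le> card (dominated f)" if "f \<in> N" for f using that by (auto simp: N_def removable_def)
    then show "2 * card N \<le> (\<Sum>f\<in>N. card (dominated f))"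
      using sum_bounded_below[of N 2 "\<lambda>f. card (dominated f)"] by simp
  qed
  also have "\<dots> = (\<Sum>f\<in>isoO \<union> N. card (dominated f))"
    by (rule sum.union_disjoint[symmetric]) (use finiso finO in \<open>auto simp: N_def\<close>)
  also have "\<dots> = card (\<Union>f\<in>isoO \<union> N. dominated f)"
    by (rule card_UN_disjoint[symmetric]) (use finiso finO finLam dominated_disjoint in \<open>auto simp: N_def\<close>)
  also have "\<dots> \<le> card L" using finL by (intro card_mono) (auto simp: dominated_def)
  finally show ?thesis using assms cN cO by linarith
qed

section \<open>Rerouting the clients of dropped centers\<close>

text \<open>The reduced solution contains mates instead of isolated centers, so a rerouted client
  has to end at the mate.\<close>

definition "rep f = (if f \<in> isoO then mate f else f)"
definition "cr c = co c + d (ctrO c) (rep (ctrO c))"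

lemma rep_V: "f \<in> Op \<Longrightarrow> rep f \<in> V" using mate_V OV by (auto simp: rep_def)

lemma cr_nonneg: "c \<in> C \<Longrightarrow> 0 \<le> cr c"
  using co_nonneg d_nonneg centers_V rep_V ctrO by (auto simp: cr_def intro!: add_nonneg_nonneg)

lemma sum_co_le: "(\<Sum>c\<in>C. co c ^ p) \<le> costs" and sum_cl_le: "(\<Sum>c\<in>C. cl c ^ p) \<le> costs"
  unfolding costs_def using cl_nonneg co_nonneg by (auto intro!: sum_mono)

lemma sum_cr_le: "(\<Sum>c\<in>C. cr c ^ p) \<le> 3 * 4 ^ p * costs"
proof -
  have "(\<Sum>c\<in>C. cr c ^ p) \<le> (\<Sum>c\<in>C. 2 ^ p * (co c ^ p + (if ctrO c \<in> isoO then gap (ctrO c) ^ p else 0)))"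
  proof (rule sum_mono)
    fix c assume c: "c \<in> C"
    \<comment> \<open>A center that is not isolated represents itself at distance 0, whose power
      vanishes because \<open>p > 0\<close>.\<close>
    have "d (ctrO c) (rep (ctrO c)) ^ p = (if ctrO c \<in> isoO then gap (ctrO c) ^ p else 0)"
      using p0 d_refl centers_V(3)[OF c] by (auto simp: rep_def gap_def)
    moreover have "cr c ^ p \<le> 2 ^ p * (co c ^ p + d (ctrO c) (rep (ctrO c)) ^ p)"
      unfolding cr_def using c co_nonneg d_nonneg centers_V rep_V ctrO by (intro power_add_le) auto
    ultimately show "cr c ^ p \<le> 2 ^ p * (co c ^ p + (if ctrO c \<in> isoO then gap (ctrO c) ^ p else 0))" by simp
  qed
  also have "\<dots> = 2 ^ p * ((\<Sum>c\<in>C. co c ^ p) + (\<Sum>c\<in>{c\<in>C. ctrO c \<in> isoO}. gap (ctrO c) ^ p))"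
    using finC by (simp add: sum_distrib_left[symmetric] sum.distrib sum.inter_filter)
  also have "\<dots> \<le> 2 ^ p * (costs + 2 * 2 ^ p * costs)"
    by (intro mult_left_mono add_mono sum_co_le sum_gap_all) auto
  also have "\<dots> \<le> 2 ^ p * (2 ^ p * costs + 2 * 2 ^ p * costs)"
    using costs_nonneg by (intro mult_left_mono add_mono) (auto simp: mult_le_cancel_right1)
  also have "\<dots> = 3 * 4 ^ p * costs" by (simp add: algebra_simps flip: power_mult_distrib)
  finally show ?thesis .
qed

text \<open>Every \<open>b\<close> receives the share \<open>1 / card (VL l)\<close> from each of
  the \<open>card (VL l)\<close> clients of its own cluster.\<close>

lemma sum_cluster_average:
  fixes t :: "'a \<Rightarrow> real"
  shows "(\<Sum>a\<in>C. (\<Sum>b\<in>VL (ctrL a). t b) / card (VL (ctrL a))) = (\<Sum>b\<in>C. t b)"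
proof -
  have "(\<Sum>a\<in>C. (\<Sum>b\<in>VL (ctrL a). t b) / card (VL (ctrL a)))
      = (\<Sum>l\<in>L. real (card {c\<in>C. ctrL c = l}) * ((\<Sum>b\<in>VL l. t b) / card (VL l)))"
    by (rule sum_fibres[OF finC finL]) (use ctrL in auto)
  also have "\<dots> = (\<Sum>l\<in>L. \<Sum>b\<in>{c\<in>C. ctrL c = l}. t b)"
  proof (rule sum.cong)
    fix l
    show "real (card {c\<in>C. ctrL c = l}) * ((\<Sum>b\<in>VL l. t b) / card (VL l)) = (\<Sum>b\<in>{c\<in>C. ctrL c = l}. t b)"
      using finVL[of l] by (cases "VL l = {}") (simp_all flip: VL_def)
  qed simp
  also have "\<dots> = (\<Sum>b\<in>C. t b)" by (rule sum.group[OF finC finL]) (use ctrL in auto)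
  finally show ?thesis .
qed

definition "substitute g \<longleftrightarrow>
  (\<forall>f\<in>Op. g f \<in> Op \<and> g f \<noteq> f \<and> (\<forall>h\<in>Op - {f}. d f (rep (g f)) \<le> d f (rep h)))"

lemma substitute_exists:
  assumes "card Op \<ge> 2"
  shows "\<exists>g. substitute g"
proof -
  have "\<exists>h. h \<in> Op \<and> h \<noteq> f \<and> (\<forall>h'\<in>Op - {f}. d f (rep h) \<le> d f (rep h'))" if "f \<in> Op" for f
  proof -
    have ne: "Op - {f} \<noteq> {}"
    proof
      assume "Op - {f} = {}"
      then have "card Op \<le> card {f}" using that by (intro card_mono) auto
      then show False using assms by simp
    qed
    obtain m where "m \<in> Op - {f}" "\<And>u. u \<in> Op - {f} \<Longrightarrow> d f (rep m) \<le> d f (rep u)"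
      using set_dist_attained[of "Op - {f}" "\<lambda>f h. d f (rep h)" f] ne finO by auto
    then show ?thesis by blast
  qed
  then show ?thesis unfolding substitute_def by metis
qed

text \<open>The detour runs from the center of \<open>a\<close> over \<open>a\<close>, the common
  \<open>L\<close>-center, \<open>b\<close> and the center of \<open>b\<close> to its
  representative. The center of \<open>b\<close> competes in the choice of \<open>g\<close>, since
  it differs from that of \<open>a\<close>.\<close>

lemma rerouting_distance:
  assumes g: "substitute g" and a: "a \<in> C" and b: "b \<in> C" "ctrL b = ctrL a" "ctrO b \<noteq> ctrO a"
  shows "d (ctrO a) (rep (g (ctrO a))) \<le> co a + cl a + cl b + cr b"
proof -
  note V = centers_V[OF a] centers_V[OF b(1)] rep_V[OF ctrO[OF b(1)]]
  have "d (ctrO a) (rep (g (ctrO a))) \<le> d (ctrO a) (rep (ctrO b))"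
    using g ctrO[OF a] ctrO[OF b(1)] b(3) by (auto simp: substitute_def)
  also have "\<dots> \<le> d (ctrO a) a + d a (rep (ctrO b))" using d_triangle V by blast
  also have "d a (rep (ctrO b)) \<le> d a (ctrL a) + d (ctrL a) (rep (ctrO b))" using d_triangle V by blast
  also have "d (ctrL a) (rep (ctrO b)) \<le> d (ctrL a) b + d b (rep (ctrO b))" using d_triangle V by blast
  also have "d b (rep (ctrO b)) \<le> d b (ctrO b) + d (ctrO b) (rep (ctrO b))" using d_triangle V by blast
  also have "d (ctrO a) a = co a" using d_sym V by (simp add: co_def)
  also have "d (ctrL a) b = cl b" using d_sym[of "ctrL a" b] V b(2) by (simp add: cl_def)
  finally show ?thesis by (simp add: cl_def co_def cr_def)
qed

text \<open>Two averages, each costing a factor \<open>1 / \<delta>\<close>. At least a \<delta>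
  share of the clients \<open>a\<close> of a removable center lie in a cluster of \<open>L\<close>
  that the center does not dominate. For such an \<open>a\<close>, at least a \<delta> share of that
  cluster belongs to other centers and can serve as \<open>b\<close> in the detour.\<close>

lemma sum_rerouting:
  assumes g: "substitute g"
  shows "(\<Sum>f\<in>removable. real (card (VO f)) * d f (rep (g f)) ^ p) \<le> 5 * 16 ^ p / \<delta>\<^sup>2 * costs"
proof -
  define D where "D f = d f (rep (g f))" for f
  have remO: "removable \<subseteq> Op" and finrem: "finite removable"
    using finO by (auto simp: removable_def)
  have D0: "0 \<le> D f" if "f \<in> Op" for f
    using that g OV rep_V unfolding D_def substitute_def by (intro d_nonneg) auto
  define W where "W = {a\<in>C. ctrO a \<in> removable \<and> ctrL a \<notin> dominated (ctrO a)}"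
  have finLam: "finite (dominated f)" for f using finL by (auto simp: dominated_def)
  have many: "\<delta> * card (VO f) \<le> card {a\<in>W. ctrO a = f}" if f: "f \<in> removable" for f
  proof -
    have eq: "{a\<in>W. ctrO a = f} = {a\<in>VO f. ctrL a \<notin> dominated f}" using f by (auto simp: W_def VO_def)
    show ?thesis
    proof (cases "dominated f = {}")
      case True
      then have "{a\<in>W. ctrO a = f} = VO f" using eq by simp
      moreover have "\<delta> * card (VO f) \<le> 1 * real (card (VO f))" using \<delta>2 by (intro mult_right_mono) auto
      ultimately show ?thesis by simp
    next
      case False
      then have "card (dominated f) = 1" using f finLam by (simp add: removable_def le_Suc_eq)
      then obtain l where l: "dominated f = {l}" by (rule card_1_singletonE)
      then have lL: "l \<in> dominated f" by simp
      then have l': "VL l \<noteq> {}" "(1 - \<delta>) * card (VL l) \<le> card (VL l \<inter> VO f)" by (auto simp: dominated_def)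
      have "0 < (1 - \<delta>) * card (VL l)"
        using l'(1) finVL \<delta>2 by (intro mult_pos_pos) (auto simp: card_gt_0_iff)
      then have "VL l \<inter> VO f \<noteq> {}" using l'(2) by (metis card.empty not_le of_nat_0)
      \<comment> \<open>The center dominates \<open>l\<close> without being isolated, so it is its
        own cluster that must have more than a \<delta> share outside \<open>VL l\<close>.\<close>
      moreover have "\<not> isolated l f" using f by (auto simp: removable_def isoO_def)
      ultimately have small: "card (VL l \<inter> VO f) < (1 - \<delta>) * card (VO f)"
        using l'(2) by (auto simp: isolated_def)
      have "{a\<in>VO f. ctrL a \<notin> dominated f} = VO f - VL l \<inter> VO f"
        using l by (auto simp: VL_def VO_def)
      then have "card {a\<in>W. ctrO a = f} = card (VO f) - card (VL l \<inter> VO f)"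
        using eq finVO by (simp add: card_Diff_subset finVL)
      moreover have "card (VL l \<inter> VO f) \<le> card (VO f)" using finVO by (intro card_mono) auto
      ultimately have "real (card {a\<in>W. ctrO a = f}) = card (VO f) - card (VL l \<inter> VO f)" by simp
      then show ?thesis using small by (simp add: algebra_simps)
    qed
  qed
  define t where "t b = cl b ^ p + cr b ^ p" for b
  have t0: "0 \<le> t b" if "b \<in> C" for b using that cl_nonneg cr_nonneg by (auto simp: t_def)
  have each: "D (ctrO a) ^ p \<le> 4 ^ p * (co a ^ p + cl a ^ p + (\<Sum>b\<in>VL (ctrL a). t b) / card (VL (ctrL a)) / \<delta>)"
    if a: "a \<in> W" for a
  proof -
    have aC: "a \<in> C" using a by (simp add: W_def)
    define l f where "l = ctrL a" and "f = ctrO a"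
    define Y where "Y = VL l - VO f"
    have aV: "a \<in> VL l" using aC by (simp add: VL_def l_def)
    have vl: "card (VL l) > 0" using aV finVL by (auto simp: card_gt_0_iff)
    have "l \<notin> dominated f" "l \<in> L" using a ctrL[OF aC] by (auto simp: W_def l_def f_def)
    then have "card (VL l \<inter> VO f) < (1 - \<delta>) * card (VL l)" using aV by (auto simp: dominated_def)
    moreover have "real (card Y) = card (VL l) - card (VL l \<inter> VO f)"
    proof -
      have "Y = VL l - VL l \<inter> VO f" by (auto simp: Y_def)
      then have "card Y = card (VL l) - card (VL l \<inter> VO f)" using finVL by (simp add: card_Diff_subset)
      then show ?thesis using card_mono[OF finVL, of "VL l \<inter> VO f" l] by simp
    qed
    ultimately have Y: "\<delta> * card (VL l) < card Y" by (simp add: algebra_simps)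
    have Ypos: "0 < real (card Y)" using Y \<delta>0 vl by (smt (verit) mult_nonneg_nonneg of_nat_0_le_iff)
    have "real (card Y) * D f ^ p \<le> (\<Sum>b\<in>Y. 4 ^ p * (co a ^ p + cl a ^ p + t b))"
    proof (rule sum_bounded_below)
      fix b assume "b \<in> Y"
      then have b: "b \<in> C" "ctrL b = ctrL a" "ctrO b \<noteq> ctrO a" using aC by (auto simp: Y_def VL_def VO_def l_def f_def)
      have "D f \<le> co a + cl a + cl b + cr b" unfolding D_def f_def by (rule rerouting_distance[OF g aC b])
      then have "D f ^ p \<le> (co a + cl a + cl b + cr b) ^ p"
        using D0[of f] ctrO[OF aC] by (intro power_mono) (auto simp: f_def)
      also have "\<dots> \<le> 4 ^ p * (co a ^ p + cl a ^ p + cl b ^ p + cr b ^ p)"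
        by (intro power_add4_le co_nonneg cl_nonneg cr_nonneg aC b)
      finally show "D f ^ p \<le> 4 ^ p * (co a ^ p + cl a ^ p + t b)" by (simp add: t_def algebra_simps)
    qed
    also have "\<dots> = 4 ^ p * (card Y * (co a ^ p + cl a ^ p) + (\<Sum>b\<in>Y. t b))"
      by (simp add: sum_distrib_left[symmetric] sum.distrib)
    also have "\<dots> \<le> 4 ^ p * (card Y * (co a ^ p + cl a ^ p) + (\<Sum>b\<in>VL l. t b))"
    proof -
      have "(\<Sum>b\<in>Y. t b) \<le> (\<Sum>b\<in>VL l. t b)"
        by (rule sum_mono2) (use finVL t0 in \<open>auto simp: Y_def VL_def\<close>)
      then show ?thesis by simp
    qed
    finally have "D f ^ p \<le> 4 ^ p * (card Y * (co a ^ p + cl a ^ p) + (\<Sum>b\<in>VL l. t b)) / card Y"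
      using Ypos by (simp add: field_simps)
    also have "\<dots> = 4 ^ p * (co a ^ p + cl a ^ p + (\<Sum>b\<in>VL l. t b) / card Y)"
      using Ypos by (simp add: field_simps)
    also have "\<dots> \<le> 4 ^ p * (co a ^ p + cl a ^ p + (\<Sum>b\<in>VL l. t b) / (\<delta> * card (VL l)))"
    proof -
      have "(\<Sum>b\<in>VL l. t b) / card Y \<le> (\<Sum>b\<in>VL l. t b) / (\<delta> * card (VL l))"
        using Y Ypos \<delta>0 vl by (intro divide_left_mono sum_nonneg t0) (auto simp: VL_def)
      then show ?thesis by simp
    qed
    finally show ?thesis by (simp add: l_def f_def field_simps)
  qed
  have "(\<Sum>f\<in>removable. real (card (VO f)) * D f ^ p) * \<delta> = (\<Sum>f\<in>removable. (\<delta> * card (VO f)) * D f ^ p)"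
    by (simp add: sum_distrib_left sum_distrib_right mult_ac)
  also have "\<dots> \<le> (\<Sum>f\<in>removable. real (card {a\<in>W. ctrO a = f}) * D f ^ p)"
    using D0 remO by (intro sum_mono mult_right_mono many) auto
  also have "\<dots> = (\<Sum>a\<in>W. D (ctrO a) ^ p)"
    by (rule sum_fibres[symmetric]) (use finC finrem in \<open>auto simp: W_def\<close>)
  also have "\<dots> \<le> (\<Sum>a\<in>W. 4 ^ p * (co a ^ p + cl a ^ p + (\<Sum>b\<in>VL (ctrL a). t b) / card (VL (ctrL a)) / \<delta>))"
    by (rule sum_mono) (rule each)
  also have "\<dots> \<le> (\<Sum>a\<in>C. 4 ^ p * (co a ^ p + cl a ^ p + (\<Sum>b\<in>VL (ctrL a). t b) / card (VL (ctrL a)) / \<delta>))"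
    by (rule sum_mono2[OF finC])
      (use co_nonneg cl_nonneg \<delta>0 t0 in \<open>auto simp: W_def VL_def intro!: mult_nonneg_nonneg add_nonneg_nonneg divide_nonneg_nonneg sum_nonneg\<close>)
  also have "\<dots> = 4 ^ p * (costs + (\<Sum>b\<in>C. t b) / \<delta>)"
  proof -
    have "(\<Sum>a\<in>C. (\<Sum>b\<in>VL (ctrL a). t b) / card (VL (ctrL a)) / \<delta>) = (\<Sum>b\<in>C. t b) / \<delta>"
      unfolding sum_divide_distrib[symmetric] sum_cluster_average ..
    then show ?thesis by (simp only: sum_distrib_left[symmetric] sum.distrib costs_def) (simp add: add.commute)
  qed
  also have "\<dots> \<le> 4 ^ p * (4 ^ p * costs / \<delta> + 4 * 4 ^ p * costs / \<delta>)"
  proof (intro mult_left_mono add_mono)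
    have "\<delta> \<le> 4 ^ p" using \<delta>2 one_le_power[of "4::real" p] by linarith
    then have "(1::real) \<le> 4 ^ p / \<delta>" using \<delta>0 by (simp add: field_simps)
    then have "1 * costs \<le> 4 ^ p / \<delta> * costs" by (intro mult_right_mono costs_nonneg)
    then show "costs \<le> 4 ^ p * costs / \<delta>" by simp
    have "(\<Sum>b\<in>C. t b) \<le> costs + 3 * 4 ^ p * costs"
      unfolding t_def sum.distrib by (intro add_mono sum_cl_le sum_cr_le)
    also have "\<dots> \<le> 4 ^ p * costs + 3 * 4 ^ p * costs"
      using mult_right_mono[of 1 "4 ^ p" costs] costs_nonneg by (simp add: mult.commute)
    finally show "(\<Sum>b\<in>C. t b) / \<delta> \<le> 4 * 4 ^ p * costs / \<delta>" using \<delta>0 by (simp add: divide_right_mono mult_ac)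
  qed auto
  also have "\<dots> = 5 * 16 ^ p * costs / \<delta>"
    using \<delta>0 by (simp add: field_simps flip: power_mult_distrib)
  finally show ?thesis unfolding D_def using \<delta>0 by (simp add: field_simps power2_eq_square)
qed

text \<open>The divisor 6 combines the half of the centers that is removable with the third of those
  in which no substitute is dropped too; the loss of 1 comes from rounding down. A cheapest subset
  costs at most its proportional share.\<close>

lemma cheap_removal:
  assumes g: "substitute g" and LO: "card L \<le> card Op" and \<theta>: "0 < \<theta>" "\<theta> \<le> (1::real)"
  obtains A where "A \<subseteq> Op - isoO" "\<And>f. f \<in> A \<Longrightarrow> g f \<notin> A"
    "\<theta> * card (Op - isoO) / 6 - 1 \<le> card A"
    "(\<Sum>f\<in>A. real (card (VO f)) * d f (rep (g f)) ^ p) \<le> \<theta> * (5 * 16 ^ p / \<delta>\<^sup>2 * costs)"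
proof -
  let ?w = "\<lambda>f. real (card (VO f)) * d f (rep (g f)) ^ p"
  have remO: "removable \<subseteq> Op - isoO" and finrem: "finite removable"
    using finO by (auto simp: removable_def)
  have w0: "0 \<le> ?w f" if "f \<in> Op" for f
    using that g OV rep_V unfolding substitute_def
    by (intro mult_nonneg_nonneg zero_le_power d_nonneg) auto
  obtain A' where A': "A' \<subseteq> removable" "card removable \<le> 3 * card A'" "\<forall>x\<in>A'. g x \<notin> A'"
    using independent_third[OF finrem, of g] g remO unfolding substitute_def by blast
  have finA': "finite A'" using A'(1) finrem finite_subset by blast
  define t where "t = nat \<lfloor>\<theta> * card A'\<rfloor>"
  have t: "real t \<le> \<theta> * card A'" "\<theta> * card A' - 1 \<le> real t"
    using \<theta> by (auto simp: t_def)
  have "\<theta> * card A' \<le> 1 * real (card A')" using \<theta> by (intro mult_right_mono) auto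
  then have "t \<le> card A'" using t(1) by linarith
  then obtain A where A: "A \<subseteq> A'" "card A = t" "real (card A') * sum ?w A \<le> real t * sum ?w A'"
    using cheap_subset[OF finA', of t ?w] by blast
  have sw: "0 \<le> sum ?w A'" using A'(1) remO by (intro sum_nonneg w0) auto
  have "sum ?w A \<le> \<theta> * sum ?w A'"
  proof (cases "A' = {}")
    case True
    then show ?thesis using A by simp
  next
    case False
    have "real (card A') * sum ?w A \<le> (\<theta> * card A') * sum ?w A'"
      using A(3) mult_right_mono[OF t(1) sw] by linarith
    then show ?thesis using False finA' by (simp add: card_gt_0_iff algebra_simps)
  qed
  also have "\<dots> \<le> \<theta> * (5 * 16 ^ p / \<delta>\<^sup>2 * costs)"
  proof (intro mult_left_mono)
    have "sum ?w A' \<le> sum ?w removable"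
      using A'(1) remO by (intro sum_mono2 finrem w0) auto
    then show "sum ?w A' \<le> 5 * 16 ^ p / \<delta>\<^sup>2 * costs" using sum_rerouting[OF g] by linarith
  qed (use \<theta> in simp)
  finally have 4: "sum ?w A \<le> \<theta> * (5 * 16 ^ p / \<delta>\<^sup>2 * costs)" .
  have "card (Op - isoO) \<le> 6 * card A'" using card_removable[OF LO] A'(2) by linarith
  then have "\<theta> * card (Op - isoO) \<le> \<theta> * (6 * card A')" using \<theta> by (intro mult_left_mono) linarith+
  then have 3: "\<theta> * card (Op - isoO) / 6 - 1 \<le> card A" using t(2) A(2) by simp
  show ?thesis
    by (rule that[of A]) (use A A' remO 3 4 in auto)
qed

section \<open>Costs of the two kinds of exchanges\<close>

text \<open>For clients of isolated centers of \<open>L\<close>: the distance available once the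
  center is exchanged for its mate.\<close>

definition "isolated_bound c = (if ctrO c = mateL (ctrL c) then co c else cl c + gap (mateL (ctrL c)))"

text \<open>For the reduced solution. Core clients keep their \<open>L\<close>-center, so their
  bound is \<open>cl c\<close> and not \<open>co c\<close> plus a gap; the difference is settled by
  the direct exchanges.\<close>

definition "reduced_bound A g c = (if ctrO c \<in> A then co c + d (ctrO c) (rep (g (ctrO c)))
   else if ctrO c \<in> isoO then (if ctrL c = mate (ctrO c) then cl c else co c + gap (ctrO c)) else co c)"

lemma reduced_solution_cost:
  assumes g: "substitute g" and A: "A \<subseteq> Op - isoO" "\<And>f. f \<in> A \<Longrightarrow> g f \<notin> A"
  shows "real_cost d p C (Op - isoO - A \<union> isoL) \<le> (\<Sum>c\<in>C. reduced_bound A g c ^ p)"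
  unfolding real_cost_def
proof (rule sum_mono)
  fix c assume c: "c \<in> C"
  let ?N = "Op - isoO - A \<union> isoL"
  have NV: "?N \<subseteq> V" using OV isoL_sub LV by blast
  have finN: "finite ?N" using NV finV finite_subset by blast
  have "\<exists>m\<in>?N. d c m \<le> reduced_bound A g c"
  proof -
    note V = centers_V[OF c]
    consider (A) "ctrO c \<in> A" | (core) "ctrO c \<in> isoO" "ctrL c = mate (ctrO c)"
      | (iso) "ctrO c \<in> isoO" "ctrL c \<noteq> mate (ctrO c)" | (other) "ctrO c \<notin> A" "ctrO c \<notin> isoO" by blast
    then show ?thesis
    proof cases
      case A': A
      let ?h = "g (ctrO c)"
      have h: "?h \<in> Op" "?h \<notin> A" using A' A g by (auto simp: substitute_def)
      \<comment> \<open>The substitute is not dropped itself, so it survives in person or through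
        its mate.\<close>
      have "rep ?h \<in> ?N" using h mate_V(3) by (auto simp: rep_def)
      moreover have "d c (rep ?h) \<le> d c (ctrO c) + d (ctrO c) (rep ?h)"
        using d_triangle V rep_V[OF h(1)] by blast
      ultimately show ?thesis using A' by (auto simp: reduced_bound_def co_def)
    next
      case core
      then have "ctrL c \<in> ?N" "ctrO c \<notin> A" using mate_V(3) A by auto
      then show ?thesis using core by (auto simp: reduced_bound_def cl_def)
    next
      case iso
      have "mate (ctrO c) \<in> ?N" "ctrO c \<notin> A" using mate_V(3) iso A by auto
      moreover have "d c (mate (ctrO c)) \<le> d c (ctrO c) + d (ctrO c) (mate (ctrO c))"
        using d_triangle V mate_V(1)[OF iso(1)] by blast
      ultimately show ?thesis using iso by (auto simp: reduced_bound_def co_def gap_def)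
    next
      case other
      then have "ctrO c \<in> ?N" using ctrO[OF c] by blast
      then show ?thesis using other by (auto simp: reduced_bound_def co_def)
    qed
  qed
  then obtain m where m: "m \<in> ?N" "d c m \<le> reduced_bound A g c" by blast
  have "set_dist d c ?N \<le> reduced_bound A g c" using set_dist_le[OF finN m(1), of d c] m(2) by linarith
  moreover have "0 \<le> set_dist d c ?N" using NV m(1) by (intro set_dist_nonneg centers_V(1)[OF c]) auto
  ultimately show "set_dist d c ?N ^ p \<le> reduced_bound A g c ^ p" by (rule power_mono)
qed

text \<open>Mates replace each other one for one, so any batch keeps the size, and clients outside
  the exchanged clusters keep their centers. Batches of up to \<open>2 * R\<close> pairs serve to
  save exchanges.\<close>

lemma isolated_exchanges:
  assumes near: "\<And>c. c \<in> C \<Longrightarrow> set_dist d c L = cl c" and Lne: "L \<noteq> {}"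
    and opt: "\<And>M. M \<subseteq> V \<Longrightarrow> M \<noteq> {} \<Longrightarrow> card M \<le> card L \<Longrightarrow> card (L - M) + card (M - L) \<le> 4 * R
       \<Longrightarrow> (1 - e) * real_cost d p C L \<le> real_cost d p C M"
    and e: "e \<ge> 0" and R: "R > 0" and m: "real (card isoO) / R + 1 \<le> m"
  shows "- (m * e * real_cost d p C L) \<le> (\<Sum>c\<in>C. if ctrL c \<in> isoL then isolated_bound c ^ p - cl c ^ p else 0)"
proof -
  \<comment> \<open>Merging singletons of size 1 and value 0 produces the batches, at most
    \<open>card isoO / R + 1\<close> of them.\<close>
  have "partition_on isoO ((\<lambda>f. {f}) ` isoO)" by (auto simp: partition_on_def disjoint_def)
  then have "\<exists>\<P>. partition_on isoO \<P> \<and> (\<forall>J\<in>\<P>. sum (\<lambda>_. 1::nat) J \<le> 2 * R \<and> sum (\<lambda>_. 0::int) J \<le> 0) \<and>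
     card \<P> * R \<le> sum (\<lambda>_. 1::nat) isoO + R"
    by (rule merge_groups[OF finiso(1)]) (use R in auto)
  then obtain \<P> where P: "partition_on isoO \<P>" "\<And>J. J \<in> \<P> \<Longrightarrow> card J \<le> 2 * R" "card \<P> * R \<le> card isoO + R"
    by auto
  have finP: "finite \<P>" using P(1) finiso by (metis finite_elements)
  have JO: "J \<subseteq> isoO" "J \<noteq> {}" if "J \<in> \<P>" for J using P(1) that by (auto simp: partition_on_def)
  define M where "M J = (L - mate ` J) \<union> J" for J
  have MV: "M J \<subseteq> V" if "J \<in> \<P>" for J using JO[OF that] LV mate_V(2) by (auto simp: M_def)
  have finM: "finite (M J)" if "J \<in> \<P>" for J using MV[OF that] finV finite_subset by blast
  have injm: "inj_on mate isoO" using bij_mate by (simp add: bij_betw_def)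
  have better: "(1 - e) * real_cost d p C L \<le> real_cost d p C (M J)" if J: "J \<in> \<P>" for J
  proof (rule opt)
    show "M J \<subseteq> V" "M J \<noteq> {}" using MV[OF J] JO[OF J] by (auto simp: M_def)
    have finJ: "finite J" using JO[OF J] finiso finite_subset by blast
    have cm: "card (mate ` J) = card J" using injm JO[OF J] by (meson card_image inj_on_subset)
    have sub: "mate ` J \<subseteq> L" using JO[OF J] mate_V(3) isoL_sub by blast
    have "card (M J) \<le> card (L - mate ` J) + card J" unfolding M_def by (rule card_Un_le)
    also have "\<dots> = card L - card J + card J" using sub finJ cm by (simp add: card_Diff_subset)
    also have "\<dots> = card L" using card_mono[OF finL sub] cm by simp
    finally show "card (M J) \<le> card L" .
    have "card (L - M J) \<le> card (mate ` J)" using finJ by (intro card_mono) (auto simp: M_def)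
    moreover have "card (M J - L) \<le> card J" using finJ by (intro card_mono) (auto simp: M_def)
    ultimately show "card (L - M J) + card (M J - L) \<le> 4 * R" using cm P(2)[OF J] by linarith
  qed
  have client: "set_dist d c (M J) ^ p - cl c ^ p \<le> (if ctrL c \<in> mate ` J then isolated_bound c ^ p - cl c ^ p else 0)"
    if c: "c \<in> C" and J: "J \<in> \<P>" for c J
  proof -
    note V = centers_V[OF c]
    have nn: "0 \<le> set_dist d c (M J)" using MV[OF J] JO[OF J] by (intro set_dist_nonneg V) (auto simp: M_def)
    show ?thesis
    proof (cases "ctrL c \<in> mate ` J")
      case False
      then have "ctrL c \<in> M J" using ctrL[OF c] by (simp add: M_def)
      then have "set_dist d c (M J) \<le> cl c" using set_dist_le[OF finM[OF J], of "ctrL c" d c] by (simp add: cl_def)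
      then show ?thesis using False power_mono[OF _ nn, of "cl c" p] by simp
    next
      case True
      then obtain f where f: "f \<in> J" "ctrL c = mate f" by blast
      have fO: "f \<in> isoO" using f JO[OF J] by blast
      have mf: "mateL (ctrL c) = f" using mateL_eq[OF iso_mate[OF fO]] f by simp
      have "d c f \<le> isolated_bound c"
      proof (cases "ctrO c = f")
        case True
        then show ?thesis using mf by (simp add: isolated_bound_def co_def)
      next
        case False
        have "d c f \<le> d c (ctrL c) + d (ctrL c) f" using d_triangle V mate_V(2)[OF fO] by blast
        also have "d (ctrL c) f = gap f" using d_sym mate_V[OF fO] f by (simp add: gap_def)
        finally show ?thesis using False mf by (simp add: isolated_bound_def cl_def)
      qed
      then have "set_dist d c (M J) \<le> isolated_bound c" using set_dist_le[OF finM[OF J], of f d c] f by (force simp: M_def)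
      then show ?thesis using True power_mono[OF _ nn, of "isolated_bound c" p] by simp
    qed
  qed
  have once: "(\<Sum>J\<in>\<P>. if ctrL c \<in> mate ` J then x else 0) = (if ctrL c \<in> isoL then x else 0)" for c and x :: real
  proof (cases "ctrL c \<in> isoL")
    case True
    define f where "f = mateL (ctrL c)"
    have f: "isolated (ctrL c) f" using iso_mateL[OF True] by (simp add: f_def)
    then have "f \<in> isoO" by (auto simp: isoO_def)
    then obtain J0 where J0: "J0 \<in> \<P>" "f \<in> J0" using P(1) by (auto simp: partition_on_def)
    have "ctrL c \<in> mate ` J \<longleftrightarrow> J = J0" if J: "J \<in> \<P>" for J
    proof
      assume "ctrL c \<in> mate ` J"
      then obtain f' where f': "f' \<in> J" "ctrL c = mate f'" by blast
      have "f' = f" using iso_unique_f[OF _ f] iso_mate f' JO[OF J] by force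
      then show "J = J0" using f' J J0 P(1) by (auto simp: partition_on_def disjoint_def)
    next
      assume "J = J0"
      then show "ctrL c \<in> mate ` J" using J0 mate_eq[OF f] by force
    qed
    then have "(\<Sum>J\<in>\<P>. if ctrL c \<in> mate ` J then x else 0) = (\<Sum>J\<in>\<P>. if J = J0 then x else 0)"
      by (intro sum.cong) auto
    then show ?thesis using True J0 finP by simp
  next
    case False
    have "mate ` J \<subseteq> isoL" if "J \<in> \<P>" for J using JO(1)[OF that] bij_mate by (auto simp: bij_betw_def)
    then have "ctrL c \<notin> mate ` J" if "J \<in> \<P>" for J using False that by (meson subsetD)
    then show ?thesis using False by simp
  qed
  have costL: "real_cost d p C L = (\<Sum>c\<in>C. cl c ^ p)" unfolding real_cost_def using near by simp
  have nnL: "0 \<le> real_cost d p C L" by (rule real_cost_nonneg[OF CV LV Lne])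
  have "real (card \<P>) * R \<le> real (card isoO) + R" using P(3) by (metis of_nat_add of_nat_le_iff of_nat_mult)
  then have "real (card \<P>) \<le> real (card isoO) / R + 1" using R by (simp add: field_simps)
  then have "real (card \<P>) * (e * real_cost d p C L) \<le> m * (e * real_cost d p C L)"
    using m e nnL by (intro mult_right_mono) auto
  then have "- (m * e * real_cost d p C L) \<le> real (card \<P>) * (- e * real_cost d p C L)" by (simp add: algebra_simps)
  also have "\<dots> \<le> (\<Sum>J\<in>\<P>. real_cost d p C (M J) - real_cost d p C L)"
  proof (rule sum_bounded_below)
    show "- e * real_cost d p C L \<le> real_cost d p C (M J) - real_cost d p C L" if "J \<in> \<P>" for J
      using better[OF that] by (simp add: algebra_simps)
  qed
  also have "\<dots> = (\<Sum>J\<in>\<P>. \<Sum>c\<in>C. set_dist d c (M J) ^ p - cl c ^ p)"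
    unfolding costL unfolding real_cost_def sum_subtractf[symmetric] by simp
  also have "\<dots> \<le> (\<Sum>J\<in>\<P>. \<Sum>c\<in>C. if ctrL c \<in> mate ` J then isolated_bound c ^ p - cl c ^ p else 0)"
    by (intro sum_mono client)
  also have "\<dots> = (\<Sum>c\<in>C. \<Sum>J\<in>\<P>. if ctrL c \<in> mate ` J then isolated_bound c ^ p - cl c ^ p else 0)" by (rule sum.swap)
  also have "\<dots> = (\<Sum>c\<in>C. if ctrL c \<in> isoL then isolated_bound c ^ p - cl c ^ p else 0)" by (simp add: once)
  finally show ?thesis .
qed

text \<open>For core clients the two sums telescope: \<open>cl c ^ p\<close> from the reduced
  solution and \<open>co c ^ p - cl c ^ p\<close> from the exchange of the pair. For the others
  \<open>power_add_perturb\<close> separates a small multiple of the costs from a heavily weighted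
  extra distance, which arises only for clients of dropped centers and stray clients.\<close>

lemma exchanges_error:
  assumes g: "substitute g" and A: "A \<subseteq> Op - isoO" and s: "0 < s" "s \<le> 1"
    and Z: "(\<Sum>f\<in>A. real (card (VO f)) * d f (rep (g f)) ^ p) \<le> Z"
  shows "(\<Sum>c\<in>C. reduced_bound A g c ^ p) + (\<Sum>c\<in>C. if ctrL c \<in> isoL then isolated_bound c ^ p - cl c ^ p else 0)
    \<le> (\<Sum>c\<in>C. co c ^ p) + 2 * 4 ^ p * s * costs + (1 + 1 / s) ^ p * (4 * \<delta> * 2 ^ p * costs + Z)"
proof -
  define W where "W = (1 + 1 / s) ^ p"
  have W0: "0 \<le> W" using s by (simp add: W_def)
  define D where "D c = d (ctrO c) (rep (g (ctrO c)))" for c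
  define e1 where "e1 c = (if ctrO c \<in> A then D c ^ p else 0)" for c
  define e2 where "e2 c = (if c \<in> strayO then gap (ctrO c) ^ p else 0)" for c
  define e3 where "e3 c = (if c \<in> strayL then gap (mateL (ctrL c)) ^ p else 0)" for c
  have point: "reduced_bound A g c ^ p + (if ctrL c \<in> isoL then isolated_bound c ^ p - cl c ^ p else 0)
     \<le> co c ^ p + 4 ^ p * s * (co c ^ p + cl c ^ p) + W * (e1 c + e2 c + e3 c)" if c: "c \<in> C" for c
  proof -
    note V = centers_V[OF c]
    have pert: "(x + y) ^ p - x ^ p \<le> 4 ^ p * s * x ^ p + W * y ^ p" if "0 \<le> x" "0 \<le> y" for x y
      unfolding W_def by (rule power_add_perturb[OF that s])
    have nn: "0 \<le> co c" "0 \<le> cl c" using co_nonneg cl_nonneg c by auto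
    have D0: "0 \<le> D c" unfolding D_def using g ctrO[OF c] V rep_V by (intro d_nonneg) (auto simp: substitute_def)
    have pos: "0 \<le> 4 ^ p * s * co c ^ p" "0 \<le> 4 ^ p * s * cl c ^ p" using nn s by auto
    have e0: "0 \<le> W * e1 c" "0 \<le> W * e2 c" "0 \<le> W * e3 c"
    proof -
      have "ctrL c \<in> isoL \<Longrightarrow> mateL (ctrL c) \<in> isoO" using iso_mateL by (auto simp: isoO_def)
      then show "0 \<le> W * e1 c" "0 \<le> W * e2 c" "0 \<le> W * e3 c"
        using D0 gap_nonneg W0 by (auto simp: e1_def e2_def e3_def strayO_def strayL_def)
    qed
    show ?thesis
    proof (cases "ctrL c \<in> isoL \<and> ctrO c = mateL (ctrL c)")
      case True
      then have i: "isolated (ctrL c) (ctrO c)" using iso_mateL[of "ctrL c"] by simp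
      have "ctrO c \<in> isoO" "mate (ctrO c) = ctrL c" using i mate_eq[OF i] by (auto simp: isoO_def)
      moreover from this have "ctrO c \<notin> A" using A by blast
      ultimately show ?thesis using True pos e0 by (simp add: reduced_bound_def isolated_bound_def algebra_simps)
    next
      case False
      have second: "(if ctrL c \<in> isoL then isolated_bound c ^ p - cl c ^ p else 0) \<le> 4 ^ p * s * cl c ^ p + W * e3 c"
      proof (cases "ctrL c \<in> isoL")
        case True
        then have "mateL (ctrL c) \<in> isoO" using iso_mateL by (auto simp: isoO_def)
        then show ?thesis using pert[OF nn(2) gap_nonneg] False True c by (simp add: isolated_bound_def e3_def strayL_def)
      qed (use pos e0 in simp)
      have first: "reduced_bound A g c ^ p \<le> co c ^ p + 4 ^ p * s * co c ^ p + W * e1 c + W * e2 c"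
      proof -
        have ne: "ctrO c \<in> isoO \<Longrightarrow> ctrL c \<noteq> mate (ctrO c)"
          using False mate_V(3) mateL_eq[OF iso_mate] by metis
        consider "ctrO c \<in> A" | "ctrO c \<notin> A" "ctrO c \<in> isoO" | "ctrO c \<notin> A" "ctrO c \<notin> isoO" by blast
        then show ?thesis
        proof cases
          case 1
          then show ?thesis using pert[OF nn(1) D0] e0 by (simp add: reduced_bound_def e1_def D_def)
        next
          case 2
          then show ?thesis using pert[OF nn(1) gap_nonneg[OF 2(2)]] e0 ne c by (simp add: reduced_bound_def e2_def strayO_def)
        next
          case 3
          then show ?thesis using pos e0 by (simp add: reduced_bound_def)
        qed
      qed
      show ?thesis using first second by (simp add: algebra_simps)
    qed
  qed
  have "(\<Sum>c\<in>C. reduced_bound A g c ^ p) + (\<Sum>c\<in>C. if ctrL c \<in> isoL then isolated_bound c ^ p - cl c ^ p else 0)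
    \<le> (\<Sum>c\<in>C. co c ^ p + 4 ^ p * s * (co c ^ p + cl c ^ p) + W * (e1 c + e2 c + e3 c))"
    unfolding sum.distrib[symmetric] by (rule sum_mono) (rule point)
  also have "\<dots> = (\<Sum>c\<in>C. co c ^ p) + 4 ^ p * s * costs + W * (sum e1 C + sum e2 C + sum e3 C)"
    by (simp add: sum.distrib sum_distrib_left costs_def algebra_simps)
  also have "\<dots> \<le> (\<Sum>c\<in>C. co c ^ p) + 2 * 4 ^ p * s * costs + W * (4 * \<delta> * 2 ^ p * costs + Z)"
  proof -
    have "sum e2 C = (\<Sum>c\<in>strayO. gap (ctrO c) ^ p)"
      unfolding e2_def using finC by (subst sum.inter_filter[symmetric]) (auto simp: strayO_def intro: sum.cong)
    moreover have "sum e3 C = (\<Sum>c\<in>strayL. gap (mateL (ctrL c)) ^ p)"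
      unfolding e3_def using finC by (subst sum.inter_filter[symmetric]) (auto simp: strayL_def intro: sum.cong)
    moreover have "sum e1 C = (\<Sum>f\<in>A. real (card (VO f)) * d f (rep (g f)) ^ p)"
    proof -
      have "sum e1 C = (\<Sum>c\<in>{c\<in>C. ctrO c \<in> A}. d (ctrO c) (rep (g (ctrO c))) ^ p)"
        unfolding e1_def D_def using finC by (simp add: sum.inter_filter)
      also have "\<dots> = (\<Sum>f\<in>A. real (card {c \<in> {c\<in>C. ctrO c \<in> A}. ctrO c = f}) * d f (rep (g f)) ^ p)"
        by (rule sum_fibres) (use finC finite_subset[OF A finite_Diff[OF finO]] in auto)
      also have "\<dots> = (\<Sum>f\<in>A. real (card (VO f)) * d f (rep (g f)) ^ p)"
        by (rule sum.cong[OF refl]) (auto simp: VO_def intro!: arg_cong[where f = card])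
      finally show ?thesis .
    qed
    ultimately have "sum e1 C + sum e2 C + sum e3 C \<le> 4 * \<delta> * 2 ^ p * costs + Z"
      using sum_gap_strayO sum_gap_strayL Z by (simp add: algebra_simps)
    then have "W * (sum e1 C + sum e2 C + sum e3 C) \<le> W * (4 * \<delta> * 2 ^ p * costs + Z)"
      using W0 by (rule mult_left_mono)
    moreover have "0 \<le> 4 ^ p * s * costs" using s costs_nonneg by simp
    moreover have "2 * 4 ^ p * s * costs = 4 ^ p * s * costs + 4 ^ p * s * costs" by simp
    ultimately show ?thesis by linarith
  qed
  finally show ?thesis by (simp add: W_def)
qed

end

section \<open>Local optima\<close>

context graph_metric
begin

text \<open>Some client pays at least the average. A center placed on it saves that much, and room
  can be made: if \<open>L\<close> is full, the other clients use fewer than \<open>k\<close>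
  centers. The saving of a \<open>1 / card C\<close> share beats the permitted \<epsilon> times that
  share, unless the cost is 0.\<close>

lemma few_clients:
  fixes \<epsilon> :: real
  assumes C: "C \<subseteq> V" and L: "L \<subseteq> V" "L \<noteq> {}" "card L \<le> k" and p: "p > 0" and \<epsilon>: "\<epsilon> < 1"
    and nk: "card C \<le> k" and s: "2 \<le> s"
    and opt: "\<And>M. M \<subseteq> V \<Longrightarrow> M \<noteq> {} \<Longrightarrow> card M \<le> k \<Longrightarrow> card (L - M) + card (M - L) \<le> s
       \<Longrightarrow> (1 - \<epsilon> / card C) * real_cost d p C L \<le> real_cost d p C M"
  shows "real_cost d p C L = 0"
proof (rule ccontr)
  assume "real_cost d p C L \<noteq> 0"
  then have pos: "0 < real_cost d p C L" using real_cost_nonneg[OF C L(1,2), of p] by linarith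
  then have Cne: "C \<noteq> {}" by (auto simp: real_cost_def)
  have finC: "finite C" and finL: "finite L" using C L finV finite_subset by auto
  have n: "card C > 0" using Cne finC by (simp add: card_gt_0_iff)
  have "\<exists>l. l \<in> L \<and> set_dist d c L = d c l" for c
    using set_dist_attained[OF finL L(2), of d c] by blast
  then obtain ctr where ctr: "\<And>c. ctr c \<in> L" "\<And>c. set_dist d c L = d c (ctr c)" by metis
  have "Max ((\<lambda>c. set_dist d c L ^ p) ` C) \<in> (\<lambda>c. set_dist d c L ^ p) ` C"
    using finC Cne by (intro Max_in) auto
  then obtain x where x: "x \<in> C" "Max ((\<lambda>c. set_dist d c L ^ p) ` C) = set_dist d x L ^ p" by blast
  have "real_cost d p C L \<le> card C * set_dist d x L ^ p"
    unfolding real_cost_def using finC x(2)[symmetric] by (intro sum_bounded_above) auto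
  then have big: "real_cost d p C L / card C \<le> set_dist d x L ^ p" using n by (simp add: field_simps)
  have xV: "x \<in> V" using x C by blast
  have "\<exists>M. M \<subseteq> V \<and> x \<in> M \<and> card M \<le> k \<and> card (L - M) + card (M - L) \<le> 2 \<and> ctr ` (C - {x}) \<subseteq> M"
  proof (cases "card L < k")
    case True
    show ?thesis
    proof (intro exI[of _ "insert x L"] conjI)
      have "card (insert x L - L) \<le> card {x}" by (intro card_mono) auto
      moreover have "L - insert x L = {}" by blast
      then have "card (L - insert x L) = 0" by (metis card.empty)
      moreover have "card {x} = 1" by simp
      ultimately show "card (L - insert x L) + card (insert x L - L) \<le> 2" by linarith
      show "card (insert x L) \<le> k" using True finL by (simp add: card_insert_if)
    qed (use L xV ctr in auto)
  next
    case False
    have "card (ctr ` (C - {x})) \<le> card (C - {x})" using finC by (intro card_image_le) auto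
    also have "\<dots> < card L" using x finC nk False n by simp
    finally have lt: "card (ctr ` (C - {x})) < card L" .
    have "\<not> L \<subseteq> ctr ` (C - {x})"
    proof
      assume "L \<subseteq> ctr ` (C - {x})"
      then have "card L \<le> card (ctr ` (C - {x}))" using finC by (intro card_mono) auto
      then show False using lt by simp
    qed
    then obtain u where u: "u \<in> L" "u \<notin> ctr ` (C - {x})" by blast
    let ?M = "insert x (L - {u})"
    have "card ?M \<le> Suc (card (L - {u}))" using finL by (simp add: card_insert_if)
    also have "\<dots> = card L" by (rule card_Suc_Diff1[OF finL u(1)])
    finally have "card ?M \<le> k" using L by simp
    moreover have "card (L - ?M) \<le> card {u}" by (intro card_mono) auto
    moreover have "card (?M - L) \<le> card {x}" by (intro card_mono) auto
    ultimately have "card ?M \<le> k" "card (L - ?M) + card (?M - L) \<le> 2" by simp_all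
    then show ?thesis using L(1) xV ctr(1) u by (intro exI[of _ ?M] conjI) blast+
  qed
  then obtain M where M: "M \<subseteq> V" "x \<in> M" "card M \<le> k" "card (L - M) + card (M - L) \<le> 2" "ctr ` (C - {x}) \<subseteq> M"
    by blast
  have finM: "finite M" using M finV finite_subset by blast
  have nn: "0 \<le> set_dist d c M" if "c \<in> C" for c using that C M by (intro set_dist_nonneg) auto
  have "set_dist d x M \<le> 0" using set_dist_le[OF finM M(2), of d x] d_refl[OF xV] by simp
  then have x0: "set_dist d x M ^ p = 0" using nn[OF x(1)] p by (simp add: antisym)
  have "real_cost d p C M = (\<Sum>c\<in>C - {x}. set_dist d c M ^ p)"
    unfolding real_cost_def using x x0 finC by (simp add: sum.remove)
  also have "\<dots> \<le> (\<Sum>c\<in>C - {x}. set_dist d c L ^ p)"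
    using set_dist_le[OF finM, of "ctr _" d] M(5) ctr nn by (intro sum_mono power_mono) auto
  also have "\<dots> = real_cost d p C L - set_dist d x L ^ p"
    unfolding real_cost_def using x finC by (simp add: sum.remove)
  finally have 1: "real_cost d p C M \<le> real_cost d p C L - real_cost d p C L / card C" using big by linarith
  have "(1 - \<epsilon> / card C) * real_cost d p C L \<le> real_cost d p C M"
    using M s by (intro opt) auto
  then have "real_cost d p C L / card C \<le> \<epsilon> * (real_cost d p C L / card C)" using 1 by (simp add: algebra_simps)
  moreover have "0 < real_cost d p C L / card C" using pos n by simp
  then have "\<epsilon> * (real_cost d p C L / card C) < 1 * (real_cost d p C L / card C)"
    using \<epsilon> by (intro mult_strict_right_mono)
  ultimately show False by linarith
qed

lemma ratio_from_error:
  fixes \<epsilon> x y :: real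
  assumes \<epsilon>: "0 < \<epsilon>" "\<epsilon> < 1/2" and xy: "0 \<le> x" "0 \<le> y"
    and le: "(1 - \<epsilon> / 8) * x \<le> y + \<epsilon> / 8 * (x + y)"
  shows "x \<le> (1 + \<epsilon>) * y"
proof -
  have "(1 - \<epsilon> / 4) * x \<le> (1 + \<epsilon> / 8) * y" using le by (simp add: field_simps)
  also have "\<dots> \<le> ((1 - \<epsilon> / 4) * (1 + \<epsilon>)) * y"
  proof (intro mult_right_mono xy)
    have "\<epsilon> * \<epsilon> \<le> \<epsilon> * (1 / 2)" using \<epsilon> by (intro mult_left_mono) auto
    moreover have "(1 - \<epsilon> / 4) * (1 + \<epsilon>) = 1 + 3 / 4 * \<epsilon> - \<epsilon> * \<epsilon> / 4" by (simp add: field_simps)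
    ultimately show "1 + \<epsilon> / 8 \<le> (1 - \<epsilon> / 4) * (1 + \<epsilon>)" using \<epsilon> by linarith
  qed
  finally have "(1 - \<epsilon> / 4) * x \<le> (1 - \<epsilon> / 4) * ((1 + \<epsilon>) * y)" by (simp add: mult.assoc)
  then show ?thesis using \<epsilon> by simp
qed

end

text \<open>The first three estimates bound the errors of perturbation, stray clients and dropped
  centers, together by an \<epsilon>/8 share. The precision \<open>\<theta> / 96\<close> makes the
  slack of a division with at most \<open>2 * kb\<close> vertices equal to
  \<open>\<theta> * kb / 12\<close>, the number of dropped centers. The bound
  \<open>24 / \<theta>\<close> lets a graph too small for dropping be one region, and 80 limits the
  number of exchanges.\<close>

definition good_parameters :: "nat \<Rightarrow> nat \<Rightarrow> real \<Rightarrow> real \<Rightarrow> real \<Rightarrow> real \<Rightarrow> nat \<Rightarrow> bool" where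
  "good_parameters p h \<epsilon> \<sigma> \<delta> \<theta> r \<longleftrightarrow> 0 < \<sigma> \<and> \<sigma> \<le> 1 \<and> 0 < \<delta> \<and> \<delta> < 1/2 \<and> 0 < \<theta> \<and> \<theta> \<le> 1 \<and>
     2 * 4 ^ p * \<sigma> \<le> \<epsilon> / 32 \<and> (1 + 1 / \<sigma>) ^ p * (4 * \<delta> * 2 ^ p) \<le> \<epsilon> / 32 \<and>
     (1 + 1 / \<sigma>) ^ p * (\<theta> * (5 * 16 ^ p / \<delta>\<^sup>2)) \<le> \<epsilon> / 16 \<and>
     16 * real (h * (2 * h + 1)) / (\<theta> / 96) \<le> sqrt (real r) \<and> 24 / \<theta> \<le> r \<and> 80 \<le> r"

text \<open>Besides the case of few clients, small \<open>k\<close> is separate: all of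
  \<open>Op\<close> is then reachable in one exchange. What remains has
  \<open>2 * R < k < n\<close>.\<close>

lemma (in graph_metric) local_optimum_ratio:
  fixes \<epsilon> \<sigma> \<delta> \<theta> :: real
  assumes nominor: "\<not> has_clique_minor E V h" and h: "h > 0" and p: "p > 0"
    and gp: "good_parameters p h \<epsilon> \<sigma> \<delta> \<theta> r" and R: "R = (2 * r ^ 3 + 1) * r" and s: "4 * R \<le> s"
    and \<epsilon>: "0 < \<epsilon>" "\<epsilon> < 1/2" and C: "C \<subseteq> V"
    and L: "L \<subseteq> V" "L \<noteq> {}" "card L \<le> k" and Op: "Op \<subseteq> V" "Op \<noteq> {}" "card Op \<le> k" and k: "k \<le> card V"
    and opt: "\<And>M. M \<subseteq> V \<Longrightarrow> M \<noteq> {} \<Longrightarrow> card M \<le> k \<Longrightarrow> card (L - M) + card (M - L) \<le> s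
       \<Longrightarrow> (1 - \<epsilon> / card C) * real_cost d p C L \<le> real_cost d p C M"
  shows "real_cost d p C L \<le> (1 + \<epsilon>) * real_cost d p C Op"
proof -
  have par: "0 < \<sigma>" "\<sigma> \<le> 1" "0 < \<delta>" "\<delta> < 1/2" "0 < \<theta>" "\<theta> \<le> 1"
    "2 * 4 ^ p * \<sigma> \<le> \<epsilon> / 32" "(1 + 1 / \<sigma>) ^ p * (4 * \<delta> * 2 ^ p) \<le> \<epsilon> / 32"
    "(1 + 1 / \<sigma>) ^ p * (\<theta> * (5 * 16 ^ p / \<delta>\<^sup>2)) \<le> \<epsilon> / 16"
    "16 * real (h * (2 * h + 1)) / (\<theta> / 96) \<le> sqrt (real r)" "24 / \<theta> \<le> r" "80 \<le> r"
    using gp unfolding good_parameters_def by simp_all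
  have rR: "r \<le> R" unfolding R by simp
  have nnL: "0 \<le> real_cost d p C L" and nnO: "0 \<le> real_cost d p C Op"
    by (rule real_cost_nonneg[OF C L(1,2)], rule real_cost_nonneg[OF C Op(1,2)])
  have finL: "finite L" and finOp: "finite Op" using L Op finV finite_subset by auto
  have kpos: "k > 0" using L finL by (metis card_gt_0_iff gr_zeroI le_zero_eq)
  show ?thesis
  proof (cases "card C \<le> k")
    case True
    have "real_cost d p C L = 0"
      by (rule few_clients[OF C L p _ True _ opt]) (use \<epsilon> s par(12) rR in auto)
    then show ?thesis using nnO \<epsilon> by simp
  next
    case kn: False
    define n where "n = card C"
    define x where "x = real_cost d p C L"
    have n2: "n \<ge> 2" "k < n" using kn kpos by (auto simp: n_def)
    show ?thesis
    proof (cases "2 * k \<le> s")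
      case True
      have "card (L - Op) \<le> card L" "card (Op - L) \<le> card Op" using finL finOp by (auto intro: card_mono)
      then have "(1 - \<epsilon> / n) * x \<le> real_cost d p C Op"
        unfolding x_def n_def using True L Op by (intro opt) auto
      moreover have "(1 - \<epsilon> / 2) * x \<le> (1 - \<epsilon> / n) * x"
      proof (intro mult_right_mono)
        have "\<epsilon> / n \<le> \<epsilon> / 2" using n2 \<epsilon> by (intro divide_left_mono) auto
        then show "1 - \<epsilon> / 2 \<le> 1 - \<epsilon> / n" by simp
      qed (use nnL in \<open>simp add: x_def\<close>)
      moreover have "1 * real_cost d p C Op \<le> ((1 - \<epsilon> / 2) * (1 + \<epsilon>)) * real_cost d p C Op"
      proof (intro mult_right_mono nnO)
        have "\<epsilon> * \<epsilon> \<le> \<epsilon> * (1 / 2)" using \<epsilon> by (intro mult_left_mono) auto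
        moreover have "(1 - \<epsilon> / 2) * (1 + \<epsilon>) = 1 + \<epsilon> / 2 - \<epsilon> * \<epsilon> / 2" by (simp add: field_simps)
        ultimately show "1 \<le> (1 - \<epsilon> / 2) * (1 + \<epsilon>)" using \<epsilon> by linarith
      qed
      ultimately have "(1 - \<epsilon> / 2) * x \<le> (1 - \<epsilon> / 2) * ((1 + \<epsilon>) * real_cost d p C Op)" by (simp add: mult.assoc)
      then show ?thesis using \<epsilon> by (simp add: x_def)
    next
      case False
      then have kR: "2 * R < k" using s by linarith
      \<comment> \<open>Both sets are padded to size \<open>k\<close>, to compare counts. The padded
        optimum is no more expensive; for \<open>L\<close>, the padding serves only as a size
        allowance, because local optimality speaks of \<open>L\<close> itself.\<close>
      obtain Lp where Lp: "L \<subseteq> Lp" "Lp \<subseteq> V" "card Lp = k"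
        using exists_subset_between[OF L(3) k L(1) finV] by blast
      obtain Q where Q: "Op \<subseteq> Q" "Q \<subseteq> V" "card Q = k"
        using exists_subset_between[OF Op(3) k Op(1) finV] by blast
      have finLp: "finite Lp" and finQ: "finite Q" using Lp Q finV finite_subset by auto
      have Qne: "Q \<noteq> {}" using Q Op by blast
      have "\<exists>l. l \<in> L \<and> set_dist d c L = d c l" for c using set_dist_attained[OF finL L(2), of d c] by blast
      then obtain ctrL where cL: "\<And>c. ctrL c \<in> L" "\<And>c. set_dist d c L = d c (ctrL c)" by metis
      have "\<exists>l. l \<in> Q \<and> set_dist d c Q = d c l" for c using set_dist_attained[OF finQ Qne, of d c] by blast
      then obtain ctrO where cO: "\<And>c. ctrO c \<in> Q" "\<And>c. set_dist d c Q = d c (ctrO c)" by metis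
      interpret two_solutions V E d C L Q p ctrL ctrO \<delta>
        by unfold_locales (use C L Q p cL cO par in auto)
      define y where "y = real_cost d p C Q"
      have xs: "x = (\<Sum>c\<in>C. cl c ^ p)" unfolding x_def real_cost_def cl_def using cL by simp
      have ys: "y = (\<Sum>c\<in>C. co c ^ p)" unfolding y_def real_cost_def co_def using cO by simp
      have costs: "costs = x + y" by (simp add: costs_def xs ys sum.distrib)
      have nn: "0 \<le> x" "0 \<le> y" unfolding x_def y_def using real_cost_nonneg C L Q Qne by auto
      obtain g where g: "substitute g" using substitute_exists Q(3) kR rR par(12) by fastforce
      define kb where "kb = card (Q - isoO)"
      have isoOk: "card isoO \<le> k" using isoO_sub finQ Q(3) card_mono by metis
      have kb: "kb = k - card isoO" unfolding kb_def using isoO_sub finiso Q(3) by (simp add: card_Diff_subset)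
      have kbL: "card (Lp - isoL) = kb"
        using kb isoL_sub Lp finiso card_iso by (subst card_Diff_subset) auto
      define Z where "Z = \<theta> * (5 * 16 ^ p / \<delta>\<^sup>2 * costs)"
      have Z0: "0 \<le> Z" unfolding Z_def using par costs_nonneg by (intro mult_nonneg_nonneg) auto
      have "\<exists>A. A \<subseteq> Q - isoO \<and> (\<forall>f\<in>A. g f \<notin> A) \<and>
         (\<Sum>f\<in>A. real (card (VO f)) * d f (rep (g f)) ^ p) \<le> Z \<and> (\<theta> * kb < 12 \<or> \<theta> * kb / 12 \<le> card A)"
      \<comment> \<open>From 12 on, the rounding loss of 1 is at most half of
        \<open>\<theta> * kb / 6\<close>. Below, nothing is dropped and no boundary will be
        needed.\<close>
      proof (cases "\<theta> * kb < 12")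
        case True
        then show ?thesis using Z0 by (intro exI[of _ "{}"]) auto
      next
        case False
        obtain A where "A \<subseteq> Q - isoO" "\<And>f. f \<in> A \<Longrightarrow> g f \<notin> A" "\<theta> * card (Q - isoO) / 6 - 1 \<le> card A"
          "(\<Sum>f\<in>A. real (card (VO f)) * d f (rep (g f)) ^ p) \<le> \<theta> * (5 * 16 ^ p / \<delta>\<^sup>2 * costs)"
          using cheap_removal[OF g _ par(5,6)] L(3) Q(3) by auto
        then show ?thesis using False by (intro exI[of _ A]) (auto simp: Z_def kb_def)
      qed
      then obtain A where A: "A \<subseteq> Q - isoO" "\<And>f. f \<in> A \<Longrightarrow> g f \<notin> A"
        "(\<Sum>f\<in>A. real (card (VO f)) * d f (rep (g f)) ^ p) \<le> Z" "\<theta> * kb < 12 \<or> \<theta> * kb / 12 \<le> card A" by blast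
      have finA: "finite A" using A(1) finQ finite_subset by blast
      define N where "N = Q - isoO - A \<union> isoL"
      define F where "F = Lp \<union> N - isoL"
      have NV: "N \<subseteq> V" using Q isoL_sub L by (auto simp: N_def)
      have Nne: "N \<noteq> {}"
      proof (cases "isoL = {}")
        case True
        then have i0: "isoO = {}" using card_iso finiso by simp
        obtain f where f: "f \<in> Q" using Qne by blast
        then have "f \<in> N \<or> g f \<in> N" using A(2) g i0 unfolding N_def substitute_def by blast
        then show ?thesis by blast
      qed (auto simp: N_def)
      have finF: "finite F" using Lp NV finV finite_subset by (metis F_def Diff_subset Un_least order_trans)
      have LF: "card (Lp \<inter> F) = kb"
      proof -
        have "Lp \<inter> F = Lp - isoL" by (auto simp: F_def)
        then show ?thesis using kbL by simp
      qed
      have NF: "card (N \<inter> F) + card A \<le> kb"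
      proof -
        have "card (N \<inter> F) \<le> card (Q - isoO - A)" using finQ by (intro card_mono) (auto simp: N_def F_def)
        also have "\<dots> = kb - card A" unfolding kb_def using A(1) finA by (simp add: card_Diff_subset)
        finally show ?thesis using card_mono[OF _ A(1)] finQ by (simp add: kb_def)
      qed
      have cF: "card F \<le> 2 * kb"
      proof -
        have "F \<subseteq> (Lp \<inter> F) \<union> (N \<inter> F)" by (auto simp: F_def)
        then have "card F \<le> card ((Lp \<inter> F) \<union> (N \<inter> F))" using finF by (intro card_mono) auto
        also have "\<dots> \<le> card (Lp \<inter> F) + card (N \<inter> F)" by (rule card_Un_le)
        finally show ?thesis using LF NF by linarith
      qed
      have R0: "R > 0" "real R \<ge> 80" using rR par(12) by auto
      have fam: "\<exists>(\<G>::nat set set) P B. balanced_family U (Lp \<union> N - isoL) Lp N (2 * R) \<G> P B \<and>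
          real (card \<G>) \<le> 4 * real k / R + 1"
        if U: "sym U" "\<not> has_clique_minor U (Lp \<union> N - isoL) h" for U
      proof (cases "\<theta> * kb < 12")
        case True
        have "real kb < 12 / \<theta>" using True par by (simp add: field_simps)
        then have "2 * real kb < real r" using par(11) by simp
        then have "card F \<le> 2 * R" using cF rR by linarith
        \<comment> \<open>The whole graph is one region without boundary, hence balanced by
          \<open>LF\<close> and \<open>NF\<close>; the single index is the empty set.\<close>
        then have "balanced_family U F Lp N (2 * R) {{}} (\<lambda>_::nat set. F) (\<lambda>_. {})"
          using LF NF by (auto simp: balanced_family_def surplus_def)
        moreover have "real (card {{}::nat set}) \<le> 4 * real k / R + 1" by simp
        ultimately show ?thesis unfolding F_def by blast
      next
        case False
        have "real (card (N \<inter> F)) + 4 * (\<theta> / 96) * card F \<le> real (card (Lp \<inter> F))"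
        proof -
          have "\<theta> / 24 * real (card F) \<le> \<theta> / 24 * (2 * kb)" using cF par by (intro mult_left_mono) linarith+
          also have "\<dots> \<le> card A" using A(4) False by simp
          finally show ?thesis using NF LF by simp
        qed
        moreover have "0 < \<theta> / 96" "\<theta> / 96 \<le> 1" "0 < r" using par by auto
        ultimately obtain \<G> :: "nat set set" and P B where
          "balanced_family U F Lp N (2 * R) \<G> P B" "card \<G> * R \<le> 2 * card F + R"
          using balanced_family_exists[OF U(1) U(2)[folded F_def] finF h _ _ par(10) _ R] by blast
        moreover from this(2) have "card \<G> * R \<le> 4 * k + R" using cF kb by linarith
        then have "real (card \<G>) * R \<le> 4 * real k + R" by (metis of_nat_add of_nat_le_iff of_nat_mult of_nat_numeral)
        then have "real (card \<G>) \<le> 4 * real k / R + 1" using R0 by (simp add: field_simps)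
        ultimately show ?thesis unfolding F_def by blast
      qed
      define e where "e = \<epsilon> / n"
      have e0: "e \<ge> 0" using \<epsilon> by (simp add: e_def)
      have "(1 - (4 * real k / R + 1) * e) * x \<le> real_cost d p C N"
        unfolding x_def
      proof (rule exchange_family[where T = "2 * R", OF nominor C Lp(1,2) L(2) NV Nne isoL_sub _ fam _ e0])
        show "isoL \<subseteq> N" by (auto simp: N_def)
        show "(1 - e) * real_cost d p C L \<le> real_cost d p C M"
          if "M \<subseteq> V" "M \<noteq> {}" "card M \<le> card Lp" "card (L - M) + card (M - L) \<le> 2 * (2 * R)" for M
          unfolding e_def n_def using that Lp(3) s by (intro opt) auto
      qed
      also have "\<dots> \<le> (\<Sum>c\<in>C. reduced_bound A g c ^ p)" unfolding N_def by (rule reduced_solution_cost[OF g A(1,2)])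
      finally have b: "(1 - (4 * real k / R + 1) * e) * x \<le> (\<Sum>c\<in>C. reduced_bound A g c ^ p)" .
      have a: "- ((real k / R + 1) * e * x) \<le> (\<Sum>c\<in>C. if ctrL c \<in> isoL then isolated_bound c ^ p - cl c ^ p else 0)"
        unfolding x_def
      proof (rule isolated_exchanges[OF _ L(2) _ e0 R0(1)])
        show "set_dist d c L = cl c" for c using cL(2) by (simp add: cl_def)
        show "(1 - e) * real_cost d p C L \<le> real_cost d p C M"
          if "M \<subseteq> V" "M \<noteq> {}" "card M \<le> card L" "card (L - M) + card (M - L) \<le> 4 * R" for M
          unfolding e_def n_def using that L(3) s by (intro opt) auto
        show "real (card isoO) / R + 1 \<le> real k / R + 1" using isoOk by (simp add: divide_right_mono)
      qed
      have err: "(1 - (5 * real k / R + 2) * e) * x \<le> y + 2 * 4 ^ p * \<sigma> * costs + (1 + 1 / \<sigma>) ^ p * (4 * \<delta> * 2 ^ p * costs + Z)"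
      proof -
        have "5 * real k / R = 4 * real k / R + real k / R" by (simp add: add_divide_distrib[symmetric])
        then have "(1 - (5 * real k / R + 2) * e) * x
            = (1 - (4 * real k / R + 1) * e) * x + - ((real k / R + 1) * e * x)"
          by (simp only:) (simp add: algebra_simps)
        then show ?thesis using a b exchanges_error[OF g A(1) par(1,2) A(3)] unfolding ys by linarith
      qed
      have "2 * 4 ^ p * \<sigma> * costs + (1 + 1 / \<sigma>) ^ p * (4 * \<delta> * 2 ^ p * costs + Z) \<le> \<epsilon> / 8 * costs"
      proof -
        have "2 * 4 ^ p * \<sigma> * costs \<le> \<epsilon> / 32 * costs" by (rule mult_right_mono[OF par(7) costs_nonneg])
        moreover have "(1 + 1 / \<sigma>) ^ p * (4 * \<delta> * 2 ^ p) * costs \<le> \<epsilon> / 32 * costs" by (rule mult_right_mono[OF par(8) costs_nonneg])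
        moreover have "(1 + 1 / \<sigma>) ^ p * (\<theta> * (5 * 16 ^ p / \<delta>\<^sup>2)) * costs \<le> \<epsilon> / 16 * costs" by (rule mult_right_mono[OF par(9) costs_nonneg])
        moreover have "(1 + 1 / \<sigma>) ^ p * (4 * \<delta> * 2 ^ p * costs + Z)
           = (1 + 1 / \<sigma>) ^ p * (4 * \<delta> * 2 ^ p) * costs + (1 + 1 / \<sigma>) ^ p * (\<theta> * (5 * 16 ^ p / \<delta>\<^sup>2)) * costs"
          by (simp add: Z_def distrib_left mult.assoc)
        moreover have "\<epsilon> / 32 * costs + \<epsilon> / 32 * costs + \<epsilon> / 16 * costs = \<epsilon> / 8 * costs" by (simp add: field_simps)
        ultimately show ?thesis by linarith
      qed
      moreover have "(1 - \<epsilon> / 8) * x \<le> (1 - (5 * real k / R + 2) * e) * x"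
      proof (intro mult_right_mono nn)
        \<comment> \<open>The exchanges number at most \<open>4 * k / R + 1\<close> along regions
          and \<open>k / R + 1\<close> for isolated pairs. With \<open>k < n\<close> and
          \<open>R \<ge> 80\<close>, losing an \<epsilon>/n share each time costs at most an
          \<epsilon>/8 share.\<close>
        have "5 * real k / R \<le> 5 * real n / 80" using R0 n2 by (intro frac_le) auto
        moreover have "2 \<le> real n / 16" using kR n2 R0 by linarith
        ultimately have "5 * real k / R + 2 \<le> real n / 8" by linarith
        then have "(5 * real k / R + 2) * e \<le> real n / 8 * e" using e0 by (rule mult_right_mono)
        then show "1 - \<epsilon> / 8 \<le> 1 - (5 * real k / R + 2) * e" using n2 by (simp add: e_def)
      qed
      ultimately have "(1 - \<epsilon> / 8) * x \<le> y + \<epsilon> / 8 * costs" using err by linarith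
      then have "(1 - \<epsilon> / 8) * x \<le> y + \<epsilon> / 8 * (x + y)" by (simp only: costs)
      then have "x \<le> (1 + \<epsilon>) * y" by (rule ratio_from_error[OF \<epsilon> nn])
      also have "\<dots> \<le> (1 + \<epsilon>) * real_cost d p C Op"
        unfolding y_def using \<epsilon> by (intro mult_left_mono real_cost_mono C Q(1,2) Op(2)) auto
      finally show ?thesis by (simp add: x_def)
    qed
  qed
qed

section \<open>Choice of the parameters\<close>

text \<open>As \<epsilon> is below 1/2, constants depending on the family and on \<open>p\<close>
  turn into powers of \<epsilon>, so an exponent alone can describe the neighborhood size.\<close>

lemma power_absorbs_constant:
  fixes K :: real
  shows "\<exists>a::nat. \<forall>\<epsilon>. 0 < \<epsilon> \<and> \<epsilon> < 1/2 \<longrightarrow> K * \<epsilon> ^ a \<le> 1"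
proof -
  obtain a :: nat where a: "K < 2 ^ a" using real_arch_pow[of 2 K] by auto
  have "K * \<epsilon> ^ a \<le> 1" if "0 < \<epsilon>" "\<epsilon> < 1/2" for \<epsilon> :: real
  proof -
    have "K * \<epsilon> ^ a \<le> 2 ^ a * \<epsilon> ^ a" using a that by (intro mult_right_mono) auto
    also have "\<dots> = (2 * \<epsilon>) ^ a" by (simp add: power_mult_distrib)
    also have "\<dots> \<le> 1" using that by (intro power_le_one) auto
    finally show ?thesis .
  qed
  then show ?thesis by blast
qed

lemma good_parameters_exist:
  assumes "h > 0"
  shows "\<exists>c::nat. c > 0 \<and> (\<forall>\<epsilon>::real. 0 < \<epsilon> \<and> \<epsilon> < 1/2 \<longrightarrow>
     (\<exists>\<sigma> \<delta> \<theta> r. good_parameters p h \<epsilon> \<sigma> \<delta> \<theta> r \<and> real (4 * ((2 * r ^ 3 + 1) * r)) \<le> (1 / \<epsilon>) ^ c))"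
proof -
  define \<kappa> where "\<kappa> = real (h * (2 * h + 1))"
  have \<kappa>: "\<kappa> \<ge> 1" unfolding \<kappa>_def using assms
    by (metis One_nat_def Suc_leI add_gr_0 mult_pos_pos of_nat_1 of_nat_le_iff zero_less_one)
  obtain a1 :: nat where a1: "\<And>\<epsilon>::real. 0 < \<epsilon> \<Longrightarrow> \<epsilon> < 1/2 \<Longrightarrow> 64 * 4 ^ p * \<epsilon> ^ a1 \<le> 1"
    using power_absorbs_constant[of "64 * 4 ^ p"] by blast
  obtain a2 :: nat where a2: "\<And>\<epsilon>::real. 0 < \<epsilon> \<Longrightarrow> \<epsilon> < 1/2 \<Longrightarrow> 128 * 4 ^ p * \<epsilon> ^ a2 \<le> 1"
    using power_absorbs_constant[of "128 * 4 ^ p"] by blast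
  obtain a3 :: nat where a3: "\<And>\<epsilon>::real. 0 < \<epsilon> \<Longrightarrow> \<epsilon> < 1/2 \<Longrightarrow> 80 * 32 ^ p * \<epsilon> ^ a3 \<le> 1"
    using power_absorbs_constant[of "80 * 32 ^ p"] by blast
  \<comment> \<open>\<open>1536\<close> is \<open>16 * 96\<close>, from the precision
    \<open>\<theta> / 96\<close> of the division; \<open>81\<close> is the 80 added to
    \<open>r\<close> and 1 for rounding up.\<close>
  define K where "K = (1536 * \<kappa>)\<^sup>2 + 81"
  obtain a4 :: nat where a4: "\<And>\<epsilon>::real. 0 < \<epsilon> \<Longrightarrow> \<epsilon> < 1/2 \<Longrightarrow> 12 * K ^ 4 * \<epsilon> ^ a4 \<le> 1"
    using power_absorbs_constant[of "12 * K ^ 4"] by blast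
  \<comment> \<open>\<epsilon> to the power \<open>w\<close> equals \<sigma> to the power
    \<open>p\<close> and offsets the factor \<open>(1 + 1 / \<sigma>) ^ p\<close>. The
    \<open>2 * b\<close> in \<open>t\<close> offsets the division by the square of \<delta>, and
    \<open>8 * t\<close> in \<open>c\<close> stems from \<open>r ^ 4\<close> with \<open>r\<close>
    of the order of \<theta> to the power -2.\<close>
  define w where "w = (a1 + 1) * p"
  define b where "b = a2 + w + 1"
  define t where "t = a3 + w + 2 * b + 1"
  define c where "c = 8 * t + a4"
  have main: "\<exists>\<sigma> \<delta> \<theta> r. good_parameters p h \<epsilon> \<sigma> \<delta> \<theta> r \<and> real (4 * ((2 * r ^ 3 + 1) * r)) \<le> (1 / \<epsilon>) ^ c"
    if e: "0 < \<epsilon>" "\<epsilon> < 1/2" for \<epsilon> :: real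
  proof -
    define \<sigma> \<delta> \<theta> where "\<sigma> = \<epsilon> ^ (a1 + 1)" and "\<delta> = \<epsilon> ^ b" and "\<theta> = \<epsilon> ^ t"
    define r where "r = nat \<lceil>(1536 * \<kappa> / \<theta>)\<^sup>2\<rceil> + 80"
    have pos: "0 < \<sigma>" "0 < \<delta>" "0 < \<theta>" using e by (auto simp: \<sigma>_def \<delta>_def \<theta>_def)
    have le1: "\<epsilon> ^ m \<le> 1" for m using e by (intro power_le_one) auto
    have \<sigma>1: "\<sigma> \<le> 1" and \<theta>1: "\<theta> \<le> 1" unfolding \<sigma>_def \<theta>_def by (rule le1)+
    have "\<delta> = \<epsilon> * \<epsilon> ^ (a2 + w)" by (simp add: \<delta>_def b_def)
    also have "\<dots> \<le> \<epsilon> * 1" using e le1 by (intro mult_left_mono) auto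
    finally have \<delta>2: "\<delta> < 1/2" using e by simp
    have c1: "2 * 4 ^ p * \<sigma> \<le> \<epsilon> / 32"
      using mult_left_mono[OF a1[OF e], of \<epsilon>] e by (simp add: \<sigma>_def algebra_simps)
    have W: "(1 + 1 / \<sigma>) ^ p * \<epsilon> ^ w \<le> 2 ^ p"
    proof -
      have "(1 + 1 / \<sigma>) ^ p * \<epsilon> ^ w = ((1 + 1 / \<sigma>) * \<sigma>) ^ p"
        by (simp only: \<sigma>_def w_def power_mult power_mult_distrib)
      also have "(1 + 1 / \<sigma>) * \<sigma> = \<sigma> + 1" using pos by (simp add: field_simps)
      also have "(\<sigma> + 1) ^ p \<le> 2 ^ p" using \<sigma>1 pos by (intro power_mono) auto
      finally show ?thesis .
    qed
    have c2: "(1 + 1 / \<sigma>) ^ p * (4 * \<delta> * 2 ^ p) \<le> \<epsilon> / 32"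
    proof -
      have "(1 + 1 / \<sigma>) ^ p * (4 * \<delta> * 2 ^ p) = ((1 + 1 / \<sigma>) ^ p * \<epsilon> ^ w) * (4 * 2 ^ p * \<epsilon> ^ a2 * \<epsilon>)"
        by (simp add: \<delta>_def b_def power_add algebra_simps)
      also have "\<dots> \<le> 2 ^ p * (4 * 2 ^ p * \<epsilon> ^ a2 * \<epsilon>)" using W e by (intro mult_right_mono) auto
      also have "\<dots> = (128 * 4 ^ p * \<epsilon> ^ a2) * (\<epsilon> / 32)"
        by (simp add: algebra_simps flip: power_mult_distrib)
      also have "\<dots> \<le> 1 * (\<epsilon> / 32)" using a2[OF e] e by (intro mult_right_mono) auto
      finally show ?thesis by simp
    qed
    have c3: "(1 + 1 / \<sigma>) ^ p * (\<theta> * (5 * 16 ^ p / \<delta>\<^sup>2)) \<le> \<epsilon> / 16"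
    proof -
      have "\<theta> = \<epsilon> ^ a3 * \<epsilon> ^ w * \<delta>\<^sup>2 * \<epsilon>"
        by (simp add: \<theta>_def t_def \<delta>_def power_add power_mult[symmetric] mult.commute)
      then have "(1 + 1 / \<sigma>) ^ p * (\<theta> * (5 * 16 ^ p / \<delta>\<^sup>2)) = ((1 + 1 / \<sigma>) ^ p * \<epsilon> ^ w) * (5 * 16 ^ p * \<epsilon> ^ a3 * \<epsilon>)"
        using pos by (simp add: algebra_simps)
      also have "\<dots> \<le> 2 ^ p * (5 * 16 ^ p * \<epsilon> ^ a3 * \<epsilon>)" using W e by (intro mult_right_mono) auto
      also have "\<dots> = (80 * 32 ^ p * \<epsilon> ^ a3) * (\<epsilon> / 16)"
        by (simp add: algebra_simps flip: power_mult_distrib)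
      also have "\<dots> \<le> 1 * (\<epsilon> / 16)" using a3[OF e] e by (intro mult_right_mono) auto
      finally show ?thesis by simp
    qed
    have rlow: "(1536 * \<kappa> / \<theta>)\<^sup>2 \<le> real r" unfolding r_def by linarith
    have q0: "0 \<le> 1536 * \<kappa> / \<theta>" using \<kappa> pos by simp
    have c4: "16 * real (h * (2 * h + 1)) / (\<theta> / 96) \<le> sqrt (real r)"
    proof -
      have "1536 * \<kappa> / \<theta> \<le> sqrt (real r)" using rlow by (rule real_le_rsqrt)
      then show ?thesis by (simp add: \<kappa>_def algebra_simps)
    qed
    have c5: "24 / \<theta> \<le> real r"
    proof -
      have "24 / \<theta> \<le> 1536 * \<kappa> / \<theta>" using \<kappa> pos by (intro divide_right_mono) auto
      moreover have "1 \<le> 1536 * \<kappa> / \<theta>" using \<kappa> pos \<theta>1 by (simp add: field_simps)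
      then have "1536 * \<kappa> / \<theta> \<le> (1536 * \<kappa> / \<theta>)\<^sup>2" by (rule self_le_power) simp
      ultimately show ?thesis using rlow by linarith
    qed
    have rup: "real r \<le> K / \<theta>\<^sup>2"
    proof -
      have "real r \<le> (1536 * \<kappa> / \<theta>)\<^sup>2 + 81" unfolding r_def using zero_le_power2[of "1536 * \<kappa> / \<theta>"] by linarith
      also have "\<dots> \<le> (1536 * \<kappa>)\<^sup>2 / \<theta>\<^sup>2 + 81 / \<theta>\<^sup>2"
        using pos \<theta>1 by (intro add_mono) (auto simp: power_divide field_simps power_le_one)
      also have "\<dots> = K / \<theta>\<^sup>2" by (simp add: K_def add_divide_distrib)
      finally show ?thesis .
    qed
    have "real (4 * ((2 * r ^ 3 + 1) * r)) \<le> 12 * real r ^ 4"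
    proof -
      have "1 \<le> r ^ 3" by (simp add: r_def)
      then have "4 * ((2 * r ^ 3 + 1) * r) \<le> 4 * ((3 * r ^ 3) * r)" by simp
      also have "\<dots> = 12 * r ^ 4" by (simp add: power_numeral_reduce)
      finally show ?thesis by (metis of_nat_le_iff of_nat_mult of_nat_numeral of_nat_power)
    qed
    also have "\<dots> \<le> 12 * (K / \<theta>\<^sup>2) ^ 4" using rup by (intro mult_left_mono power_mono) auto
    also have "\<dots> = 12 * K ^ 4 / \<epsilon> ^ (8 * t)"
      by (simp add: \<theta>_def power_divide power_mult[symmetric] mult.commute)
    also have "\<dots> \<le> (1 / \<epsilon> ^ a4) / \<epsilon> ^ (8 * t)"
      using a4[OF e] e by (intro divide_right_mono) (auto simp: field_simps)
    also have "\<dots> = (1 / \<epsilon>) ^ c" by (simp add: c_def power_add power_divide mult.commute)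
    finally have "real (4 * ((2 * r ^ 3 + 1) * r)) \<le> (1 / \<epsilon>) ^ c" .
    moreover have "good_parameters p h \<epsilon> \<sigma> \<delta> \<theta> r"
      unfolding good_parameters_def using pos \<sigma>1 \<theta>1 \<delta>2 c1 c2 c3 c4 c5 by (simp add: r_def)
    ultimately show ?thesis by blast
  qed
  have "c > 0" by (simp add: c_def t_def)
  then show ?thesis using main by blast
qed

section \<open>Shortest paths in weighted graphs\<close>

lemma conn_imp_connected:
  assumes "pair_graph G" "S \<subseteq> pverts G" "conn (parcs G) S"
  shows "Digraph_Component.connected (with_proj G \<restriction> S)"
proof -
  interpret pair_graph G by (rule assms)
  let ?H = "with_proj G \<restriction> S"
  have v: "verts ?H = S" by simp
  have a: "parcs G \<inter> S \<times> S \<subseteq> (arcs_ends ?H)\<^sup>s"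
    by (force simp: arcs_ends_def arc_to_ends_def symcl_def)
  have "(x, y) \<in> rtrancl_on S ((arcs_ends ?H)\<^sup>s)" if "x \<in> S" "y \<in> S" for x y
  proof -
    have "(x, y) \<in> (parcs G \<inter> S \<times> S)\<^sup>*" using assms(3) that by (simp add: conn_def)
    then show ?thesis
    proof (induction rule: rtrancl_induct)
      case base
      then show ?case using that by simp
    next
      case (step y z)
      have "(y, z) \<in> (arcs_ends ?H)\<^sup>s" "z \<in> S" using subsetD[OF a step.hyps(2)] step.hyps(2) by auto
      with step.IH show ?case by (rule rtrancl_on_into_rtrancl_on)
    qed
  qed
  then show ?thesis using conn_nonempty[OF assms(3)] unfolding connected_conv v by blast
qed

text \<open>A clique on as many vertices contains \<open>H\<close>: any bijection from the vertices
  of \<open>H\<close> to the branch sets works, since arcs of \<open>H\<close> join distinct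
  vertices.\<close>

lemma clique_minor_imp_is_minor:
  assumes G: "pair_graph G" and H: "pair_graph H"
    and minor: "has_clique_minor (parcs G) (pverts G) (card (pverts H))"
  shows "is_minor H G"
proof -
  interpret H: pair_graph H by (rule H)
  obtain \<C> where C: "clique_model (parcs G) (pverts G) \<C>" "card \<C> = card (pverts H)"
    using minor by (auto simp: has_clique_minor_def)
  have "finite \<C>" using C by (simp add: clique_model_def)
  then obtain B where B: "bij_betw B (pverts H) \<C>"
    using C(2) H.pair_finite_verts finite_same_card_bij by metis
  have BC: "B x \<in> \<C>" if "x \<in> pverts H" for x using B that by (auto simp: bij_betw_def)
  have Binj: "B x \<noteq> B y" if "x \<in> pverts H" "y \<in> pverts H" "x \<noteq> y" for x y
    using B that by (auto simp: bij_betw_def inj_on_def)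
  have C1: "D \<subseteq> pverts G" "conn (parcs G) D" if "D \<in> \<C>" for D
    using C(1) that by (simp_all add: clique_model_def)
  have C2: "D \<inter> D' = {}" "\<exists>u\<in>D. \<exists>v\<in>D'. (u, v) \<in> parcs G" if "D \<in> \<C>" "D' \<in> \<C>" "D \<noteq> D'" for D D'
    using C(1) that unfolding clique_model_def by simp_all
  show ?thesis
    unfolding is_minor_def
  proof (intro exI[of _ B] conjI ballI impI)
    fix x assume x: "x \<in> pverts H"
    show "B x \<subseteq> pverts G" by (rule C1(1)[OF BC[OF x]])
    then show "Digraph_Component.connected (with_proj G \<restriction> B x)"
      using conn_imp_connected[OF G] C1(2)[OF BC[OF x]] by blast
    show "B x \<inter> B y = {}" if "y \<in> pverts H" "x \<noteq> y" for y
      by (rule C2(1)[OF BC[OF x] BC[OF that(1)] Binj[OF x that]])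
  next
    fix e assume e: "e \<in> parcs H"
    obtain x y where xy: "e = (x, y)" by (cases e)
    have H': "x \<in> pverts H" "y \<in> pverts H" "x \<noteq> y"
      using H.arc_fst_in_verts[OF e] H.arc_snd_in_verts[OF e] H.pair_no_loops[OF e] xy by auto
    have "\<exists>u\<in>B x. \<exists>v\<in>B y. (u, v) \<in> parcs G"
      by (rule C2(2)[OF BC[OF H'(1)] BC[OF H'(2)] Binj[OF H']])
    then show "case e of (x, y) \<Rightarrow> \<exists>u\<in>B x. \<exists>v\<in>B y. (u, v) \<in> parcs G" using xy by simp
  qed
qed

locale weighted_graph = pair_graph G for G :: "'v pair_pre_digraph" +
  fixes w :: "('v \<times> 'v) weight_fun"
  assumes w_nonneg: "\<And>e. e \<in> parcs G \<Longrightarrow> 0 \<le> w e" and w_sym: "\<And>u v. (u, v) \<in> parcs G \<Longrightarrow> w (u, v) = w (v, u)"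
begin

abbreviation "D \<equiv> graph_dist (G, w)"

lemma D_eq: "D u v = \<mu> w u v" by (simp add: graph_dist_def)

lemma D_le_walk: "awalk u q v \<Longrightarrow> D u v \<le> ereal (awalk_cost w q)"
  unfolding D_eq by (rule min_cost_le_walk_cost)

lemma D_attained:
  assumes "D u v \<noteq> \<infinity>"
  obtains q where "awalk u q v" "D u v = ereal (awalk_cost w q)"
proof -
  have "u \<rightarrow>\<^sup>*\<^bsub>with_proj G\<^esub> v" using assms \<mu>_reach_conv[of w u v] by (simp add: D_eq less_top[symmetric] top_ereal_def)
  from min_cost_awalk[OF this, of w] w_nonneg obtain q where "apath u q v" "\<mu> w u v = ereal (awalk_cost w q)"
    by auto
  then show ?thesis using that by (auto simp: D_eq apath_def)
qed

lemma walk_cost_nonneg: "awalk u q v \<Longrightarrow> 0 \<le> awalk_cost w q"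
  by (rule pos_cost_pos_awalk_cost[where c = w]) (use w_nonneg in auto)

lemma D_nonneg: "0 \<le> D u v"
proof (cases "D u v = \<infinity>")
  case False
  then obtain q where "awalk u q v" "D u v = ereal (awalk_cost w q)" by (rule D_attained)
  then show ?thesis using walk_cost_nonneg by simp
qed simp

lemma D_refl: "u \<in> pverts G \<Longrightarrow> D u u = 0"
  using D_le_walk[of u "[]" u] D_nonneg[of u u] by (simp add: awalk_Nil_iff zero_ereal_def[symmetric] antisym)

lemma D_triangle: "D x z \<le> D x y + D y z"
proof (cases "D x y = \<infinity> \<or> D y z = \<infinity>")
  case True
  then show ?thesis using D_nonneg[of x y] D_nonneg[of y z] by auto
next
  case False
  obtain q where q: "awalk x q y" "D x y = ereal (awalk_cost w q)" using D_attained[of x y] False by blast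
  obtain q' where q': "awalk y q' z" "D y z = ereal (awalk_cost w q')" using D_attained[of y z] False by blast
  have "awalk x (q @ q') z" using q(1) q'(1) by (rule awalk_appendI)
  then show ?thesis using D_le_walk[of x "q @ q'" z] q(2) q'(2) by simp
qed

lemma arc_swap: "(u, v) \<in> parcs G \<Longrightarrow> (v, u) \<in> parcs G"
  using pair_sym_arcs by (auto simp: symmetric_def sym_def)

lemma walk_rev: "awalk u q v \<Longrightarrow> \<exists>q'. awalk v q' u \<and> awalk_cost w q' = awalk_cost w q"
proof (induction q arbitrary: u)
  case Nil
  then show ?case by (intro exI[of _ "[]"]) (auto simp: awalk_Nil_iff)
next
  case (Cons e q)
  obtain x y where e: "e = (x, y)" by (cases e)
  have 1: "(x, y) \<in> parcs G" "u = x" "awalk y q v" using Cons.prems e by (auto simp: awalk_Cons_iff)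
  obtain q' where q': "awalk v q' y" "awalk_cost w q' = awalk_cost w q" using Cons.IH[OF 1(3)] by blast
  have "awalk y [(y, x)] x"
    using arc_swap[OF 1(1)] arc_snd_in_verts[OF arc_swap[OF 1(1)]] by (auto simp: awalk_Cons_iff awalk_Nil_iff)
  then have "awalk v (q' @ [(y, x)]) x" using q'(1) awalk_appendI by blast
  then show ?case using q'(2) w_sym[OF 1(1)] 1(2) e by (intro exI[of _ "q' @ [(y, x)]"]) auto
qed

lemma D_sym: "D u v = D v u"
proof -
  have "D v u \<le> D u v" for u v
  proof (cases "D u v = \<infinity>")
    case False
    obtain q where q: "awalk u q v" "D u v = ereal (awalk_cost w q)" using D_attained[OF False] by blast
    obtain q' where "awalk v q' u" "awalk_cost w q' = awalk_cost w q" using walk_rev[OF q(1)] by blast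
    then show ?thesis using D_le_walk[of v q' u] q(2) by simp
  qed simp
  then show ?thesis by (simp add: antisym)
qed

text \<open>The rest of a shortest walk is again shortest. Finiteness is recorded with each arc,
  because the inequality holds trivially at \<infinity> and would not transfer to real
  distances.\<close>

lemma shortest_walk_tight:
  assumes "awalk u q v" "D u v = ereal (awalk_cost w q)"
  shows "(u, v) \<in> {(y, z) \<in> parcs G. D y z + D z v \<le> D y v \<and> D y v \<noteq> \<infinity>}\<^sup>*"
  using assms
proof (induction q arbitrary: u)
  case Nil
  then show ?case by (simp add: awalk_Nil_iff)
next
  case (Cons e q)
  obtain x y where e: "e = (x, y)" by (cases e)
  have 1: "(x, y) \<in> parcs G" "u = x" "awalk y q v" using Cons.prems e by (auto simp: awalk_Cons_iff)
  have "awalk x [(x, y)] y" using 1(1) arc_snd_in_verts[OF 1(1)] by (auto simp: awalk_Cons_iff awalk_Nil_iff)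
  from D_le_walk[OF this] have xy: "D x y \<le> ereal (w (x, y))" by simp
  have yv: "D y v \<le> ereal (awalk_cost w q)" by (rule D_le_walk[OF 1(3)])
  have xv: "D x v = ereal (w (x, y) + awalk_cost w q)" using Cons.prems(2) 1(2) e by simp
  have tri: "D x v \<le> D x y + D y v" by (rule D_triangle)
  obtain a where a: "D x y = ereal a" using xy D_nonneg[of x y] by (cases "D x y") auto
  obtain b where b: "D y v = ereal b" using yv D_nonneg[of y v] by (cases "D y v") auto
  have "a \<le> w (x, y)" "b \<le> awalk_cost w q" "w (x, y) + awalk_cost w q \<le> a + b"
    using xy yv tri xv a b by auto
  then have "b = awalk_cost w q" "a + b \<le> w (x, y) + awalk_cost w q" by linarith+
  then have "(y, v) \<in> {(y, z) \<in> parcs G. D y z + D z v \<le> D y v \<and> D y v \<noteq> \<infinity>}\<^sup>*"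
    and "(x, y) \<in> {(y, z) \<in> parcs G. D y z + D z v \<le> D y v \<and> D y v \<noteq> \<infinity>}"
    using Cons.IH[OF 1(3)] b a xv 1(1) by auto
  then show ?case unfolding 1(2) by (rule converse_rtrancl_into_rtrancl[rotated])
qed

section \<open>Truncation of infinite distances\<close>

definition "trunc B x y = (if D x y = \<infinity> then B else real_of_ereal (D x y))"

definition "bound B \<longleftrightarrow> 0 \<le> B \<and> (\<forall>x\<in>pverts G. \<forall>y\<in>pverts G. D x y \<noteq> \<infinity> \<longrightarrow> D x y \<le> ereal B)"

lemma real_D: "D x y \<noteq> \<infinity> \<Longrightarrow> ereal (real_of_ereal (D x y)) = D x y"
  using D_nonneg[of x y] by (cases "D x y") auto

lemma trunc_nonneg: "0 \<le> B \<Longrightarrow> 0 \<le> trunc B x y"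
  using D_nonneg[of x y] by (simp add: trunc_def real_of_ereal_pos)

lemma trunc_le: "bound B \<Longrightarrow> x \<in> pverts G \<Longrightarrow> y \<in> pverts G \<Longrightarrow> trunc B x y \<le> B"
  using real_D[of x y] by (auto simp: trunc_def bound_def) (metis ereal_less_eq(3))

text \<open>No truncated distance exceeds \<open>B\<close>, so the triangle inequality survives a
  missing path, and a vertex in another component is as far away as possible, the first alternative
  of \<open>geodesic\<close>.\<close>

lemma graph_metric_trunc:
  assumes B: "bound B"
  shows "graph_metric (pverts G) (parcs G) (trunc B)"
proof
  have B0: "0 \<le> B" using B by (simp add: bound_def)
  show "finite (pverts G)" by (rule pair_finite_verts)
  show "parcs G \<subseteq> pverts G \<times> pverts G" using arc_fst_in_verts arc_snd_in_verts by fastforce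
  show "sym (parcs G)" using arc_swap by (auto simp: sym_def)
  show "0 \<le> trunc B x y" for x y by (rule trunc_nonneg[OF B0])
  show "trunc B x x = 0" if "x \<in> pverts G" for x using D_refl[OF that] by (simp add: trunc_def)
  show "trunc B x y = trunc B y x" for x y by (simp add: trunc_def D_sym)
  show "trunc B x z \<le> trunc B x y + trunc B y z"
    if V: "x \<in> pverts G" "y \<in> pverts G" "z \<in> pverts G" for x y z
  proof (cases "D x y = \<infinity> \<or> D y z = \<infinity>")
    case True
    then have "B \<le> trunc B x y + trunc B y z"
      using trunc_nonneg[OF B0, of x y] trunc_nonneg[OF B0, of y z] by (auto simp: trunc_def)
    then show ?thesis using trunc_le[OF B V(1,3)] by linarith
  next
    case False
    then have "D x z \<noteq> \<infinity>" using D_triangle[of x z y] by auto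
    then have "ereal (trunc B x z) \<le> ereal (trunc B x y + trunc B y z)"
      using D_triangle[of x z y] False real_D by (simp add: trunc_def flip: plus_ereal.simps(1))
    then show ?thesis by simp
  qed
  show "(\<forall>v\<in>pverts G. trunc B x v \<le> trunc B x u) \<or> (x, u) \<in> (tight (parcs G) (trunc B) u)\<^sup>*"
    if V: "x \<in> pverts G" "u \<in> pverts G" for x u
  proof (cases "D x u = \<infinity>")
    case True
    then show ?thesis using trunc_le[OF B V(1)] by (simp add: trunc_def)
  next
    case False
    have "{(y, z) \<in> parcs G. D y z + D z u \<le> D y u \<and> D y u \<noteq> \<infinity>} \<subseteq> tight (parcs G) (trunc B) u"
    proof (clarsimp simp: tight_def)
      fix y z assume yz: "D y z + D z u \<le> D y u" "D y u \<noteq> \<infinity>"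
      have fin: "D y z \<noteq> \<infinity>" "D z u \<noteq> \<infinity>" using yz D_nonneg[of y z] D_nonneg[of z u] by auto
      then have "ereal (trunc B y z + trunc B z u) \<le> ereal (trunc B y u)"
        using yz real_D by (simp add: trunc_def flip: plus_ereal.simps(1))
      then show "trunc B y z + trunc B z u \<le> trunc B y u" by simp
    qed
    note sub = rtrancl_mono[OF this]
    obtain q where "awalk x q u" "D x u = ereal (awalk_cost w q)" using False by (rule D_attained)
    then show ?thesis using subsetD[OF sub shortest_walk_tight] by blast
  qed
qed

lemma INF_attained:
  assumes "finite M" "M \<noteq> {}"
  obtains m where "m \<in> M" "(INF u\<in>M. D c u) = D c m"
proof -
  have "(INF u\<in>M. D c u) = Min (D c ` M)" using assms by (simp add: Min_Inf)
  moreover have "Min (D c ` M) \<in> D c ` M" using assms by (intro Min_in) auto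
  ultimately show ?thesis using that by auto
qed

lemma set_dist_trunc:
  assumes B: "bound B" and M: "M \<subseteq> pverts G" "M \<noteq> {}" and c: "c \<in> pverts G"
  shows "(INF u\<in>M. D c u) \<noteq> \<infinity> \<Longrightarrow> (INF u\<in>M. D c u) = ereal (set_dist (trunc B) c M)"
    and "(INF u\<in>M. D c u) = \<infinity> \<Longrightarrow> set_dist (trunc B) c M = B"
proof -
  have finM: "finite M" using M(1) pair_finite_verts finite_subset by blast
  obtain m where m: "m \<in> M" "(INF u\<in>M. D c u) = D c m" using INF_attained[OF finM M(2)] by blast
  have low: "D c m \<le> D c u" if "u \<in> M" for u using m(2) INF_lower[OF that, of "D c"] by simp
  {
    assume fin: "(INF u\<in>M. D c u) \<noteq> \<infinity>"
    have "trunc B c m \<le> trunc B c u" if u: "u \<in> M" for u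
    proof (cases "D c u = \<infinity>")
      case True
      then show ?thesis using trunc_le[OF B c, of m] m M by (auto simp: trunc_def)
    next
      case False
      have "ereal (trunc B c m) \<le> ereal (trunc B c u)"
        using low[OF u] False fin m(2) real_D by (simp add: trunc_def)
      then show ?thesis by simp
    qed
    then have "set_dist (trunc B) c M = trunc B c m"
      unfolding set_dist_def using finM m by (intro Min_eqI) auto
    then show "(INF u\<in>M. D c u) = ereal (set_dist (trunc B) c M)"
      using fin m(2) real_D by (simp add: trunc_def)
  }
  {
    assume inf: "(INF u\<in>M. D c u) = \<infinity>"
    then have "trunc B c u = B" if "u \<in> M" for u using low[OF that] m(2) by (simp add: trunc_def)
    then have "trunc B c ` M = {B}" using M by auto
    then show "set_dist (trunc B) c M = B" by (simp add: set_dist_def)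
  }
qed

lemma cluster_cost_infinite_iff:
  assumes "C \<subseteq> pverts G" "p > 0"
  shows "cluster_cost D p C M = \<infinity> \<longleftrightarrow> (\<exists>c\<in>C. (INF u\<in>M. D c u) = \<infinity>)"
proof -
  have "finite C" using assms(1) pair_finite_verts finite_subset by blast
  moreover have nn: "0 \<le> (INF u\<in>M. D c u)" for c using D_nonneg by (intro INF_greatest)
  have "(INF u\<in>M. D c u) ^ p = \<infinity> \<longleftrightarrow> (INF u\<in>M. D c u) = \<infinity>" for c
    using nn[of c] assms(2) by (cases "INF u\<in>M. D c u") (auto simp: ereal_power)
  ultimately show ?thesis by (simp add: cluster_cost_def sum_Pinfty)
qed

lemma cluster_cost_real:
  assumes B: "bound B" and M: "M \<subseteq> pverts G" "M \<noteq> {}" and C: "C \<subseteq> pverts G" and p: "p > 0"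
    and fin: "cluster_cost D p C M \<noteq> \<infinity>"
  shows "cluster_cost D p C M = ereal (real_cost (trunc B) p C M)"
proof -
  have "(INF u\<in>M. D c u) ^ p = ereal (set_dist (trunc B) c M ^ p)" if c: "c \<in> C" for c
    using set_dist_trunc(1)[OF B M, of c] fin c C cluster_cost_infinite_iff[OF C p, of M] by (auto simp: ereal_power)
  then show ?thesis by (simp add: cluster_cost_def real_cost_def)
qed

text \<open>A set of infinite cost must not look like an improvement after truncation; it does not
  once \<open>B\<close> is at least the cost of the local optimum.\<close>

lemma real_cost_of_infinite:
  assumes B: "bound B" "1 \<le> B" and M: "M \<subseteq> pverts G" "M \<noteq> {}" and C: "C \<subseteq> pverts G" and p: "p > 0"
    and inf: "cluster_cost D p C M = \<infinity>"
  shows "B \<le> real_cost (trunc B) p C M"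
proof -
  interpret graph_metric "pverts G" "parcs G" "trunc B" by (rule graph_metric_trunc[OF B(1)])
  obtain c where c: "c \<in> C" "(INF u\<in>M. D c u) = \<infinity>"
    using inf cluster_cost_infinite_iff[OF C p] by blast
  have "B \<le> B ^ p" using B(2) p by (intro self_le_power) auto
  also have "B ^ p = set_dist (trunc B) c M ^ p" using set_dist_trunc(2)[OF B(1) M _ c(2)] c C by auto
  also have "\<dots> \<le> real_cost (trunc B) p C M"
    unfolding real_cost_def using c C M finite_subset[OF C pair_finite_verts]
    by (intro member_le_sum zero_le_power set_dist_nonneg) auto
  finally show ?thesis .
qed

lemma bound_exists: "\<exists>B. bound B \<and> x \<le> B \<and> 1 \<le> B"
proof -
  define Y where "Y = (\<lambda>(x, y). real_of_ereal (D x y)) ` (pverts G \<times> pverts G)"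
  have fin: "finite Y" using pair_finite_verts by (simp add: Y_def)
  define B where "B = Max (insert 1 (insert x Y))"
  have "D u v \<le> ereal B" if "u \<in> pverts G" "v \<in> pverts G" "D u v \<noteq> \<infinity>" for u v
  proof -
    have "real_of_ereal (D u v) \<in> Y" using that by (auto simp: Y_def)
    then have "real_of_ereal (D u v) \<le> B" unfolding B_def using fin by (intro Max_ge) auto
    then have "ereal (real_of_ereal (D u v)) \<le> ereal B" by simp
    then show ?thesis using real_D[OF that(3)] by simp
  qed
  moreover have "1 \<le> B" "x \<le> B" unfolding B_def using fin by (auto intro!: Max_ge simp del: Max_insert)
  ultimately show ?thesis by (intro exI[of _ B]) (auto simp: bound_def)
qed

end

lemma local_search_output_facts:
  assumes out: "local_search_output X cost n \<epsilon> k s S" and X: "finite X"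
  shows "S \<subseteq> X" "card S \<le> k" "k \<le> card X"
    and "\<And>M. M \<subseteq> X \<Longrightarrow> card M \<le> k \<Longrightarrow> card (S - M) + card (M - S) \<le> s \<Longrightarrow>
       ereal (1 - \<epsilon> / real n) * cost S < cost M"
proof -
  obtain S0 where S0: "S0 \<subseteq> X" "card S0 = k" "(local_search_step X cost n \<epsilon> k s)\<^sup>*\<^sup>* S0 S"
    and stop: "\<not> (\<exists>S'. local_search_step X cost n \<epsilon> k s S S')"
    using out by (auto simp: local_search_output_def)
  show "k \<le> card X" using S0 card_mono[OF X] by blast
  from S0(3) have "S \<subseteq> X \<and> card S \<le> k"
    by (induction rule: rtranclp_induct) (use S0 in \<open>auto simp: local_search_step_def\<close>)
  then show "S \<subseteq> X" "card S \<le> k" by auto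
  show "ereal (1 - \<epsilon> / real n) * cost S < cost M"
    if "M \<subseteq> X" "card M \<le> k" "card (S - M) + card (M - S) \<le> s" for M
    using stop that finite_subset[OF _ X] unfolding local_search_step_def by (meson not_le)
qed

lemma (in weighted_graph) local_search_ratio:
  fixes \<epsilon> \<sigma> \<delta> \<theta> :: real
  assumes nominor: "\<not> has_clique_minor (parcs G) (pverts G) h" and h: "h > 0" and p: "p > 0"
    and gp: "good_parameters p h \<epsilon> \<sigma> \<delta> \<theta> r" and s: "4 * ((2 * r ^ 3 + 1) * r) \<le> s"
    and \<epsilon>: "0 < \<epsilon>" "\<epsilon> < 1/2" and C: "C \<subseteq> pverts G"
    and out: "local_search_output (pverts G) (cluster_cost D p C) (card C) \<epsilon> k s S"
  shows "cluster_cost D p C S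
     \<le> ereal (1 + \<epsilon>) * Min (cluster_cost D p C ` {T. T \<subseteq> pverts G \<and> card T \<le> k})"
proof -
  let ?V = "pverts G" and ?cost = "cluster_cost D p C"
  note S = local_search_output_facts[OF out pair_finite_verts]
  have finV: "finite ?V" by (rule pair_finite_verts)
  have finC: "finite C" using C finV finite_subset by blast
  \<comment> \<open>The loop did not continue with the unchanged set. This alone rules out an empty
    client set and infinite cost of \<open>S\<close>.\<close>
  have self: "ereal (1 - \<epsilon> / real (card C)) * ?cost S < ?cost S" using S by simp
  have Cne: "C \<noteq> {}"
  proof
    assume "C = {}"
    then have "?cost S = 0" by (simp add: cluster_cost_def)
    then show False using self by simp
  qed
  then have n: "card C \<ge> 1" using finC by (simp add: Suc_leI card_gt_0_iff)
  have "\<epsilon> / real (card C) \<le> \<epsilon> / 1" using n \<epsilon> by (intro divide_left_mono) auto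
  then have "0 < 1 - \<epsilon> / real (card C)" using \<epsilon> by simp
  then have "ereal (1 - \<epsilon> / real (card C)) * \<infinity> = \<infinity>" by (metis ereal_less(2) ereal_mult_eq_PInfty)
  then have fin: "?cost S \<noteq> \<infinity>" using self by auto
  have emp: "?cost {} = \<infinity>"
    using Cne cluster_cost_infinite_iff[OF C p, of "{}"] by (auto simp: top_ereal_def)
  have Sne: "S \<noteq> {}" using fin emp by auto
  let ?\<T> = "{T. T \<subseteq> ?V \<and> card T \<le> k}"
  have "finite ?\<T>" using finV by simp
  moreover have "{} \<in> ?\<T>" by simp
  ultimately have "Min (?cost ` ?\<T>) \<in> ?cost ` ?\<T>" by (intro Min_in) auto
  then obtain T where T: "T \<subseteq> ?V" "card T \<le> k" "Min (?cost ` ?\<T>) = ?cost T" by blast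
  show ?thesis
  proof (cases "?cost T = \<infinity>")
    case True
    then show ?thesis using T(3) \<epsilon> by simp
  next
    case Tfin: False
    have Tne: "T \<noteq> {}" using Tfin emp by auto
    \<comment> \<open>The bound is chosen twice: any bound shows that the cost of \<open>S\<close>
      is a real number \<open>x\<close>, and the final one must also exceed
      \<open>x\<close>.\<close>
    obtain B0 where "bound B0" using bound_exists by blast
    then obtain x where x: "?cost S = ereal x"
      using cluster_cost_real[OF _ S(1) Sne C p fin] by blast
    obtain B where B: "bound B" "x \<le> B" "1 \<le> B" using bound_exists by blast
    interpret graph_metric ?V "parcs G" "trunc B" by (rule graph_metric_trunc[OF B(1)])
    have rS: "real_cost (trunc B) p C S = x"
      using cluster_cost_real[OF B(1) S(1) Sne C p fin] x by simp
    have x0: "0 \<le> x" using real_cost_nonneg[OF C S(1) Sne, of p] rS by simp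
    have "real_cost (trunc B) p C S \<le> (1 + \<epsilon>) * real_cost (trunc B) p C T"
    proof (rule local_optimum_ratio[OF nominor h p gp refl s \<epsilon> C S(1) Sne S(2) T(1) Tne T(2) S(3)])
      fix M assume M: "M \<subseteq> ?V" "M \<noteq> {}" "card M \<le> k" "card (S - M) + card (M - S) \<le> s"
      have "ereal ((1 - \<epsilon> / real (card C)) * x) < ?cost M" using S(4)[OF M(1,3,4)] x by simp
      moreover have "(1 - \<epsilon> / real (card C)) * x \<le> 1 * x" using x0 \<epsilon> by (intro mult_right_mono) auto
      ultimately show "(1 - \<epsilon> / real (card C)) * real_cost (trunc B) p C S \<le> real_cost (trunc B) p C M"
        using cluster_cost_real[OF B(1) M(1,2) C p] real_cost_of_infinite[OF B(1,3) M(1,2) C p] B(2) rS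
        by (cases "?cost M = \<infinity>") auto
    qed
    then show ?thesis
      using cluster_cost_real[OF B(1) T(1) Tne C p Tfin] T(3) x rS by simp
  qed
qed

theorem theorem2:
  fixes \<K> :: "'v wgraph set" and p :: nat
  assumes "\<forall>\<G> \<in> \<K>. edge_weighted_graph \<G>"
    and "minor_closed \<K>"
    and "nontrivial_family \<K>"
    and "p > 0"
  shows "\<exists>c::real. c > 0 \<and>
    (\<forall>(\<epsilon>::real) G w C k S.
       0 < \<epsilon> \<and> \<epsilon> < 1/2 \<and> (G, w) \<in> \<K> \<and> C \<subseteq> pverts G \<and> 0 < k \<and>
       local_search_output (pverts G) (cluster_cost (graph_dist (G, w)) p C)
         (card C) \<epsilon> k (nat \<lfloor>1 / \<epsilon> powr c\<rfloor>) S \<longrightarrow>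
       cluster_cost (graph_dist (G, w)) p C S
         \<le> ereal (1 + \<epsilon>) *
           Min (cluster_cost (graph_dist (G, w)) p C ` {T. T \<subseteq> pverts G \<and> card T \<le> k}))"
proof -
  obtain H where H: "pair_graph H" "H \<notin> fst ` \<K>" using assms(3) by (auto simp: nontrivial_family_def)
  define h where "h = card (pverts H)"
  have pg: "pair_graph G" if "(G, w) \<in> \<K>" for G w
    using assms(1) that by (auto simp: edge_weighted_graph_def)
  have nominor: "\<not> has_clique_minor (parcs G) (pverts G) h" if K: "(G, w) \<in> \<K>" for G w
  proof
    assume "has_clique_minor (parcs G) (pverts G) h"
    then have "is_minor H G" using clique_minor_imp_is_minor[OF pg[OF K] H(1)] by (simp add: h_def)
    moreover have "G \<in> fst ` \<K>" using K by force
    ultimately show False using assms(2) H unfolding minor_closed_def by blast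
  qed
  show ?thesis
  proof (cases "h = 0")
    case True
    \<comment> \<open>The omitted graph has no vertices here; every graph contains it as a minor, so
      the family is empty.\<close>
    have "has_clique_minor E V 0" for E V :: "_ set"
      unfolding has_clique_minor_def by (rule exI[of _ "{}"]) (simp add: clique_model_def)
    then have "(G, w) \<notin> \<K>" for G w using nominor True by blast
    then show ?thesis by (intro exI[of _ 1]) auto
  next
    case False
    then obtain c :: nat where c: "c > 0"
      and par: "\<And>\<epsilon>::real. 0 < \<epsilon> \<Longrightarrow> \<epsilon> < 1/2 \<Longrightarrow> \<exists>\<sigma> \<delta> \<theta> r. good_parameters p h \<epsilon> \<sigma> \<delta> \<theta> r \<and>
         real (4 * ((2 * r ^ 3 + 1) * r)) \<le> (1 / \<epsilon>) ^ c"
      using good_parameters_exist[of h p] by auto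
    show ?thesis
    proof (intro exI[of _ "real c"] conjI allI impI; (elim conjE)?)
      show "0 < real c" using c by simp
      fix \<epsilon> :: real and G w C k S
      assume \<epsilon>: "0 < \<epsilon>" "\<epsilon> < 1/2" and K: "(G, w) \<in> \<K>" and C: "C \<subseteq> pverts G"
        and out: "local_search_output (pverts G) (cluster_cost (graph_dist (G, w)) p C)
          (card C) \<epsilon> k (nat \<lfloor>1 / \<epsilon> powr real c\<rfloor>) S"
      obtain \<sigma> \<delta> \<theta> r where gp: "good_parameters p h \<epsilon> \<sigma> \<delta> \<theta> r"
        and r: "real (4 * ((2 * r ^ 3 + 1) * r)) \<le> (1 / \<epsilon>) ^ c" using par[OF \<epsilon>] by blast
      have "(1 / \<epsilon>) ^ c = 1 / \<epsilon> powr real c" using \<epsilon> by (simp add: powr_realpow power_divide)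
      \<comment> \<open>The left side is a natural number, so it stays below the bound after
        rounding down.\<close>
      then have s: "4 * ((2 * r ^ 3 + 1) * r) \<le> nat \<lfloor>1 / \<epsilon> powr real c\<rfloor>" using r by (metis le_nat_floor)
      interpret weighted_graph G w
      proof (intro weighted_graph.intro weighted_graph_axioms.intro pg[OF K])
        have e: "\<forall>(u, v)\<in>parcs G. 0 \<le> w (u, v) \<and> w (u, v) = w (v, u)"
          using assms(1) K by (auto simp: edge_weighted_graph_def)
        show "0 \<le> w e" if "e \<in> parcs G" for e using e that by (cases e) auto
        show "w (u, v) = w (v, u)" if "(u, v) \<in> parcs G" for u v using e that by auto
      qed
      show "cluster_cost (graph_dist (G, w)) p C S \<le> ereal (1 + \<epsilon>) *
           Min (cluster_cost (graph_dist (G, w)) p C ` {T. T \<subseteq> pverts G \<and> card T \<le> k})"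
        using local_search_ratio[OF nominor[OF K] _ assms(4) gp s \<epsilon> C out] False by simp
    qed
  qed
qed

end
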